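(* Let $k,\ell \geq 3$ be odd integers and let $n = \frac{k\ell+1}{2}$. The edges of the bumpy wheel $BW_{k,\ell}$ cannot be partitioned into $n$ plane subgraphs if and only if $\ell > 5$, or $\ell = 5$ and $k > 3$.
   Context: A geometric graph is a graph drawn in the plane whose vertices are points in general position (no three collinear) and whose edges are straight-line segments; it is plane if no two edges cross, i.e. share a point of their relative interiors (sharing an endpoint is allowed). A partition of a graph $G$ into subgraphs is a set of edge-disjoint subgraphs whose union is $G$. For odd integers $k,\ell\ge 3$, the bumpy wheel $BW_{k,\ell}$ is the complete geometric graph on the following set of $k\ell+1$ points: take a regular $k$-gon with center $v_0$ and replace each of its $k$ vertices by a group of $\ell$ points that are $\varepsilon$-close for a sufficiently small $\varepsilon>0$, such that all $k\ell$ points other than $v_0$ lie on the convex hull (in convex position), $v_0$ is the only interior point, and the convex hull of any $\frac{k+1}{2}$ consecutive groups does not contain $v_0$. *)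

theory Defs
  imports "HOL-Analysis.Analysis"
begin

text \<open>The plane is \<^typ>\<open>complex\<close>. An edge is the set of its two endpoints; it is drawn as the
  segment \<^term>\<open>convex hull e\<close>.\<close>

record geom_graph =
  verts :: "complex set"
  edges :: "complex set set"

definition general_position :: "complex set \<Rightarrow> bool" where
  "general_position V \<longleftrightarrow>
     (\<forall>a\<in>V. \<forall>b\<in>V. \<forall>c\<in>V. a \<noteq> b \<and> a \<noteq> c \<and> b \<noteq> c \<longrightarrow> \<not> collinear {a, b, c})"

definition all_edges :: "complex set \<Rightarrow> complex set set" where
  "all_edges V = {{a, b} | a b. a \<in> V \<and> b \<in> V \<and> a \<noteq> b}"

definition geometric_graph :: "geom_graph \<Rightarrow> bool" where
  "geometric_graph G \<longleftrightarrow>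
     finite (verts G) \<and> general_position (verts G) \<and> edges G \<subseteq> all_edges (verts G)"

definition complete_geometric_graph :: "geom_graph \<Rightarrow> bool" where
  "complete_geometric_graph G \<longleftrightarrow> geometric_graph G \<and> edges G = all_edges (verts G)"

definition crossing :: "complex set \<Rightarrow> complex set \<Rightarrow> bool" where
  "crossing e f \<longleftrightarrow> rel_interior (convex hull e) \<inter> rel_interior (convex hull f) \<noteq> {}"

definition plane :: "geom_graph \<Rightarrow> bool" where
  "plane G \<longleftrightarrow> (\<forall>e\<in>edges G. \<forall>f\<in>edges G. e \<noteq> f \<longrightarrow> \<not> crossing e f)"

definition subgraph :: "geom_graph \<Rightarrow> geom_graph \<Rightarrow> bool" where
  "subgraph H G \<longleftrightarrow>
     verts H \<subseteq> verts G \<and> edges H \<subseteq> edges G \<and> edges H \<subseteq> all_edges (verts H)"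

definition graph_partition :: "geom_graph set \<Rightarrow> geom_graph \<Rightarrow> bool" where
  "graph_partition \<H> G \<longleftrightarrow>
     (\<forall>H\<in>\<H>. subgraph H G) \<and>
     pairwise (\<lambda>H K. edges H \<inter> edges K = {}) \<H> \<and>
     (\<Union>H\<in>\<H>. verts H) = verts G \<and>
     (\<Union>H\<in>\<H>. edges H) = edges G"

definition plane_partitionable :: "geom_graph \<Rightarrow> nat \<Rightarrow> bool" where
  "plane_partitionable G n \<longleftrightarrow>
     (\<exists>\<H>. finite \<H> \<and> card \<H> = n \<and> graph_partition \<H> G \<and> (\<forall>H\<in>\<H>. plane H))"

text \<open>Every regular \<^term>\<open>k\<close>-gon with center \<^term>\<open>v0\<close> arises for some \<^term>\<open>w \<noteq> 0\<close>, which
  encodes its radius and its rotation.\<close>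

definition polygon_corner :: "nat \<Rightarrow> complex \<Rightarrow> complex \<Rightarrow> nat \<Rightarrow> complex" where
  "polygon_corner k v0 w i = v0 + w * cis (2 * pi * real i / real k)"

text \<open>\<^term>\<open>bumpy_wheel k l v0 w \<epsilon> G\<close>: the graph \<^term>\<open>G\<close> is a realisation of the bumpy wheel
  in which \<^term>\<open>P i\<close> is the group of \<^term>\<open>l\<close> points that replaces the \<^term>\<open>i\<close>-th corner of
  the \<^term>\<open>k\<close>-gon, at distance less than \<^term>\<open>\<epsilon>\<close> from it. The indices of consecutive groups
  are cyclic.\<close>

definition bumpy_wheel ::
  "nat \<Rightarrow> nat \<Rightarrow> complex \<Rightarrow> complex \<Rightarrow> real \<Rightarrow> geom_graph \<Rightarrow> bool" where
  "bumpy_wheel k l v0 w \<epsilon> G \<longleftrightarrow>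
     complete_geometric_graph G \<and>
     (\<exists>P :: nat \<Rightarrow> complex set.
        (\<forall>i<k. finite (P i) \<and> card (P i) = l \<and> P i \<subseteq> ball (polygon_corner k v0 w i) \<epsilon>) \<and>
        disjoint_family_on P {..<k} \<and>
        v0 \<notin> (\<Union>i<k. P i) \<and>
        verts G = insert v0 (\<Union>i<k. P i) \<and>
        (\<forall>p \<in> (\<Union>i<k. P i). p extreme_point_of (convex hull (verts G))) \<and>
        verts G \<inter> interior (convex hull (verts G)) = {v0} \<and>
        (\<forall>i<k. v0 \<notin> convex hull (\<Union>j<(k + 1) div 2. P ((i + j) mod k))))"

text \<open>Bumpy wheels exist for every \<^term>\<open>\<epsilon> > 0\<close>, so statements about all of them are not
  vacuous. The witness has all groups on the circumcircle of the polygon.\<close>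


lemma cis_eq_cis_iff: "cis x = cis y \<longleftrightarrow> (\<exists>m::int. x = y + 2 * pi * m)"
proof -
  have "cis x = cis y \<longleftrightarrow> sin x = sin y \<and> cos x = cos y"
    by (auto simp: complex_eq_iff)
  then show ?thesis by (simp only: sin_cos_eq_iff)
qed

lemma cis_minus_one_bound: "cmod (1 - cis x) \<le> \<bar>x\<bar>"
  using dist_exp_i_1[of x] abs_sin_x_le_abs_x[of "x / 2"]
  by (simp add: cis_conv_exp norm_minus_commute)

lemma orthogonal_complex:
  assumes "a \<noteq> 0" "a \<bullet> x = 0"
  shows "\<exists>c. x = c *\<^sub>R (\<i> * a)"
proof -
  have o: "Re a * Re x + Im a * Im x = 0" using assms by (simp add: inner_complex_def)
  have n: "(Re a)\<^sup>2 + (Im a)\<^sup>2 \<noteq> 0" using assms by (simp add: complex_eq_iff sum_power2_eq_zero_iff)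
  define c where "c = (Im x * Re a - Re x * Im a) / ((Re a)\<^sup>2 + (Im a)\<^sup>2)"
  have "Re x * ((Re a)\<^sup>2 + (Im a)\<^sup>2) = - (Im x * Re a - Re x * Im a) * Im a"
    using o by algebra
  moreover have "Im x * ((Re a)\<^sup>2 + (Im a)\<^sup>2) = (Im x * Re a - Re x * Im a) * Re a"
    using o by algebra
  ultimately have "x = c *\<^sub>R (\<i> * a)"
    using n by (simp add: complex_eq_iff c_def nonzero_eq_divide_eq minus_divide_left algebra_simps
        del: sum_power2_eq_zero_iff)
  then show ?thesis ..
qed

lemma cis_grid_inj:
  fixes k l i i' j j' :: nat and \<eta> :: real
  assumes "i < k" "i' < k" "j < l" "j' < l" "0 < \<eta>" "\<eta> * real l < 1"
    and "cis (pi / k * (2 * real i + \<eta> * real j)) = cis (pi / k * (2 * real i' + \<eta> * real j'))"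
  shows "i = i' \<and> j = j'"
proof -
  have k: "k > 0" using assms by simp
  from assms(7) obtain m :: int
    where "pi / k * (2 * real i + \<eta> * real j) = pi / k * (2 * real i' + \<eta> * real j') + 2 * pi * m"
    unfolding cis_eq_cis_iff by blast
  then have "pi * (2 * real i + \<eta> * real j) = pi * (2 * i' + \<eta> * j' + 2 * m * k)"
    using k by (simp add: field_simps)
  then have eq: "2 * i + \<eta> * j = 2 * i' + \<eta> * j' + 2 * m * k"
    by simp
  have b: "\<eta> * j < 1" "\<eta> * j' < 1" "\<eta> * j \<ge> 0" "\<eta> * j' \<ge> 0"
    using assms order_less_trans[OF mult_strict_left_mono[of "real j" l \<eta>]]
      order_less_trans[OF mult_strict_left_mono[of "real j'" l \<eta>]] by simp_all
  have "real_of_int (2 * int i - 2 * int i' - 2 * m * int k) = \<eta> * j' - \<eta> * j"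
    using eq by simp
  then have "real_of_int (2 * int i - 2 * int i' - 2 * m * int k) < 1"
    "real_of_int (2 * int i - 2 * int i' - 2 * m * int k) > -1"
    using b by linarith+
  then have z: "2 * int i - 2 * int i' - 2 * m * int k = 0"
    by linarith
  then have "int i - int i' = m * int k" by linarith
  moreover have "\<bar>int i - int i'\<bar> < int k" using assms by linarith
  ultimately have "\<bar>m\<bar> * int k < 1 * int k" by (simp add: abs_mult)
  then have "\<bar>m\<bar> < 1" using k by (simp add: mult_less_cancel_right1)
  then have "m = 0" by simp
  then show ?thesis using z eq assms by auto
qed

lemma cis_grid_not_antipodal:
  fixes k l i i' j j' :: nat and \<eta> :: real
  assumes "odd k" "j < l" "j' < l" "0 < \<eta>" "\<eta> * real l < 1"
  shows "cis (pi / k * (2 * real i + \<eta> * real j)) \<noteq> - cis (pi / k * (2 * real i' + \<eta> * real j'))"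
proof
  assume "cis (pi / k * (2 * real i + \<eta> * real j)) = - cis (pi / k * (2 * real i' + \<eta> * real j'))"
  also have "\<dots> = cis (pi / k * (2 * real i' + \<eta> * real j') + pi)"
    by (simp add: cis_mult[symmetric])
  finally obtain m :: int
    where "pi / k * (2 * real i + \<eta> * real j) = pi / k * (2 * real i' + \<eta> * real j') + pi + 2 * pi * m"
    unfolding cis_eq_cis_iff by blast
  then have "pi * (2 * real i + \<eta> * real j) = pi * (2 * i' + \<eta> * j' + (2 * m + 1) * k)"
    using odd_pos[OF \<open>odd k\<close>] by (simp add: field_simps)
  then have eq: "2 * i + \<eta> * j = 2 * i' + \<eta> * j' + (2 * m + 1) * k"
    by simp
  have b: "\<eta> * j < 1" "\<eta> * j' < 1" "\<eta> * j \<ge> 0" "\<eta> * j' \<ge> 0"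
    using assms order_less_trans[OF mult_strict_left_mono[of "real j" l \<eta>]]
      order_less_trans[OF mult_strict_left_mono[of "real j'" l \<eta>]] by simp_all
  have "real_of_int (2 * int i - 2 * int i' - (2 * m + 1) * int k) = \<eta> * j' - \<eta> * j"
    using eq by simp
  then have "real_of_int (2 * int i - 2 * int i' - (2 * m + 1) * int k) < 1"
    "real_of_int (2 * int i - 2 * int i' - (2 * m + 1) * int k) > -1"
    using b by linarith+
  then have "2 * int i - 2 * int i' - (2 * m + 1) * int k = 0"
    by linarith
  then have "(2 * m + 1) * int k = 2 * (int i - int i')" by (simp only: right_diff_distrib)
  then have "even ((2 * m + 1) * int k)" by (metis dvd_triv_left)
  then show False using \<open>odd k\<close> by simp
qed

lemma sphere_not_between:
  fixes c :: "'a::euclidean_space"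
  assumes "x \<in> sphere c r" "a \<in> cball c r" "b \<in> cball c r" "x \<noteq> a" "x \<noteq> b"
  shows "\<not> between (a, b) x"
proof
  assume "between (a, b) x"
  then have "x \<in> open_segment a b"
    using assms by (simp add: between_mem_segment open_segment_def)
  then show False
    using dist_decreases_open_segment[of x a b c] assms by auto
qed

lemma bumpy_wheel_exists:
  fixes k l :: nat and v0 w :: complex and \<epsilon> :: real
  assumes "odd k" "k \<ge> 3" "l \<ge> 1" "w \<noteq> 0" "\<epsilon> > 0"
  shows "\<exists>G. bumpy_wheel k l v0 w \<epsilon> G"
proof -
  have k0: "k > 0" and l0: "l > 0" using assms by auto
  define \<eta> where "\<eta> = min (1 / (2 * l)) (\<epsilon> / (4 * l * cmod w))"
  have \<eta>: "\<eta> > 0" "\<eta> * l \<le> 1/2" "\<eta> * l * cmod w \<le> \<epsilon> / 4"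
    using assms by (auto simp: \<eta>_def min_def field_simps)
  then have \<eta>1: "\<eta> * l < 1" by simp
  have \<eta>j: "\<eta> * j < \<eta> * l" if "j < l" for j
    using that \<eta> by simp
  define t where "t i j = pi / k * (2 * real i + \<eta> * real j)" for i j :: nat
  define f where "f i j = v0 + w * cis (t i j)" for i j
  define P where "P i = f i ` {..<l}" for i
  define S where "S = (\<Union>i<k. P i)"
  define V where "V = insert v0 S"
  define r where "r = cmod w"
  have r: "r > 0" using assms by (simp add: r_def)
  have inj: "i = i' \<and> j = j'" if "f i j = f i' j'" "i < k" "i' < k" "j < l" "j' < l" for i i' j j'
    using cis_grid_inj[of i k i' j l j' \<eta>] that \<eta> \<eta>1 \<open>w \<noteq> 0\<close> by (auto simp: f_def t_def)
  have sph: "f i j \<in> sphere v0 r" for i j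
    by (simp add: f_def r_def dist_norm norm_mult)
  have S_sph: "S \<subseteq> sphere v0 r" using sph by (auto simp: S_def P_def)
  have v0S: "v0 \<notin> S" using S_sph r by auto
  have V_cball: "V \<subseteq> cball v0 r" using S_sph r by (auto simp: V_def)
  have hull_cball: "convex hull V \<subseteq> cball v0 r"
    using V_cball by (simp add: subset_hull)
  have anti: "p - v0 \<noteq> - (q - v0)" if pq: "p \<in> S" "q \<in> S" for p q
  proof -
    obtain i j i' j' where *: "j < l" "j' < l" "p = f i j" "q = f i' j'"
      using pq by (auto simp: S_def P_def)
    then have "cis (t i j) \<noteq> - cis (t i' j')"
      unfolding t_def using cis_grid_not_antipodal assms \<eta> \<eta>1 by blast
    then have "w * cis (t i j) \<noteq> w * (- cis (t i' j'))"
      using \<open>w \<noteq> 0\<close> mult_left_cancel by blast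
    then show ?thesis using * by (simp add: f_def)
  qed
  have ncol0: "\<not> collinear {v0, p, q}" if pq: "p \<in> S" "q \<in> S" "p \<noteq> q" for p q
  proof -
    have d: "norm (p - v0) = r" "norm (q - v0) = r"
      using pq S_sph by (auto simp: dist_norm norm_minus_commute)
    have "\<not> between (v0, q) p"  "\<not> between (p, v0) q"
      using sphere_not_between[of p v0 r v0 q] sphere_not_between[of q v0 r p v0]
        pq S_sph v0S d r by (auto simp: dist_norm norm_minus_commute)
    moreover have "\<not> between (p, q) v0"
    proof
      assume "between (p, q) v0"
      then obtain u where u: "0 \<le> u" "u \<le> 1" "v0 = (1 - u) *\<^sub>R p + u *\<^sub>R q"
        by (auto simp: between_mem_segment in_segment)
      then have e: "(1 - u) *\<^sub>R (p - v0) = - (u *\<^sub>R (q - v0))"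
        by (simp add: algebra_simps)
      then have "norm ((1 - u) *\<^sub>R (p - v0)) = norm (u *\<^sub>R (q - v0))" by simp
      then have "u = 1 / 2" using d u r by simp
      then have "(1 / 2) *\<^sub>R (p - v0) = (1 / 2) *\<^sub>R (- (q - v0))"
        using e by (simp only: scaleR_minus_right) simp
      then have "p - v0 = - (q - v0)" unfolding scaleR_cancel_left by simp
      then show False using anti pq by blast
    qed
    ultimately show ?thesis
      by (simp add: collinear_between_cases between_commute)
  qed
  have gp: "general_position V"
    unfolding general_position_def
  proof (intro ballI impI; elim conjE)
    fix a b c assume abc: "a \<in> V" "b \<in> V" "c \<in> V" "a \<noteq> b" "a \<noteq> c" "b \<noteq> c"
    consider "a = v0" "b \<in> S" "c \<in> S" | "b = v0" "a \<in> S" "c \<in> S" | "c = v0" "a \<in> S" "b \<in> S"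
      | "a \<in> S" "b \<in> S" "c \<in> S"
      using abc by (auto simp: V_def)
    then show "\<not> collinear {a, b, c}"
    proof cases
      case 1 then show ?thesis using ncol0 abc by simp
    next
      case 2 then show ?thesis using ncol0[of a c] abc by (simp add: insert_commute)
    next
      case 3 then show ?thesis using ncol0[of a b] abc by (simp add: insert_commute)
    next
      case 4
      then have "a \<in> sphere v0 r" "b \<in> sphere v0 r" "c \<in> sphere v0 r"
        using S_sph by auto
      then show ?thesis
        using sphere_not_between abc unfolding collinear_between_cases
        by (metis mem_cball mem_sphere order_refl)
    qed
  qed
  have finS: "finite S" by (simp add: S_def P_def)
  have corner: "f i 0 = polygon_corner k v0 w i" for i
    by (simp add: f_def t_def polygon_corner_def mult_ac)
  have close: "P i \<subseteq> ball (polygon_corner k v0 w i) \<epsilon>" for i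
  proof
    fix p assume "p \<in> P i"
    then obtain j where j: "j < l" "p = f i j" by (auto simp: P_def)
    have "cis (t i j) = cis (t i 0) * cis (pi / k * (\<eta> * j))"
      by (simp add: cis_mult t_def algebra_simps)
    then have "f i 0 - f i j = w * cis (t i 0) * (1 - cis (pi / k * (\<eta> * j)))"
      by (simp add: f_def algebra_simps)
    then have d: "dist (f i 0) (f i j) = cmod w * cmod (1 - cis (pi / k * (\<eta> * j)))"
      by (simp add: dist_norm norm_mult)
    have "cmod (1 - cis (pi / k * (\<eta> * j))) \<le> \<bar>pi / k * (\<eta> * j)\<bar>"
      by (rule cis_minus_one_bound)
    also have "\<bar>pi / k * (\<eta> * j)\<bar> \<le> 2 * (\<eta> * l)"
    proof -
      have "pi / k \<le> 2" using assms(2) pi_less_4 by (simp add: field_simps)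
      moreover have "0 \<le> \<eta> * real j" "\<eta> * real j \<le> \<eta> * real l"
        using \<eta>(1) \<eta>j[OF j(1)] by auto
      ultimately have "pi / k * (\<eta> * j) \<le> 2 * (\<eta> * l)"
        using \<eta>(1) j(1) by (intro mult_mono) auto
      then show ?thesis using \<eta>(1) by simp
    qed
    finally have "cmod w * cmod (1 - cis (pi / k * (\<eta> * j))) \<le> cmod w * (2 * (\<eta> * l))"
      by (rule mult_left_mono) simp
    then have "dist (f i 0) (f i j) \<le> 2 * (\<eta> * l * cmod w)"
      unfolding d by (simp add: mult_ac)
    also have "\<dots> < \<epsilon>" using \<eta> assms by linarith
    finally show "p \<in> ball (polygon_corner k v0 w i) \<epsilon>"
      using j corner by simp
  qed
  have ext: "p extreme_point_of (convex hull V)" if p: "p \<in> S" for p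
    unfolding extreme_point_of_def
  proof (intro conjI ballI)
    show "p \<in> convex hull V" using p by (simp add: V_def hull_inc)
    fix a b assume ab: "a \<in> convex hull V" "b \<in> convex hull V"
    show "p \<notin> open_segment a b"
    proof
      assume "p \<in> open_segment a b"
      then have "dist v0 p < dist v0 a \<or> dist v0 p < dist v0 b"
        by (rule dist_decreases_open_segment)
      then show False using ab hull_cball p S_sph by fastforce
    qed
  qed
  have v0_int: "v0 \<in> interior (convex hull V)"
  proof (rule ccontr)
    let ?H = "convex hull V"
    assume n: "v0 \<notin> interior ?H"
    have cor: "f i 0 \<in> ?H" if "i < k" for i
      using that l0 by (auto simp: V_def S_def P_def intro!: hull_inc)
    obtain a where a: "a \<noteq> 0" "\<And>x. x \<in> ?H \<Longrightarrow> a \<bullet> v0 \<le> a \<bullet> x"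
    proof (cases "rel_interior ?H = interior ?H")
      case True
      have "v0 \<in> ?H" by (simp add: V_def hull_inc)
      with True n that show ?thesis
        using supporting_hyperplane_rel_boundary[of ?H v0] by (metis convex_convex_hull)
    next
      case False
      then have "interior ?H = {}" using rel_interior_nonempty_interior by blast
      then obtain a b where ab: "a \<noteq> 0" "?H \<subseteq> {x. a \<bullet> x = b}"
        using empty_interior_subset_hyperplane[of ?H] convex_convex_hull by metis
      have "v0 \<in> ?H" by (simp add: V_def hull_inc)
      then have "a \<bullet> v0 = b" using ab by blast
      moreover have "a \<bullet> x = b" if "x \<in> ?H" for x using ab that by blast
      ultimately show ?thesis using ab(1) that[of a] by simp
    qed
    have "(\<Sum>i<k. cis (2 * pi * i / k)) = 0"
      using sum.reindex_bij_betw[OF Complex.bij_betw_roots_unity[OF k0], of "\<lambda>z. z"]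
        sum_roots_unity[of k] assms(2) by simp
    then have "(\<Sum>i<k. w * cis (2 * pi * i / k)) = 0"
      by (simp flip: sum_distrib_left)
    then have "(\<Sum>i<k. f i 0 - v0) = 0"
      by (simp add: corner polygon_corner_def)
    then have "(\<Sum>i<k. a \<bullet> (f i 0 - v0)) = 0"
      by (simp flip: inner_sum_right)
    moreover have "a \<bullet> (f i 0 - v0) \<ge> 0" if "i < k" for i
      using a cor that by (simp add: inner_diff_right)
    ultimately have z: "a \<bullet> (f i 0 - v0) = 0" if "i < k" for i
      using that sum_nonneg_eq_0_iff[of "{..<k}" "\<lambda>i. a \<bullet> (f i 0 - v0)"] by simp
    obtain c0 c1 where c: "f 0 0 - v0 = c0 *\<^sub>R (\<i> * a)" "f 1 0 - v0 = c1 *\<^sub>R (\<i> * a)"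
      using orthogonal_complex a(1) z[of 0] z[of 1] assms(2) by force
    have "collinear {v0, f 0 0, f 1 0}"
    proof -
      have "f 0 0 = v0 + c0 *\<^sub>R (\<i> * a)" "f 1 0 = v0 + c1 *\<^sub>R (\<i> * a)"
        using c by (simp_all add: algebra_simps)
      then have "\<exists>c. x = v0 + c *\<^sub>R (\<i> * a)" if "x \<in> {v0, f 0 0, f 1 0}" for x
        using that by (auto intro: exI[of _ 0])
      then show ?thesis unfolding collinear_alt by blast
    qed
    moreover have "f 0 0 \<in> S" "f 1 0 \<in> S" "f 0 0 \<noteq> f 1 0"
      using assms inj[of 0 0 1 0] l0 by (auto simp: S_def P_def)
    ultimately show False using ncol0 by blast
  qed
  have int_only: "V \<inter> interior (convex hull V) = {v0}"
  proof -
    have "interior (convex hull V) \<subseteq> ball v0 r"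
      using interior_mono[OF hull_cball] by simp
    then have "p \<notin> interior (convex hull V)" if "p \<in> S" for p
      using S_sph that by fastforce
    then show ?thesis using v0_int by (auto simp: V_def)
  qed
  have sep: "v0 \<notin> convex hull (\<Union>m<(k + 1) div 2. P ((i + m) mod k))" for i
  proof -
    define mid where "mid = pi / k * (2 * i + (real k - 1) / 2)"
    define a where "a = w * cis mid"
    have "(\<Union>m<(k + 1) div 2. P ((i + m) mod k)) \<subseteq> {x. a \<bullet> x > a \<bullet> v0}"
    proof clarify
      fix m p assume m: "m < (k + 1) div 2" and "p \<in> P ((i + m) mod k)"
      then obtain j where j: "j < l" "p = f ((i + m) mod k) j" by (auto simp: P_def)
      have "i + m = (i + m) mod k + k * ((i + m) div k)" by simp
      then have "real (i + m) = real ((i + m) mod k) + real k * real ((i + m) div k)"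
        by (metis of_nat_add of_nat_mult)
      then have tt: "t (i + m) j = t ((i + m) mod k) j + 2 * pi * real ((i + m) div k)"
        using k0 by (simp add: t_def field_simps)
      have cc: "cis (t ((i + m) mod k) j) = cis (t (i + m) j)"
        unfolding tt by (simp add: cis_mult[symmetric] cis_multiple_2pi)
      define s where "s = pi / k * (2 * m - (real k - 1) / 2 + \<eta> * j)"
      have ts: "t (i + m) j = mid + s"
        by (simp add: t_def mid_def s_def algebra_simps)
      have m2: "2 * real m \<le> real k - 1" using m \<open>odd k\<close> by (elim oddE) auto
      have ej: "0 \<le> \<eta> * j" "\<eta> * j < 1/2"
        using order_less_le_trans[OF \<eta>j[OF j(1)] \<eta>(2)] \<eta>(1) by simp_all
      have sb: "\<bar>2 * m - (real k - 1) / 2 + \<eta> * j\<bar> < k / 2"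
        using m2 ej assms(2) by (simp add: abs_less_iff field_simps)
      have "\<bar>s\<bar> = pi / k * \<bar>2 * m - (real k - 1) / 2 + \<eta> * j\<bar>"
        by (simp add: s_def abs_mult)
      also have "\<dots> < pi / k * (k / 2)"
        using sb k0 by (intro mult_strict_left_mono) auto
      finally have "\<bar>s\<bar> < pi / 2" using k0 by simp
      then have "cos s > 0" by (intro cos_gt_zero_pi) auto
      have "a \<bullet> (p - v0) = (w * cis mid) \<bullet> (w * cis mid * cis s)"
        using j cc ts by (simp add: a_def f_def cis_mult mult.assoc)
      also have "\<dots> = (cmod (w * cis mid))\<^sup>2 * cos s"
        by (simp only: cmod_power2) (simp add: inner_complex_def power2_eq_square algebra_simps)
      finally have "a \<bullet> (p - v0) > 0" using \<open>cos s > 0\<close> assms by (simp add: norm_mult)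
      then show "a \<bullet> v0 < a \<bullet> p" by (simp add: inner_diff_right)
    qed
    then have "convex hull (\<Union>m<(k + 1) div 2. P ((i + m) mod k)) \<subseteq> {x. a \<bullet> x > a \<bullet> v0}"
      by (intro hull_minimal convex_halfspace_gt)
    then show ?thesis by auto
  qed
  define G where "G = \<lparr>verts = V, edges = all_edges V\<rparr>"
  have "complete_geometric_graph G"
    using gp finS by (simp add: complete_geometric_graph_def geometric_graph_def G_def V_def)
  moreover have "card (P i) = l" if "i < k" for i
    unfolding P_def using that inj by (subst card_image) (auto simp: inj_on_def)
  moreover have "disjoint_family_on P {..<k}"
    using inj by (auto simp: disjoint_family_on_def P_def)
  ultimately have "bumpy_wheel k l v0 w \<epsilon> G"
    unfolding bumpy_wheel_def using close ext int_only sep v0S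
    by (intro conjI exI[of _ P]) (auto simp: G_def V_def S_def P_def)
  then show ?thesis ..
qed

end

theory Submission
  imports Defs
begin

text \<open>Number the \<^term>\<open>2 * h + 1\<close> outer points by angle around the centre. Which edges cross then
  depends on the indices only. Any two of the chords of length \<^term>\<open>h\<close> cross or share an
  endpoint, so each of the \<^term>\<open>h + 1\<close> plane subgraphs contains two of them, with a common
  endpoint (the apex), except for one subgraph that contains a single one. A chord of length
  \<^term>\<open>h - 1\<close> fits only next to one of its two neighbours of length \<^term>\<open>h\<close>, and as all of these
  chords must be placed, the choice made for one of them propagates along the circle. All subgraphs
  but one contain two chords that join corresponding points of groups \<^term>\<open>(k - 1) div 2\<close> apart;
  such a subgraph leaves room for very few spokes, and a spoke to a point in the middle of a group
  fixes the choice at that point. A few such spokes force contradictory choices. Only when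
  \<^term>\<open>k = 3\<close> and the single longest chord joins an end of a group to the middle of the next group,
  the chords of length \<^term>\<open>h - 2\<close> are needed as well, and these require \<^term>\<open>l > 5\<close>.
  Conversely, for \<^term>\<open>l = 3\<close> double stars around the apices leave exactly half of the spokes,
  which fit beside the single longest chord.\<close>

section \<open>Orientation and crossing segments\<close>

text \<open>Counting shapes the argument. There are \<open>2 * h + 1\<close> longest chords and
  equally many chords \<open>R\<close>, which join corresponding points of groups
  \<open>(k - 1) div 2\<close> apart, but only \<open>h + 1\<close> colours, each with room for two
  of either kind. So exactly one colour is short of a longest chord and exactly one, possibly a
  different one, is short of an \<open>R\<close>. The latter is the obstacle, since a colour
  confines its spokes tightly only if it has both chords \<open>R\<close>. The spoke to the middle
  of a group reveals it: a colour with both chords \<open>R\<close> admits such a spoke only at the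
  apex of its longest chords, and the apices fill only \<open>h\<close> consecutive positions.
  Suitable spokes elsewhere then lie in colours with two chords \<open>R\<close>, which leaves each
  of them few alternatives. Each alternative starts a run of forced choices, and a run either hits a
  chord that another spoke has forbidden, or two runs reach \<open>D s\<close> from both sides and
  clash there. The centre and the size of the bumps enter only through signs of determinants; since
  \<open>k\<close> is odd, no two corners are opposite, so these signs survive small
  perturbations.\<close>

definition det2 :: "complex \<Rightarrow> complex \<Rightarrow> real" where
  "det2 u v = Re u * Im v - Im u * Re v"

definition orient :: "complex \<Rightarrow> complex \<Rightarrow> complex \<Rightarrow> real" where
  "orient a b c = det2 (b - a) (c - a)"

lemma det2_commute: "det2 u v = - det2 v u"
  by (simp add: det2_def)

lemma det2_self [simp]: "det2 u u = 0"
  by (simp add: det2_def)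

lemma orient_rotate: "orient a b c = orient b c a"
  by (simp add: orient_def det2_def algebra_simps)

lemma orient_swap: "orient a b c = - orient b a c"
  by (simp add: orient_def det2_def algebra_simps)

lemma orient_eq_det2_sum:
  "orient a b c = det2 (a - v) (b - v) + det2 (b - v) (c - v) + det2 (c - v) (a - v)"
  by (simp add: orient_def det2_def algebra_simps)

text \<open>Cramer's rule, written as the linear relation between three vectors of the
  plane.\<close>

lemma det2_plucker: "det2 a b *\<^sub>R c = det2 c b *\<^sub>R a + det2 a c *\<^sub>R b"
  by (simp add: complex_eq_iff det2_def algebra_simps)

lemma orient_on_line:
  "orient a b ((1 - t) *\<^sub>R c + t *\<^sub>R d) = (1 - t) * orient a b c + t * orient a b d"
  by (simp add: orient_def det2_def algebra_simps)

lemma orient_open_segment: "z \<in> open_segment a b \<Longrightarrow> orient a b z = 0"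
  unfolding in_segment
  by (elim conjE exE, simp only: orient_on_line) (simp add: orient_def det2_def)

lemma det2_eq_0_imp_collinear:
  assumes "det2 (b - a) (c - a) = 0"
  shows "collinear {a, b, c}"
proof (cases "b = a")
  case False
  define u where "u = b - a"
  define v where "v = c - a"
  have u: "(Re u)\<^sup>2 + (Im u)\<^sup>2 \<noteq> 0"
    using False by (simp add: u_def complex_eq_iff sum_power2_eq_zero_iff)
  have d: "Re u * Im v = Im u * Re v"
    using assms by (simp add: det2_def u_def v_def)
  define t where "t = (Re u * Re v + Im u * Im v) / ((Re u)\<^sup>2 + (Im u)\<^sup>2)"
  have "Re v * ((Re u)\<^sup>2 + (Im u)\<^sup>2) = (Re u * Re v + Im u * Im v) * Re u"
       "Im v * ((Re u)\<^sup>2 + (Im u)\<^sup>2) = (Re u * Re v + Im u * Im v) * Im u"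
    using d by algebra+
  then have "v = t *\<^sub>R u"
    using u by (simp add: complex_eq_iff t_def nonzero_eq_divide_eq algebra_simps
        del: sum_power2_eq_zero_iff)
  then have c: "c = a + t *\<^sub>R u" by (simp add: v_def algebra_simps)
  have b: "b = a + 1 *\<^sub>R u" by (simp add: u_def)
  have "\<exists>s. x = a + s *\<^sub>R u" if "x \<in> {a, b, c}" for x
    using that b c by (auto intro: exI[of _ 0] exI[of _ 1])
  then show ?thesis unfolding collinear_alt by blast
qed simp

lemma general_position_orient:
  assumes "general_position V" "a \<in> V" "b \<in> V" "c \<in> V" "a \<noteq> b" "a \<noteq> c" "b \<noteq> c"
  shows "orient a b c \<noteq> 0"
  using assms det2_eq_0_imp_collinear unfolding general_position_def orient_def by blast

lemma crossing_iff_segments: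
  assumes "a \<noteq> b" "c \<noteq> d"
  shows "crossing {a, b} {c, d} \<longleftrightarrow> open_segment a b \<inter> open_segment c d \<noteq> {}"
  using assms by (simp add: crossing_def rel_interior_closed_segment flip: segment_convex_hull)

lemma crossing_commute: "crossing e f \<longleftrightarrow> crossing f e"
  by (simp add: crossing_def Int_commute)

lemma crossing_iff_orient:
  assumes "orient a b c \<noteq> 0" "orient a b d \<noteq> 0" "orient c d a \<noteq> 0" "orient c d b \<noteq> 0"
  shows "crossing {a, b} {c, d} \<longleftrightarrow>
    orient a b c * orient a b d < 0 \<and> orient c d a * orient c d b < 0"
proof -
  have ne: "a \<noteq> b" "c \<noteq> d" using assms by (auto simp: orient_def det2_def)
  have opp: "orient a b c * orient a b d < 0"
    if z: "z \<in> open_segment a b" "z \<in> open_segment c d" and nz: "orient a b c \<noteq> 0" for a b c d z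
  proof -
    obtain t where t: "0 < t" "t < 1" "z = (1 - t) *\<^sub>R c + t *\<^sub>R d"
      using z by (auto simp: in_segment)
    have "orient a b z = 0" using z by (simp add: orient_open_segment)
    then have "(1 - t) * orient a b c = - (t * orient a b d)"
      using t by (simp add: orient_on_line)
    then have "orient a b d = - ((1 - t) / t) * orient a b c"
      using t by (simp add: field_simps)
    then have "orient a b c * orient a b d = - ((1 - t) / t * (orient a b c)\<^sup>2)"
      by (simp add: power2_eq_square)
    also have "\<dots> < 0" using t nz by simp
    finally show ?thesis .
  qed
  show ?thesis
  proof
    assume "crossing {a, b} {c, d}"
    then obtain z where "z \<in> open_segment a b" "z \<in> open_segment c d"
      using ne by (auto simp: crossing_iff_segments)
    then show "orient a b c * orient a b d < 0 \<and> orient c d a * orient c d b < 0"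
      using opp assms by blast
  next
    assume n: "orient a b c * orient a b d < 0 \<and> orient c d a * orient c d b < 0"
    \<comment> \<open>Cramer's rule: \<open>D\<close> is the determinant of the directions
      \<open>b - a\<close> and \<open>c - d\<close>, and \<open>s\<close>, \<open>t\<close> are the
      parameters of the intersection point on the two lines.\<close>
    define D where "D = orient a b c - orient a b d"
    define t where "t = orient a b c / D"
    define s where "s = - orient c d a / D"
    have D': "orient c d b - orient c d a = D"
      by (simp add: D_def orient_def det2_def algebra_simps)
    have D: "D \<noteq> 0" using n unfolding D_def
      by (metis eq_iff_diff_eq_0 mult_less_0_iff not_less_iff_gr_or_eq)
    have t: "0 < t" "t < 1"
      using n D unfolding t_def D_def by (auto simp: mult_less_0_iff field_simps)
    have s: "0 < s" "s < 1"
      using n D unfolding s_def D'[symmetric] by (auto simp: mult_less_0_iff field_simps)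
    have "D *\<^sub>R (a + s *\<^sub>R (b - a)) = D *\<^sub>R (c + t *\<^sub>R (d - c))"
    proof -
      have st: "D * s = - orient c d a" "D * t = orient a b c"
        using D by (simp_all add: s_def t_def)
      show ?thesis
        by (simp only: scaleR_right_distrib scaleR_scaleR st)
          (simp add: D_def orient_def det2_def complex_eq_iff algebra_simps)
    qed
    then have e: "a + s *\<^sub>R (b - a) = c + t *\<^sub>R (d - c)" using D by simp
    have "a + s *\<^sub>R (b - a) \<in> open_segment a b"
      unfolding in_segment using s ne by (intro conjI exI[of _ s]) (auto simp: algebra_simps)
    moreover have "a + s *\<^sub>R (b - a) \<in> open_segment c d"
      unfolding e in_segment using t ne by (intro conjI exI[of _ t]) (auto simp: algebra_simps)
    ultimately show "crossing {a, b} {c, d}" using ne by (auto simp: crossing_iff_segments)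
  qed
qed

lemma not_crossing_shared_endpoint:
  assumes "orient a b c \<noteq> 0"
  shows "\<not> crossing {a, b} {a, c}"
proof
  have ne: "a \<noteq> b" "a \<noteq> c" using assms by (auto simp: orient_def det2_def)
  assume "crossing {a, b} {a, c}"
  then obtain z where z: "z \<in> open_segment a b" "z \<in> open_segment a c"
    using ne by (auto simp: crossing_iff_segments)
  then obtain t where t: "0 < t" "z = (1 - t) *\<^sub>R a + t *\<^sub>R c" by (auto simp: in_segment)
  have "orient a b z = 0" using z by (simp add: orient_open_segment)
  moreover have "orient a b a = 0" by (simp add: orient_def det2_def)
  ultimately show False using t assms by (simp add: orient_on_line)
qed

text \<open>Otherwise \<^term>\<open>c\<close> would lie in the triangle \<^term>\<open>{v, a, b}\<close>.\<close>

lemma extreme_point_beyond_chord: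
  assumes ext: "c extreme_point_of (convex hull V)"
    and V: "v \<in> V" "a \<in> V" "b \<in> V" and ne: "c \<noteq> v" "c \<noteq> a" "c \<noteq> b"
    and pos: "det2 (a - v) (b - v) > 0" "det2 (a - v) (c - v) > 0" "det2 (c - v) (b - v) > 0"
  shows "orient a b c < 0"
proof (rule ccontr)
  assume "\<not> orient a b c < 0"
  define d where "d = det2 (a - v) (b - v)"
  define \<alpha> where "\<alpha> = det2 (c - v) (b - v) / d"
  define \<beta> where "\<beta> = det2 (a - v) (c - v) / d"
  have d: "d > 0" using pos by (simp add: d_def)
  have ab: "\<alpha> > 0" "\<beta> > 0" using pos by (simp_all add: \<alpha>_def \<beta>_def d_def)
  have "orient a b c = d - det2 (c - v) (b - v) - det2 (a - v) (c - v)"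
    unfolding orient_eq_det2_sum[of a b c v]
    by (simp add: d_def det2_commute[of "b - v" "c - v"] det2_commute[of "c - v" "a - v"])
  then have "det2 (c - v) (b - v) + det2 (a - v) (c - v) \<le> d"
    using \<open>\<not> orient a b c < 0\<close> by simp
  then have le: "\<alpha> + \<beta> \<le> 1" using d by (simp add: \<alpha>_def \<beta>_def field_simps)
  have "d *\<^sub>R (c - v) = d *\<^sub>R (\<alpha> *\<^sub>R (a - v) + \<beta> *\<^sub>R (b - v))"
    using det2_plucker[of "a - v" "b - v" "c - v"] d
    by (simp add: \<alpha>_def \<beta>_def scaleR_right_distrib flip: d_def)
  then have "c - v = \<alpha> *\<^sub>R (a - v) + \<beta> *\<^sub>R (b - v)"
    using d unfolding scaleR_cancel_left by simp
  then have c: "c = (1 - \<alpha> - \<beta>) *\<^sub>R v + \<alpha> *\<^sub>R a + \<beta> *\<^sub>R b"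
    by (simp add: algebra_simps)
  have "c \<in> convex hull {v, a, b}"
    unfolding convex_hull_3 using ab le
    by (intro CollectI exI[of _ "1 - \<alpha> - \<beta>"] exI[of _ \<alpha>] exI[of _ \<beta>]) (auto simp: c)
  moreover have "convex hull {v, a, b} \<subseteq> convex hull V - {c}"
  proof (rule hull_minimal)
    show "{v, a, b} \<subseteq> convex hull V - {c}" using V ne by (auto simp: hull_inc)
    show "convex (convex hull V - {c})"
      using ext by (simp add: extreme_point_of_stillconvex convex_convex_hull)
  qed
  ultimately show False by blast
qed

section \<open>Signs of determinants under small perturbations of the corners\<close>

lemma eventually_close_det2:
  fixes P :: "real \<Rightarrow> bool"
  assumes "open {z. P z}" "P (det2 (a - v) (b - v))"
  shows "\<forall>\<^sub>F \<epsilon> in at_right 0. \<forall>p\<in>ball a \<epsilon>. \<forall>q\<in>ball b \<epsilon>. P (det2 (p - v) (q - v))"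
proof -
  have "continuous_on UNIV (\<lambda>z. det2 (fst z - v) (snd z - v))"
    unfolding det2_def by (intro continuous_intros)
  then have "open ((\<lambda>z. det2 (fst z - v) (snd z - v)) -` {z. P z})"
    using assms(1) by (intro open_vimage)
  moreover have "(a, b) \<in> (\<lambda>z. det2 (fst z - v) (snd z - v)) -` {z. P z}"
    using assms(2) by simp
  ultimately obtain A B where AB: "open A" "open B" "a \<in> A" "b \<in> B"
    "A \<times> B \<subseteq> (\<lambda>z. det2 (fst z - v) (snd z - v)) -` {z. P z}"
    by (rule open_prod_elim[of _ "(a, b)"]) blast
  then obtain d e where de: "d > 0" "ball a d \<subseteq> A" "e > 0" "ball b e \<subseteq> B"
    by (meson openE)
  have "P (det2 (p - v) (q - v))"
    if "\<epsilon> < min d e" "p \<in> ball a \<epsilon>" "q \<in> ball b \<epsilon>" for \<epsilon> p q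
  proof -
    have "p \<in> A" "q \<in> B" using that de by (auto intro!: subsetD[OF de(2)] subsetD[OF de(4)])
    then show ?thesis using AB(5) by auto
  qed
  then show ?thesis
    unfolding eventually_at_right_field
    by (intro exI[of _ "min d e"]) (use de in auto)
qed

lemma det2_scaled_cis: "det2 (w * cis x) (w * cis y) = (cmod w)\<^sup>2 * sin (y - x)"
proof -
  have "det2 (w * cis x) (w * cis y) = ((Re w)\<^sup>2 + (Im w)\<^sup>2) * (cos x * sin y - sin x * cos y)"
    by (simp add: det2_def power2_eq_square algebra_simps)
  then show ?thesis by (simp add: cmod_power2 sin_diff algebra_simps)
qed

lemma det2_polygon_corner:
  "det2 (polygon_corner k v w i - v) (polygon_corner k v w j - v) =
    (cmod w)\<^sup>2 * sin (2 * pi * (real j - real i) / real k)"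
  by (simp add: polygon_corner_def det2_scaled_cis right_diff_distrib diff_divide_distrib)

lemma sin_polygon_pos:
  assumes "0 < d" "2 * d < real k"
  shows "sin (2 * pi * d / k) > 0"
proof (rule sin_gt_zero)
  show "0 < 2 * pi * d / k" using assms by simp
  have "pi * (2 * d) < pi * k" using assms by (intro mult_strict_left_mono) auto
  then show "2 * pi * d / k < pi" using assms by (simp add: field_simps)
qed

lemma sin_polygon_neg:
  assumes "d < real k" "real k < 2 * d"
  shows "sin (2 * pi * d / k) < 0"
proof -
  have k: "real k > 0" using assms by linarith
  have "2 * pi * (real k - d) / k = 2 * pi - 2 * pi * d / k"
    using k by (simp add: field_simps)
  then show ?thesis using sin_polygon_pos[of "real k - d" k] assms
    by (simp add: sin_2pi_minus)
qed

text \<open>Points of different groups are seen from the centre in the same rotational sense as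
  their corners. The bound \<open>cmod w\<close> keeps each group in an open half-plane around the
  direction of its corner, where its points can be sorted by slope.\<close>

definition small_bumps :: "nat \<Rightarrow> complex \<Rightarrow> complex \<Rightarrow> real \<Rightarrow> bool" where
  "small_bumps k v w \<epsilon> \<longleftrightarrow> 0 < \<epsilon> \<and> \<epsilon> \<le> cmod w \<and>
    (\<forall>i<k. \<forall>j<k. i < j \<longrightarrow>
      (\<forall>p \<in> ball (polygon_corner k v w i) \<epsilon>. \<forall>q \<in> ball (polygon_corner k v w j) \<epsilon>.
        if 2 * (j - i) < k then det2 (p - v) (q - v) > 0 else det2 (p - v) (q - v) < 0))"

text \<open>As \<open>k\<close> is odd, no two corners are opposite with respect to
  \<open>v\<close>. Hence each of the finitely many determinants between corners is nonzero and
  keeps its sign nearby.\<close>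

lemma eventually_small_bumps:
  assumes "w \<noteq> 0" "odd k"
  shows "\<forall>\<^sub>F \<epsilon> in at_right 0. small_bumps k v w \<epsilon>"
proof -
  have 1: "\<forall>\<^sub>F \<epsilon> in at_right (0::real). 0 < \<epsilon>" by (rule eventually_at_right_less)
  have 2: "\<forall>\<^sub>F \<epsilon> in at_right (0::real). \<epsilon> \<le> cmod w"
    using assms unfolding eventually_at_right_field by (intro exI[of _ "cmod w"]) auto
  have "\<forall>\<^sub>F \<epsilon> in at_right 0.
      \<forall>p \<in> ball (polygon_corner k v w i) \<epsilon>. \<forall>q \<in> ball (polygon_corner k v w j) \<epsilon>.
        if 2 * (j - i) < k then det2 (p - v) (q - v) > 0 else det2 (p - v) (q - v) < 0"
    if "i < j" "j < k" for i j
  proof (cases "2 * (j - i) < k")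
    case True
    then have "2 * j < k + 2 * i" using that by linarith
    then have "real (2 * j) < real (k + 2 * i)" by (simp only: of_nat_less_iff)
    then have "2 * (real j - real i) < real k" by simp
    then have "sin (2 * pi * (real j - real i) / real k) > 0"
      using that by (intro sin_polygon_pos) auto
    then show ?thesis using True assms
      by (simp, intro eventually_close_det2)
        (auto simp: det2_polygon_corner open_greaterThan[unfolded greaterThan_def])
  next
    case False
    then have "2 * (j - i) > k" using assms(2) by (metis even_mult_iff even_numeral linorder_neqE_nat)
    then have "2 * j > k + 2 * i" using that by linarith
    then have "real (2 * j) > real (k + 2 * i)" by (simp only: of_nat_less_iff)
    then have "2 * (real j - real i) > real k" by simp
    then have "sin (2 * pi * (real j - real i) / real k) < 0"
      using that by (intro sin_polygon_neg) auto
    then show ?thesis using False assms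
      by (simp, intro eventually_close_det2)
        (auto simp: det2_polygon_corner mult_less_0_iff open_lessThan[unfolded lessThan_def])
  qed
  then have 3: "\<forall>\<^sub>F \<epsilon> in at_right 0. \<forall>i\<in>{..<k}. \<forall>j\<in>{..<k}. i < j \<longrightarrow>
      (\<forall>p \<in> ball (polygon_corner k v w i) \<epsilon>. \<forall>q \<in> ball (polygon_corner k v w j) \<epsilon>.
        if 2 * (j - i) < k then det2 (p - v) (q - v) > 0 else det2 (p - v) (q - v) < 0)"
    by (intro eventually_ball_finite ballI finite_lessThan) auto
  show ?thesis
    using 1 2 3 by eventually_elim (auto simp: small_bumps_def)
qed

text \<open>Multiplying by \<open>cnj d\<close> turns the direction \<open>d\<close> into the
  positive real axis and scales all determinants by the same positive factor.\<close>

lemma det2_pos_iff_slope: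
  assumes "Re (u * cnj d) > 0" "Re (v * cnj d) > 0"
  shows "det2 u v > 0 \<longleftrightarrow> Im (u * cnj d) / Re (u * cnj d) < Im (v * cnj d) / Re (v * cnj d)"
proof -
  have "d \<noteq> 0" using assms by auto
  then have d: "(Re d)\<^sup>2 + (Im d)\<^sup>2 > 0"
    by (simp add: complex_eq_iff sum_power2_gt_zero_iff)
  have "Re (u * cnj d) * Im (v * cnj d) - Im (u * cnj d) * Re (v * cnj d)
      = ((Re d)\<^sup>2 + (Im d)\<^sup>2) * det2 u v"
    by (simp add: det2_def power2_eq_square algebra_simps)
  then have "det2 u v > 0 \<longleftrightarrow>
      Re (u * cnj d) * Im (v * cnj d) - Im (u * cnj d) * Re (v * cnj d) > 0"
    using d by (simp add: zero_less_mult_iff)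
  then show ?thesis using assms by (simp add: field_simps)
qed

lemma Re_mult_cnj_near:
  assumes "cmod (u - d) < cmod d"
  shows "Re (u * cnj d) > 0"
proof -
  have "Re ((d - u) * cnj d) \<le> cmod ((d - u) * cnj d)" by (rule complex_Re_le_cmod)
  also have "\<dots> = cmod (u - d) * cmod d" by (simp add: norm_mult norm_minus_commute)
  also have "\<dots> < cmod d * cmod d"
    using assms by (intro mult_strict_right_mono) (auto intro: le_less_trans[OF norm_ge_zero])
  also have "\<dots> = Re (d * cnj d)" by (simp add: complex_mult_cnj cmod_power2 flip: power2_eq_square)
  finally show ?thesis by (simp add: algebra_simps)
qed

lemma finite_enumerate_by_key:
  fixes key :: "'a \<Rightarrow> real"
  assumes "finite A" "inj_on key A"
  shows "\<exists>f. bij_betw f {..<card A} A \<and> (\<forall>i j. i < j \<longrightarrow> j < card A \<longrightarrow> key (f i) < key (f j))"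
proof -
  have c: "card (key ` A) = card A" using assms by (simp add: card_image)
  define xs where "xs = sorted_list_of_set (key ` A)"
  have xs: "sorted_wrt (<) xs" "set xs = key ` A" "length xs = card A"
    using assms c by (simp_all add: xs_def)
  have b: "bij_betw ((!) xs) {..<card A} (key ` A)"
    using bij_betw_nth[of xs "{..<card A}" "key ` A"] xs by (simp add: strict_sorted_iff)
  have i: "bij_betw (inv_into A key) (key ` A) A"
    using assms by (simp add: bij_betw_inv_into inj_on_imp_bij_betw)
  show ?thesis
  proof (intro exI conjI allI impI)
    show "bij_betw (inv_into A key \<circ> (!) xs) {..<card A} A"
      using b i by (rule bij_betw_trans)
    fix i j assume ij: "i < j" "j < card A"
    then have "xs ! i \<in> key ` A" "xs ! j \<in> key ` A" using xs nth_mem[of _ xs] by auto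
    moreover have "xs ! i < xs ! j" using xs ij sorted_wrt_nth_less by fastforce
    ultimately show "key ((inv_into A key \<circ> (!) xs) i) < key ((inv_into A key \<circ> (!) xs) j)"
      by (simp add: f_inv_into_f)
  qed
qed

section \<open>Indexing the bumpy wheel by angle\<close>

text \<open>This is all the geometry that the rest relies on. The sign condition says that
  \<open>p j\<close> is less than a half turn ahead of \<open>p i\<close> exactly if their groups
  differ by less than half of \<open>k\<close>.\<close>

definition wheel_indexing :: "nat \<Rightarrow> nat \<Rightarrow> complex \<Rightarrow> complex set \<Rightarrow> (nat \<Rightarrow> complex) \<Rightarrow> bool" where
  "wheel_indexing k l v V p \<longleftrightarrow>
     v \<in> V \<and> bij_betw p {..<k * l} (V - {v}) \<and> general_position V \<and>
     (\<forall>x \<in> V - {v}. x extreme_point_of (convex hull V)) \<and>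
     (\<forall>i j. i < j \<longrightarrow> j < k * l \<longrightarrow>
       (if 2 * (j div l - i div l) < k then det2 (p i - v) (p j - v) > 0
        else det2 (p i - v) (p j - v) < 0))"

text \<open>Different groups are ordered by \<open>small_bumps\<close>. Within a group the points
  are sorted by their slope relative to the direction of the corner; equal slopes would make two
  points collinear with the centre.\<close>

lemma bumpy_wheel_indexing:
  assumes bw: "bumpy_wheel k l v w \<epsilon> G" and sb: "small_bumps k v w \<epsilon>" and "l > 0" "odd k"
  shows "\<exists>p. wheel_indexing k l v (verts G) p"
proof -
  obtain P where P: "\<forall>i<k. finite (P i) \<and> card (P i) = l \<and> P i \<subseteq> ball (polygon_corner k v w i) \<epsilon>"
    and disj: "disjoint_family_on P {..<k}" and v: "v \<notin> (\<Union>i<k. P i)"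
    and V: "verts G = insert v (\<Union>i<k. P i)"
    and ext: "\<forall>p \<in> (\<Union>i<k. P i). p extreme_point_of (convex hull (verts G))"
    using bw unfolding bumpy_wheel_def by (elim conjE exE) (rule that, assumption+)
  have P: "finite (P i)" "card (P i) = l" "P i \<subseteq> ball (polygon_corner k v w i) \<epsilon>" if "i < k" for i
    using P[rule_format, OF that] by blast+
  have gp: "general_position (verts G)"
    using bw by (simp add: bumpy_wheel_def complete_geometric_graph_def geometric_graph_def)
  define d where "d i = polygon_corner k v w i - v" for i
  define key where "key i q = Im ((q - v) * cnj (d i)) / Re ((q - v) * cnj (d i))" for i q
  have Re_pos: "Re ((q - v) * cnj (d i)) > 0" if "i < k" "q \<in> P i" for i q
  proof (rule Re_mult_cnj_near)
    have "cmod (q - v - d i) < \<epsilon>"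
      using P(3)[OF that(1)] that(2) by (auto simp: d_def dist_norm norm_minus_commute)
    also have "\<epsilon> \<le> cmod (d i)" using sb
      by (simp add: small_bumps_def d_def polygon_corner_def norm_mult)
    finally show "cmod (q - v - d i) < cmod (d i)" .
  qed
  have key: "det2 (a - v) (b - v) > 0 \<longleftrightarrow> key i a < key i b" if "i < k" "a \<in> P i" "b \<in> P i" for i a b
    unfolding key_def using det2_pos_iff_slope Re_pos that by blast
  have inj: "inj_on (key i) (P i)" if i: "i < k" for i
  proof (rule inj_onI, rule ccontr)
    fix a b assume ab: "a \<in> P i" "b \<in> P i" "key i a = key i b" "a \<noteq> b"
    then have "\<not> det2 (a - v) (b - v) > 0" "\<not> det2 (b - v) (a - v) > 0"
      using key[OF i] by auto
    then have "det2 (a - v) (b - v) = 0"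
      by (simp add: det2_commute[of "b - v"])
    then have "orient v a b = 0" by (simp add: orient_def)
    moreover have "a \<in> verts G" "b \<in> verts G" "v \<in> verts G" "v \<noteq> a" "v \<noteq> b"
      using ab i v V by auto
    ultimately show False using general_position_orient[OF gp, of v a b] ab by simp
  qed
  have "\<exists>f. bij_betw f {..<l} (P i) \<and> (\<forall>a b. a < b \<longrightarrow> b < l \<longrightarrow> key i (f a) < key i (f b))"
    if "i < k" for i
    using finite_enumerate_by_key[OF P(1) inj] P(2) that by auto
  then obtain f where f: "\<And>i. i < k \<Longrightarrow> bij_betw (f i) {..<l} (P i)"
    "\<And>i a b. i < k \<Longrightarrow> a < b \<Longrightarrow> b < l \<Longrightarrow> key i (f i a) < key i (f i b)"
    by metis
  define p where "p x = f (x div l) (x mod l)" for x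
  have div: "x div l < k" "x mod l < l" if "x < k * l" for x
    using that \<open>l > 0\<close> by (simp_all add: less_mult_imp_div_less)
  have pP: "p x \<in> P (x div l)" if "x < k * l" for x
    using bij_betwE[OF f(1)[OF div(1)[OF that]]] div(2)[OF that] by (simp add: p_def)
  have "inj_on p {..<k * l}"
  proof (rule inj_onI)
    fix x y assume xy: "x \<in> {..<k * l}" "y \<in> {..<k * l}" "p x = p y"
    have "x div l = y div l"
    proof (rule ccontr)
      assume "x div l \<noteq> y div l"
      then have "P (x div l) \<inter> P (y div l) = {}"
        using disj div xy by (auto simp: disjoint_family_on_def)
      then show False using pP xy by fastforce
    qed
    moreover have "x mod l = y mod l"
      using f(1)[of "x div l"] div xy calculation
      by (auto simp: p_def bij_betw_def inj_on_def)
    ultimately show "x = y" by (metis div_mult_mod_eq)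
  qed
  moreover have "p ` {..<k * l} = verts G - {v}"
  proof -
    have "q \<in> p ` {..<k * l}" if q: "i < k" "q \<in> P i" for i q
    proof -
      obtain a where a: "a < l" "q = f i a" using f(1)[OF q(1)] q(2) by (auto simp: bij_betw_def)
      have "i * l + a < k * l"
        using q(1) a(1) mult_le_mono1[of "Suc i" k l] by simp
      moreover have "p (i * l + a) = q" using a by (simp add: p_def)
      ultimately show ?thesis by (intro image_eqI[of _ _ "i * l + a"]) simp_all
    qed
    then have "(\<Union>i<k. P i) \<subseteq> p ` {..<k * l}" by (intro UN_least subsetI) simp_all
    moreover have "p ` {..<k * l} \<subseteq> (\<Union>i<k. P i)"
    proof (rule image_subsetI)
      fix x assume "x \<in> {..<k * l}"
      then have x: "x < k * l" by simp
      show "p x \<in> (\<Union>i<k. P i)" using pP[OF x] div(1)[OF x] by (intro UN_I[of "x div l"]) simp_all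
    qed
    ultimately have "p ` {..<k * l} = (\<Union>i<k. P i)" by (rule subset_antisym[rotated])
    then show ?thesis unfolding V by (simp only: Diff_insert_absorb[OF v])
  qed
  ultimately have bij: "bij_betw p {..<k * l} (verts G - {v})" by (simp add: bij_betw_def)
  have sgn: "if 2 * (j div l - i div l) < k then det2 (p i - v) (p j - v) > 0
        else det2 (p i - v) (p j - v) < 0" if ij: "i < j" "j < k * l" for i j
  proof (cases "i div l = j div l")
    case True
    then have "i mod l < j mod l"
      using ij by (metis add_less_cancel_left div_mult_mod_eq)
    then have "key (j div l) (p i) < key (j div l) (p j)"
      using f(2)[of "j div l" "i mod l" "j mod l"] div ij True by (simp add: p_def)
    then have "det2 (p i - v) (p j - v) > 0"
      using key[of "j div l" "p i" "p j"] pP[of i] pP[of j] div ij True by simp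
    then show ?thesis using True \<open>odd k\<close> by (simp add: odd_pos)
  next
    case False
    then have lt: "i div l < j div l" using ij by (simp add: div_le_mono le_neq_implies_less)
    then show ?thesis
      using sb pP[of i] pP[of j] P(3)[of "i div l"] P(3)[of "j div l"] div(1)[of i] div(1)[of j] ij
      unfolding small_bumps_def by (meson less_trans subsetD)
  qed
  have "\<forall>x\<in>verts G - {v}. x extreme_point_of convex hull verts G" using ext V by blast
  moreover have "v \<in> verts G" using V by blast
  ultimately have "wheel_indexing k l v (verts G) p"
    unfolding wheel_indexing_def using bij gp sgn by (intro conjI allI impI) assumption+
  then show ?thesis by (intro exI[of _ p])
qed

context
  fixes k l :: nat and v :: complex and V :: "complex set" and p :: "nat \<Rightarrow> complex"
  assumes wi: "wheel_indexing k l v V p" and odd_k: "odd k"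
begin

lemma indexed_points:
  "v \<in> V" "general_position V" "i < k * l \<Longrightarrow> p i \<in> V" "i < k * l \<Longrightarrow> p i \<noteq> v"
  "i < k * l \<Longrightarrow> p i extreme_point_of (convex hull V)"
  "i < k * l \<Longrightarrow> j < k * l \<Longrightarrow> p i = p j \<longleftrightarrow> i = j"
  "i < k * l \<Longrightarrow> v \<noteq> p i"
  using wi unfolding wheel_indexing_def
  by (auto dest: bij_betwE simp: bij_betw_def inj_on_def)

lemma indexed_orient_nonzero:
  "\<lbrakk>a < k * l; b < k * l; c < k * l; a \<noteq> b; a \<noteq> c; b \<noteq> c\<rbrakk> \<Longrightarrow> orient (p a) (p b) (p c) \<noteq> 0"
  "\<lbrakk>a < k * l; b < k * l; a \<noteq> b\<rbrakk> \<Longrightarrow> orient v (p a) (p b) \<noteq> 0"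
  "\<lbrakk>a < k * l; b < k * l; a \<noteq> b\<rbrakk> \<Longrightarrow> orient (p a) (p b) v \<noteq> 0"
  by (rule general_position_orient[OF indexed_points(2)]; simp add: indexed_points)+

lemma indexed_det2:
  assumes "i < j" "j < k * l"
  shows "2 * (j div l - i div l) < k \<Longrightarrow> det2 (p i - v) (p j - v) > 0"
    and "\<not> 2 * (j div l - i div l) < k \<Longrightarrow> det2 (p i - v) (p j - v) < 0"
  using wi assms unfolding wheel_indexing_def by (metis, metis)

text \<open>If the three directions from the centre lie within a half turn, the middle point is
  extreme and so lies beyond the chord of the other two. Otherwise the centre is inside the
  triangle, and the three positive determinants add up to the orientation.\<close>

lemma indexed_orient:
  assumes "i < j" "j < x" "x < k * l"
  shows "orient (p i) (p j) (p x) > 0"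
proof -
  have lt: "i < k * l" "j < k * l" "i < x" using assms by auto
  have le: "i div l \<le> j div l" "j div l \<le> x div l" "x div l < k"
    using assms by (auto simp: div_le_mono less_imp_le less_mult_imp_div_less)
  have ne: "p i \<noteq> p j" "p i \<noteq> p x" "p j \<noteq> p x"
    using assms lt by (simp_all add: indexed_points)
  let ?d = "\<lambda>a b. det2 (p a - v) (p b - v)"
  note beyond = extreme_point_beyond_chord[OF indexed_points(5) indexed_points(1) indexed_points(3,3)
      indexed_points(4)]
  show ?thesis
  proof (cases "2 * (x div l - i div l) < k")
    case True
    then have "?d i x > 0" "?d i j > 0" "?d j x > 0"
      using indexed_det2(1) assms lt le by auto
    then have "orient (p i) (p x) (p j) < 0"
      using beyond[of j i x] assms lt ne by auto
    then show ?thesis by (metis neg_0_less_iff_less orient_rotate orient_swap)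
  next
    case ix: False
    then have xi: "?d x i > 0" using indexed_det2(2)[of i x] assms lt by (simp add: det2_commute[of "p x - v"])
    show ?thesis
    proof (cases "2 * (j div l - i div l) < k")
      case ij: True
      then have dij: "?d i j > 0" using indexed_det2(1) assms lt by auto
      show ?thesis
      proof (cases "2 * (x div l - j div l) < k")
        case True
        then have "?d j x > 0" using indexed_det2(1) assms lt by auto
        then show ?thesis using dij xi orient_eq_det2_sum[of "p i" "p j" "p x" v] by simp
      next
        case False
        then have "?d x j > 0"
          using indexed_det2(2)[of j x] assms lt by (simp add: det2_commute[of "p x - v"])
        then have "orient (p x) (p j) (p i) < 0"
          using beyond[of i x j] dij xi assms lt ne by auto
        then show ?thesis by (metis neg_0_less_iff_less orient_rotate orient_swap)
      qed
    next
      case ij: False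
      then have dji: "?d j i > 0"
        using indexed_det2(2)[of i j] assms lt by (simp add: det2_commute[of "p j - v"])
      have "2 * (x div l - j div l) < k" using ij le odd_k by linarith
      then have "?d j x > 0" using indexed_det2(1) assms lt by auto
      then have "orient (p j) (p i) (p x) < 0"
        using beyond[of x j i] dji xi assms lt ne by auto
      then show ?thesis by (metis neg_0_less_iff_less orient_swap)
    qed
  qed
qed

lemma indexed_orient_sign:
  assumes "i < j" "j < k * l" "x < k * l" "x \<noteq> i" "x \<noteq> j"
  shows "(orient (p i) (p j) (p x) < 0 \<longleftrightarrow> i < x \<and> x < j) \<and>
         (orient (p i) (p j) (p x) > 0 \<longleftrightarrow> x < i \<or> j < x)"
proof -
  consider "x < i" | "i < x" "x < j" | "j < x" using assms by linarith
  then show ?thesis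
  proof cases
    case 1
    then have "orient (p i) (p j) (p x) > 0"
      using indexed_orient[of x i j] assms by (metis orient_rotate)
    then show ?thesis using 1 assms by auto
  next
    case 2
    then have "orient (p i) (p j) (p x) < 0"
      using indexed_orient[of i x j] assms by (metis neg_0_less_iff_less orient_rotate orient_swap)
    then show ?thesis using 2 assms by auto
  next
    case 3
    then have "orient (p i) (p j) (p x) > 0"
      using indexed_orient[of i j x] assms by simp
    then show ?thesis using 3 assms by auto
  qed
qed

lemma chord_crossing_iff:
  assumes "i < j" "j < k * l" "a < b" "b < k * l" "{i, j} \<noteq> {a, b}"
  shows "crossing {p i, p j} {p a, p b} \<longleftrightarrow> i < a \<and> a < j \<and> j < b \<or> a < i \<and> i < b \<and> b < j"
proof (cases "{i, j} \<inter> {a, b} = {}")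
  case True
  have o: "orient (p i) (p j) (p a) < 0 \<longleftrightarrow> i < a \<and> a < j"
    "orient (p i) (p j) (p a) > 0 \<longleftrightarrow> a < i \<or> j < a"
    "orient (p i) (p j) (p b) < 0 \<longleftrightarrow> i < b \<and> b < j"
    "orient (p i) (p j) (p b) > 0 \<longleftrightarrow> b < i \<or> j < b"
    "orient (p a) (p b) (p i) < 0 \<longleftrightarrow> a < i \<and> i < b"
    "orient (p a) (p b) (p i) > 0 \<longleftrightarrow> i < a \<or> b < i"
    "orient (p a) (p b) (p j) < 0 \<longleftrightarrow> a < j \<and> j < b"
    "orient (p a) (p b) (p j) > 0 \<longleftrightarrow> j < a \<or> b < j"
    using indexed_orient_sign[of i j a] indexed_orient_sign[of i j b]
      indexed_orient_sign[of a b i] indexed_orient_sign[of a b j] assms True by auto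
  have nz: "orient (p i) (p j) (p a) \<noteq> 0" "orient (p i) (p j) (p b) \<noteq> 0"
    "orient (p a) (p b) (p i) \<noteq> 0" "orient (p a) (p b) (p j) \<noteq> 0"
    by (rule indexed_orient_nonzero; use assms True in auto)+
  show ?thesis unfolding crossing_iff_orient[OF nz] mult_less_0_iff o using assms True by auto
next
  case False
  have *: "\<not> crossing {p x, p y} {p x, p z}"
    if "x < k * l" "y < k * l" "z < k * l" "x \<noteq> y" "x \<noteq> z" "y \<noteq> z" for x y z
    using that by (intro not_crossing_shared_endpoint indexed_orient_nonzero)
  consider "i = a" "j \<noteq> b" | "i = b" | "j = a" | "j = b" "i \<noteq> a" using False assms by auto
  then have "\<not> crossing {p i, p j} {p a, p b}"
  proof cases
    case 1 then show ?thesis using *[of i j b] assms by auto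
  next
    case 2 then show ?thesis using *[of i j a] assms by (auto simp: insert_commute)
  next
    case 3 then show ?thesis using *[of j i b] assms by (auto simp: insert_commute)
  next
    case 4 then show ?thesis using *[of j i a] assms by (auto simp: insert_commute)
  qed
  then show ?thesis using False assms by auto
qed

text \<open>A spoke crosses the chord iff its outer end is on the side without the centre. The
  centre is outside the index interval if the chord spans less than a half turn and inside it
  otherwise.\<close>

lemma chord_crossing_spoke_iff:
  assumes "i < j" "j < k * l" "x < k * l"
  shows "crossing {p i, p j} {v, p x} \<longleftrightarrow>
    (if 2 * (j div l - i div l) < k then i < x \<and> x < j else x < i \<or> j < x)"
proof (cases "x = i \<or> x = j")
  case True
  have "orient (p i) (p j) v \<noteq> 0" "orient (p j) (p i) v \<noteq> 0"
    by (rule indexed_orient_nonzero; use assms in auto)+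
  then have "\<not> crossing {p i, p j} {p i, v}" "\<not> crossing {p j, p i} {p j, v}"
    by (auto dest: not_crossing_shared_endpoint)
  then have "\<not> crossing {p i, p j} {v, p x}" using True by (auto simp: insert_commute)
  then show ?thesis using True assms by auto
next
  case False
  have le: "i div l \<le> j div l" "j div l < k"
    using assms by (auto simp: div_le_mono less_imp_le less_mult_imp_div_less)
  have xk: "x div l < k" using assms by (simp add: less_mult_imp_div_less)
  let ?d = "\<lambda>a b. det2 (p a - v) (p b - v)"
  have ov: "orient (p i) (p j) v = ?d i j" "orient v (p x) (p i) = ?d x i" "orient v (p x) (p j) = ?d x j"
    by (simp_all add: orient_def det2_def algebra_simps)
  have nz: "orient (p i) (p j) v \<noteq> 0" "orient (p i) (p j) (p x) \<noteq> 0"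
    "orient v (p x) (p i) \<noteq> 0" "orient v (p x) (p j) \<noteq> 0"
    by (rule indexed_orient_nonzero; use assms False in auto)+
  note o = indexed_orient_sign[of i j x]
  note d1 = indexed_det2(1)
  have d2: "?d b a > 0" if "a < b" "b < k * l" "\<not> 2 * (b div l - a div l) < k" for a b
    using indexed_det2(2)[of a b] that by (simp add: det2_commute[of "p b - v"])
  show ?thesis
  proof (cases "2 * (j div l - i div l) < k")
    case True
    then have ij: "?d i j > 0" using d1 assms by auto
    show ?thesis
    proof (cases "i < x \<and> x < j")
      case x: True
      then have "i div l \<le> x div l" "x div l \<le> j div l" by (auto simp: div_le_mono)
      then have "?d i x > 0" "?d x j > 0" using d1[of i x] d1[of x j] x assms True by auto
      then have "?d x i < 0" "?d x j > 0" by (simp_all add: det2_commute[of "p x - v" "p i - v"])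
      then show ?thesis
        unfolding crossing_iff_orient[OF nz] mult_less_0_iff using ij o x assms True False
        by (simp add: ov)
    next
      case x: False
      then have "orient (p i) (p j) (p x) > 0" using o assms False by auto
      then show ?thesis
        unfolding crossing_iff_orient[OF nz] mult_less_0_iff using ij x True by (simp add: ov)
    qed
  next
    case far: False
    then have ij: "?d i j < 0" using indexed_det2(2) assms by auto
    consider "i < x" "x < j" | "x < i" | "j < x" using False by linarith
    then show ?thesis
    proof cases
      case 1
      then have "orient (p i) (p j) (p x) < 0" using o assms False by auto
      then show ?thesis
        unfolding crossing_iff_orient[OF nz] mult_less_0_iff using ij 1 far by (simp add: ov)
    next
      case 2
      then have xi: "x div l \<le> i div l" by (simp add: div_le_mono)
      have "?d x i > 0" using d1[of x i] 2 assms far le xi xk odd_k by auto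
      moreover have "?d j x > 0" using d2[of x j] 2 assms far le xi by auto
      then have "?d x j < 0" by (simp add: det2_commute[of "p x - v" "p j - v"])
      ultimately show ?thesis
        unfolding crossing_iff_orient[OF nz] mult_less_0_iff using ij o 2 assms far
        by (simp add: ov)
    next
      case 3
      then have jx: "j div l \<le> x div l" by (simp add: div_le_mono)
      have "?d j x > 0" using d1[of j x] 3 assms far le jx xk odd_k by auto
      then have "?d x j < 0" by (simp add: det2_commute[of "p x - v" "p j - v"])
      moreover have "?d x i > 0" using d2[of i x] 3 assms far le jx by auto
      ultimately show ?thesis
        unfolding crossing_iff_orient[OF nz] mult_less_0_iff using ij o 3 assms far
        by (simp add: ov)
    qed
  qed
qed

lemma spokes_not_crossing:
  assumes "x < k * l" "y < k * l" "x \<noteq> y"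
  shows "\<not> crossing {v, p x} {v, p y}"
  using assms by (intro not_crossing_shared_endpoint indexed_orient_nonzero)

end

section \<open>Colourings of the edges of a wheel\<close>

lemma card_int_le_2:
  fixes A :: "int set"
  assumes "\<And>a b c. \<lbrakk>a \<in> A; b \<in> A; c \<in> A; a < b; b < c\<rbrakk> \<Longrightarrow> False"
  shows "card A \<le> 2"
proof (rule ccontr)
  assume "\<not> card A \<le> 2"
  then obtain B where "B \<subseteq> A" "card B = 3"
    using obtain_subset_with_card_n[of 3 A] by auto
  then obtain x y z where "x \<in> A" "y \<in> A" "z \<in> A" "x \<noteq> y" "x \<noteq> z" "y \<noteq> z"
    by (auto simp: card_3_iff)
  then show False using assms by (metis linorder_neqE)
qed

lemma card_int_le_1:
  fixes A :: "int set"
  assumes "finite A" "\<And>a b. \<lbrakk>a \<in> A; b \<in> A; a < b\<rbrakk> \<Longrightarrow> False"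
  shows "card A \<le> 1"
  using assms card_le_Suc0_iff_eq[of A] by (metis One_nat_def linorder_neqE)

text \<open>The deficits \<open>2 - card\<close> of the fibres add up to
  \<open>2 * card C - card X = 1\<close>, so exactly one fibre falls short.\<close>

lemma fibres_of_almost_double_cover:
  assumes "finite X" "finite C" "f ` X \<subseteq> C" "card X + 1 = 2 * card C"
    and le: "\<And>c. c \<in> C \<Longrightarrow> card {x\<in>X. f x = c} \<le> 2"
  shows "\<exists>c0\<in>C. card {x\<in>X. f x = c0} = 1 \<and> (\<forall>c\<in>C. c \<noteq> c0 \<longrightarrow> card {x\<in>X. f x = c} = 2)"
proof -
  have "(\<Sum>c\<in>C. card {x\<in>X. f x = c}) = card X"
    using sum.group[OF assms(1-3), of "\<lambda>_. 1::nat"] by (simp only: card_eq_sum)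
  moreover have "(\<Sum>c\<in>C. (2 - card {x\<in>X. f x = c}) + card {x\<in>X. f x = c}) = (\<Sum>c\<in>C. 2)"
    by (intro sum.cong) (use le in auto)
  ultimately have "(\<Sum>c\<in>C. 2 - card {x\<in>X. f x = c}) = 1"
    using assms(4) by (simp add: sum.distrib)
  then obtain c0 where c0: "c0 \<in> C" "2 - card {x\<in>X. f x = c0} = 1"
    "\<forall>c\<in>C. c0 \<noteq> c \<longrightarrow> 2 - card {x\<in>X. f x = c} = 0"
    using sum_eq_1_iff[OF assms(2)] by auto
  show ?thesis
    by (rule bexI[OF _ c0(1)]) (use c0 le in fastforce)
qed

lemma dvd_diff_unique:
  fixes a b l z :: int
  assumes "l dvd z - a" "l dvd z - b" "\<bar>a - b\<bar> < l"
  shows "a = b"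
proof -
  have "l dvd (z - b) - (z - a)" using assms(2,1) by (rule dvd_diff)
  moreover have "(z - b) - (z - a) = a - b" by simp
  ultimately have "l dvd a - b" by (simp only:)
  then show ?thesis using assms(3) zdvd_imp_le[of l "\<bar>a - b\<bar>"] by force
qed

text \<open>The outer points are indexed by the integers modulo \<^term>\<open>k * l = 2 * r + 2 * q + 1\<close>, where
  \<^term>\<open>l = 2 * q + 1\<close> and \<^term>\<open>r = (k - 1) div 2 * l\<close>; groups start at the multiples of \<^term>\<open>l\<close>.
  \<^term>\<open>K x y\<close> is the colour of the chord between \<^term>\<open>x\<close> and \<^term>\<open>y\<close>, and \<^term>\<open>S z\<close> that of the spoke
  to \<^term>\<open>z\<close>. In the last assumption the arc from \<^term>\<open>x\<close> to \<^term>\<open>y\<close> lies in \<^term>\<open>(k + 1) div 2\<close> consecutive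
  groups, so that the chord separates it from the centre.\<close>

locale wheel_colouring =
  fixes q r :: int and C :: "'c set" and K :: "int \<Rightarrow> int \<Rightarrow> 'c" and S :: "int \<Rightarrow> 'c"
  assumes q: "q \<ge> 2" and r: "r \<ge> 2 * q + 1" and l_dvd_r: "2 * q + 1 dvd r"
    and finite_C: "finite C" and card_C: "int (card C) = r + q + 1"
    and K_flip: "K y (x + (2 * r + 2 * q + 1)) = K x y"
    and S_periodic: "S (x + (2 * r + 2 * q + 1)) = S x"
    and K_in: "\<lbrakk>x < y; y < x + (2 * r + 2 * q + 1)\<rbrakk> \<Longrightarrow> K x y \<in> C"
    and S_in: "S x \<in> C"
    and chords: "\<lbrakk>x < z; z < y; y < u; u < x + (2 * r + 2 * q + 1)\<rbrakk> \<Longrightarrow> K x y \<noteq> K z u"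
    and spokes: "\<lbrakk>2 * q + 1 dvd G; G \<le> x; x < z; z < y; y < G + r + (2 * q + 1)\<rbrakk>
        \<Longrightarrow> K x y \<noteq> S z"
begin

abbreviation "l \<equiv> 2 * q + 1"
abbreviation "h \<equiv> r + q"
abbreviation "m \<equiv> 2 * r + 2 * q + 1"

definition D where "D x = K x (x + h)"
definition E where "E x = K x (x + h - 1)"
definition F where "F x = K x (x + h - 2)"
definition R where "R x = K x (x + r)"

lemma K_periodic: "K (x + m) (y + m) = K x y"
  by (simp only: K_flip)

lemma K_periodic': "x' = x + m \<Longrightarrow> y' = y + m \<Longrightarrow> K x' y' = K x y"
  by (simp only: K_periodic)

lemma periodic: "D (x + m) = D x" "E (x + m) = E x" "F (x + m) = F x" "R (x + m) = R x"
  unfolding D_def E_def F_def R_def by (rule K_periodic'; simp)+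

lemma in_C: "D x \<in> C" "E x \<in> C" "F x \<in> C" "R x \<in> C"
  unfolding D_def E_def F_def R_def using q r by (intro K_in; linarith)+

lemma l_dvd_m: "l dvd m"
proof -
  have "m = 2 * r + l" by simp
  moreover have "l dvd 2 * r + l" using l_dvd_r by (intro dvd_add dvd_mult dvd_refl)
  ultimately show ?thesis by (simp only:)
qed

lemma split_l: obtains G P where "x = G + P" "l dvd G" "0 \<le> P" "P \<le> 2 * q"
proof -
  have "x = l * (x div l) + x mod l" by simp
  moreover have "0 \<le> x mod l" "x mod l < l" using q by (intro pos_mod_sign pos_mod_bound; simp)+
  ultimately show ?thesis using that[of "l * (x div l)" "x mod l"] by simp
qed

section \<open>Which chords and spokes may share a colour\<close>

lemma D_D:
  assumes "D x = D y" "x < y" "y < x + m"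
  shows "y = x + h \<or> y = x + h + 1"
proof (rule ccontr)
  assume n: "\<not> ?thesis"
  consider "y < x + h" | "y > x + h + 1" using n by linarith
  then show False
  proof cases
    case 1
    then show ?thesis using chords[of x y "x + h" "y + h"] assms q r by (simp add: D_def)
  next
    case 2
    then show ?thesis
      using chords[of y "x + m" "y + h" "x + m + h"] assms q r periodic(1)[of x] by (simp add: D_def)
  qed
qed

text \<open>A chord of length \<open>h\<close> that does not cross \<open>E z\<close> either covers
  its arc of length \<open>h - 1\<close>, in two ways, or fits into the complementary arc of length
  \<open>h + 2\<close>, in three ways.\<close>

lemma E_D:
  assumes "E z = D y" "z - 1 \<le> y" "y \<le> z + m - 2"
  shows "y = z - 1 \<or> y = z \<or> z + h - 1 \<le> y \<and> y \<le> z + h + 1"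
proof (rule ccontr)
  assume n: "\<not> ?thesis"
  consider "z < y" "y < z + h - 1" | "y > z + h + 1" using n assms by linarith
  then show False
  proof cases
    case 1
    then show ?thesis
      using chords[of z y "z + h - 1" "y + h"] assms q r by (simp add: D_def E_def)
  next
    case 2
    then show ?thesis
      using chords[of y "z + m" "y + h" "z + m + h - 1"] assms q r periodic(2)[of z]
      by (simp add: D_def E_def)
  qed
qed

lemma E_E: "E z \<noteq> E (z + 1)" "E z \<noteq> E (z + 2)"
  using chords[of z "z + 1" "z + h - 1" "z + h"] chords[of z "z + 2" "z + h - 1" "z + h + 1"] q r
  by (simp_all add: E_def algebra_simps)

text \<open>The length is \<open>r = h - q\<close>, so \<open>R u\<close> fits into the arc of
  \<open>D y\<close> in \<open>q + 1\<close> ways and into the complementary arc, of length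
  \<open>h + 1\<close>, in \<open>q + 2\<close> ways.\<close>

lemma R_D:
  assumes "R u = D y" "y \<le> u" "u < y + m"
  shows "u \<le> y + q \<or> y + h \<le> u \<and> u \<le> y + h + q + 1"
proof (rule ccontr)
  assume n: "\<not> ?thesis"
  consider "y + q < u" "u < y + h" | "y + h + q + 1 < u" using n by linarith
  then show False
  proof cases
    case 1
    then show ?thesis using chords[of y u "y + h" "u + r"] assms q r by (simp add: D_def R_def)
  next
    case 2
    then show ?thesis
      using chords[of u "y + m" "u + r" "y + m + h"] assms q r periodic(1)[of y]
      by (simp add: D_def R_def)
  qed
qed

lemma R_R:
  assumes "R u = R v" "u < v" "v < u + m"
  shows "u + r \<le> v" "v \<le> u + m - r"
proof -
  show "u + r \<le> v"
    using chords[of u v "u + r" "v + r"] assms q r by (force simp: R_def)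
  show "v \<le> u + m - r"
    using chords[of v "u + m" "v + r" "u + m + r"] assms q r periodic(4)[of u] by (force simp: R_def)
qed

text \<open>If a longest chord starts in the first half of a group, its own arc stays within
  \<open>(k + 1) div 2\<close> groups. If it starts in the second half, the complementary arc does,
  which is the case of \<open>spoke_far\<close>.\<close>

lemma spoke_near:
  assumes "l dvd G" "G \<le> y" "y \<le> G + q" "y < z" "z < y + h"
  shows "S z \<noteq> D y"
  using spokes[of G y z "y + h"] assms by (simp add: D_def eq_commute)

lemma spoke_far:
  assumes "l dvd G" "G + q < y" "y \<le> G + 2 * q" "y + h < z" "z < y + m"
  shows "S z \<noteq> D y"
proof -
  have "l dvd G + r + l" using assms(1) l_dvd_r by simp
  moreover have "K (y + h) (y + m) = D y" by (simp only: K_flip D_def)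
  ultimately show ?thesis using spokes[of "G + r + l" "y + h" z "y + m"] assms by (simp add: eq_commute)
qed

lemma spoke_R:
  assumes "u < z" "z < u + r"
  shows "S z \<noteq> R u"
proof -
  obtain G P where "u = G + P" "l dvd G" "0 \<le> P" "P \<le> 2 * q" using split_l[of u] .
  then show ?thesis using spokes[of G u z "u + r"] assms by (simp add: R_def eq_commute)
qed

text \<open>Three chords of one colour would have two consecutive gaps of at least \<open>h\<close>
  each, but the outer two are at most \<open>h + 1\<close> apart.\<close>

lemma D_fibre_le_2: "card {x \<in> {0..<m}. D x = c} \<le> 2"
proof (rule card_int_le_2)
  fix a b d assume "a \<in> {x \<in> {0..<m}. D x = c}" "b \<in> {x \<in> {0..<m}. D x = c}"
    "d \<in> {x \<in> {0..<m}. D x = c}" "a < b" "b < d"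
  then show False using D_D[of a b] D_D[of a d] D_D[of b d] q r by auto
qed

lemma card_window: "card {x..<x + m} + 1 = 2 * card C"
  using card_C q r by simp

lemma shift_window:
  assumes "s \<le> x" "x < s + m" "s' \<le> s" "s < s' + m"
  obtains x' where "s' \<le> x'" "x' < s' + m" "D x' = D x" "x' = x \<or> x' = x - m"
proof (cases "x < s' + m")
  case True
  then show ?thesis using that[of x] assms by simp
next
  case False
  have "D (x - m) = D x" using periodic(1)[of "x - m"] by simp
  then show ?thesis using that[of "x - m"] False assms by simp
qed

lemma shift_window':
  assumes "s' \<le> x" "x < s' + m" "s' \<le> s" "s < s' + m"
  obtains x' where "s \<le> x'" "x' < s + m" "D x' = D x" "x' = x \<or> x' = x + m"
proof (cases "x < s")
  case True
  then show ?thesis using that[of "x + m"] periodic(1)[of x] assms by simp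
next
  case False
  then show ?thesis using that[of x] assms by simp
qed

text \<open>The count \<open>m + 1 = 2 * card C\<close> singles out one colour. The window is then
  moved to start at its only longest chord, so that all partners lie strictly inside.\<close>

lemma single_exists:
  obtains s where "\<And>x. \<lbrakk>s < x; x < s + m\<rbrakk> \<Longrightarrow> D x \<noteq> D s"
    "\<And>c. c \<in> C \<Longrightarrow> \<exists>x\<ge>s. x < s + m \<and> D x = c"
    "\<And>x. \<lbrakk>s < x; x < s + m\<rbrakk> \<Longrightarrow> \<exists>y>s. y < s + m \<and> y \<noteq> x \<and> D y = D x"
proof -
  let ?N = "\<lambda>c. {x \<in> {0..<m}. D x = c}"
  have "\<exists>c0\<in>C. card (?N c0) = 1 \<and> (\<forall>c\<in>C. c \<noteq> c0 \<longrightarrow> card (?N c) = 2)"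
    using finite_C in_C(1) card_window[of 0] D_fibre_le_2
    by (intro fibres_of_almost_double_cover) auto
  then obtain c0 where c0: "c0 \<in> C" "card (?N c0) = 1" "\<And>c. c \<in> C \<Longrightarrow> c \<noteq> c0 \<Longrightarrow> card (?N c) = 2"
    by blast
  obtain s where s: "?N c0 = {s}" using c0(2) by (rule card_1_singletonE)
  then have "s \<in> ?N c0" by blast
  then have s': "0 \<le> s" "s < 0 + m" "D s = c0" by simp_all
  show ?thesis
  proof (rule that[of s])
    show 1: "D x \<noteq> D s" if x: "s < x" "x < s + m" for x
    proof
      assume "D x = D s"
      obtain x' where "0 \<le> x'" "x' < 0 + m" "D x' = D x" "x' = x \<or> x' = x - m"
        using shift_window[of s x 0] x s' by (metis less_imp_le)
      then have "x' \<in> ?N c0" "x' \<noteq> s" using s' x \<open>D x = D s\<close> by auto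
      then show False using s by blast
    qed
    show "\<exists>x\<ge>s. x < s + m \<and> D x = c" if c: "c \<in> C" for c
    proof -
      have "card (?N c) \<noteq> 0" using c0 c by (metis one_neq_zero zero_neq_numeral)
      then obtain x where "x \<in> ?N c" by (metis card.empty ex_in_conv)
      then show ?thesis using shift_window'[of 0 x s] s' by auto
    qed
    show "\<exists>y>s. y < s + m \<and> y \<noteq> x \<and> D y = D x" if x: "s < x" "x < s + m" for x
    proof -
      have "D x \<noteq> c0" using 1[OF x] s' by simp
      then have "card (?N (D x)) = 2" using c0(3) in_C(1) by blast
      then obtain a b where ab: "?N (D x) = {a, b}" "a \<noteq> b" unfolding card_2_iff by blast
      obtain x' where x': "0 \<le> x'" "x' < 0 + m" "D x' = D x" "x' = x \<or> x' = x - m"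
        using shift_window[of s x 0] x s' by (metis less_imp_le)
      obtain y' where "y' \<in> ?N (D x)" "y' \<noteq> x'" using ab by blast
      then have y': "0 \<le> y'" "y' < 0 + m" "D y' = D x" "y' \<noteq> x'" by simp_all
      obtain y where y: "s \<le> y" "y < s + m" "D y = D x" "y = y' \<or> y = y' + m"
        using shift_window'[of 0 y' s] y' s' by metis
      have "y \<noteq> s" using y(3) \<open>D x \<noteq> c0\<close> s' by auto
      moreover have "y \<noteq> x" using x' y' y by auto
      ultimately show ?thesis using y by (intro exI[of _ y]) simp
    qed
  qed
qed

end

text \<open>\<^term>\<open>D s\<close> is the longest chord that is alone in its colour.\<close>

locale wheel_colouring_at = wheel_colouring +
  fixes s :: int
  assumes single: "\<lbrakk>s < x; x < s + m\<rbrakk> \<Longrightarrow> D x \<noteq> D s"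
    and D_covers: "c \<in> C \<Longrightarrow> \<exists>x\<ge>s. x < s + m \<and> D x = c"
    and D_partner: "\<lbrakk>s < x; x < s + m\<rbrakk> \<Longrightarrow> \<exists>y>s. y < s + m \<and> y \<noteq> x \<and> D y = D x"
begin

section \<open>Pairing the longest chords and placing those of length \<open>h - 1\<close>\<close>

lemma D_partner_cases:
  assumes "s < x" "x < s + m"
  obtains y where "s < y" "y < s + m" "D y = D x"
    "y = x + h \<or> y = x + h + 1 \<or> x = y + h \<or> x = y + h + 1"
proof -
  obtain y where y: "s < y" "y < s + m" "y \<noteq> x" "D y = D x" using D_partner assms by blast
  have "y = x + h \<or> y = x + h + 1 \<or> x = y + h \<or> x = y + h + 1"
    using D_D[of x y] D_D[of y x] y assms by (cases "x < y") auto
  then show ?thesis using y that by blast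
qed

text \<open>Inside the window \<open>D (s + h)\<close> has only one possible partner,
  \<open>D (s + 2 * h)\<close>. This takes away one of the two candidates of
  \<open>D (s + h - 1)\<close>, and so on downwards. The apex of the pair is \<open>x + h\<close>,
  so the apices are the points after \<open>s + h\<close> and before \<open>s + m\<close>.\<close>

lemma D_pair:
  assumes "s < x" "x \<le> s + h"
  shows "D (x + h) = D x"
proof -
  have "D (s + h - int n + h) = D (s + h - int n)" if "int n < h" for n
    using that
  proof (induction n)
    case 0
    show ?case
      by (rule D_partner_cases[of "s + h"]) (use q r in auto)
  next
    case (Suc n)
    let ?x = "s + h - int (Suc n)"
    obtain y where y: "s < y" "y < s + m" "D y = D ?x"
      "y = ?x + h \<or> y = ?x + h + 1 \<or> ?x = y + h \<or> ?x = y + h + 1"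
      by (rule D_partner_cases[of ?x]) (use q r Suc.prems in auto)
    have "y \<noteq> ?x + h + 1"
    proof
      assume "y = ?x + h + 1"
      then have "y = s + h - int n + h" by simp
      then have "D (s + h - int n) = D ?x" using Suc y by simp
      moreover have "s + h - int n = ?x + 1" by simp
      ultimately have "D (?x + 1) = D ?x" by (simp only:)
      then show False using D_D[of ?x "?x + 1"] q r by simp
    qed
    moreover have "?x \<noteq> y + h" "?x \<noteq> y + h + 1" using y Suc.prems by auto
    ultimately show ?case using y by auto
  qed
  from this[of "nat (s + h - x)"] show ?thesis using assms by simp
qed

lemma colour_cases:
  assumes "c \<in> C" "c \<noteq> D s"
  obtains x where "s < x" "x \<le> s + h" "D x = c" "D (x + h) = c"
proof -
  obtain x where x: "s \<le> x" "x < s + m" "D x = c" using D_covers assms by blast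
  then have "s < x" using assms by (cases "x = s") auto
  show ?thesis
  proof (cases "x \<le> s + h")
    case True
    then show ?thesis using that[of x] D_pair[of x] x \<open>s < x\<close> by simp
  next
    case False
    then show ?thesis using that[of "x - h"] D_pair[of "x - h"] x by simp
  qed
qed

text \<open>The two longest chords of a colour start \<open>h\<close> or \<open>h + 1\<close> apart
  on the circle, so they cannot both be among the three that \<open>E_D\<close> admits behind
  \<open>E z\<close>. The single chord \<open>D s\<close> has no partner and therefore leaves a
  hole: three positions \<open>z\<close> opposite to \<open>s\<close> where \<open>E z\<close> may
  take its colour.\<close>

lemma E_cases:
  assumes "s < z" "z \<le> s + m"
  shows "E z = D z \<or> E z = D (z - 1) \<or> E z = D s \<and> s + h \<le> z \<and> z \<le> s + h + 2"
proof (cases "E z = D s")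
  case True
  have per: "D (s + m) = D s" by (rule periodic)
  show ?thesis
  proof (cases "z = s + 1")
    case False
    then have "s + m = z - 1 \<or> s + m = z \<or> z + h - 1 \<le> s + m \<and> s + m \<le> z + h + 1"
      using E_D[of z "s + m"] True per assms by simp
    then show ?thesis using True per assms by auto
  qed (use True in simp)
next
  case False
  obtain x where x: "s < x" "x \<le> s + h" "D x = E z" "D (x + h) = E z"
    using colour_cases[OF in_C(2) False] by metis
  have lift: "\<exists>y'. (y' = y \<or> y' = y + m) \<and> z - 1 \<le> y' \<and> y' \<le> z + m - 2 \<and> D y' = D y"
    if "s < y" "y < s + m" for y
    using that assms periodic(1)[of y]
    by (cases "z - 1 \<le> y") (auto intro: exI[of _ y] exI[of _ "y + m"])
  obtain a where a: "a = x \<or> a = x + m" "z - 1 \<le> a" "a \<le> z + m - 2" "D a = E z"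
    using lift[of x] x by auto
  obtain b where b: "b = x + h \<or> b = x + h + m" "z - 1 \<le> b" "b \<le> z + m - 2" "D b = E z"
    using lift[of "x + h"] x by auto
  have "a = z - 1 \<or> a = z \<or> z + h - 1 \<le> a \<and> a \<le> z + h + 1"
    using E_D[of z a] a by simp
  moreover have "b = z - 1 \<or> b = z \<or> z + h - 1 \<le> b \<and> b \<le> z + h + 1"
    using E_D[of z b] b by simp
  ultimately have "a = z - 1 \<or> a = z \<or> b = z - 1 \<or> b = z"
    using a(1) b(1) q r by linarith
  then show ?thesis using a(4) b(4) by metis
qed

text \<open>Neighbouring chords \<open>E\<close> cross, so \<open>E z = D z\<close> denies this
  colour to \<open>E (z + 1)\<close>, which must move on to \<open>D (z + 1)\<close>. The start at
  \<open>s + h + 2\<close> keeps every later chord out of the hole.\<close>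

lemma E_up:
  assumes "E z0 = D z0" "s + h + 2 \<le> z0" "z0 \<le> z" "z \<le> s + m"
  shows "E z = D z"
proof -
  have "z0 + int n \<le> s + m \<Longrightarrow> E (z0 + int n) = D (z0 + int n)" for n
  proof (induction n)
    case (Suc n)
    then have "E (z0 + int n) = D (z0 + int n)" by simp
    then show ?case
      using E_cases[of "z0 + int (Suc n)"] E_E(1)[of "z0 + int n"] Suc.prems assms q r
      by (auto simp: algebra_simps)
  qed (use assms in simp)
  from this[of "nat (z - z0)"] show ?thesis using assms by simp
qed

text \<open>The mirror image of \<open>E_up\<close>, except that the run may pass the hole, where it
  could switch to the colour of \<open>D s\<close>.\<close>

lemma E_down:
  assumes "E z0 = D (z0 - 1)" "z0 \<le> s + m" "s < z" "z \<le> z0"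
    and no_hole: "\<And>y. \<lbrakk>z \<le> y; y < z0; s + h \<le> y; y \<le> s + h + 2\<rbrakk> \<Longrightarrow> E y \<noteq> D s"
  shows "E z = D (z - 1)"
proof -
  have "z \<le> z0 - int n \<Longrightarrow> E (z0 - int n) = D (z0 - int n - 1)" for n
  proof (induction n)
    case (Suc n)
    then have "E (z0 - int n) = D (z0 - int n - 1)" by simp
    then show ?case
      using E_cases[of "z0 - int (Suc n)"] E_E(1)[of "z0 - int (Suc n)"] Suc.prems assms q r
        no_hole[of "z0 - int (Suc n)"]
      by (auto simp: algebra_simps)
  qed (use assms in simp)
  from this[of "nat (z0 - z)"] show ?thesis using assms by simp
qed

text \<open>\<open>E (s + m)\<close> is \<open>E s\<close>, so an upward and a downward run would
  give the colour of \<open>D s\<close> to two chords that cross.\<close>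

lemma E_ends: "\<not> (E (s + m) = D (s + m) \<and> E (s + 1) = D s)"
  using E_E(1)[of s] periodic[of s] by auto

section \<open>Colours with two chords \<open>R\<close>\<close>

lemma R_lift:
  assumes "R u = D y" "s \<le> y" "y < s + m" "s \<le> u" "u < s + m"
  obtains u' where "u' = u \<or> u' = u + m" "y \<le> u'" "u' < y + m" "R u' = D y"
    "u' \<le> y + q \<or> y + h \<le> u' \<and> u' \<le> y + h + q + 1"
proof (cases "y \<le> u")
  case True
  then show ?thesis using that[of u] R_D[of u y] assms by simp
next
  case False
  then show ?thesis using that[of "u + m"] R_D[of "u + m" y] assms periodic(4)[of u] by simp
qed

text \<open>Both intervals in \<open>R_D\<close> are shorter than \<open>r\<close>, the least
  distance between two chords \<open>R\<close> of one colour, so each interval contains at most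
  one.\<close>

lemma R_fibre_le_2:
  assumes "c \<in> C"
  shows "card {u \<in> {s..<s + m}. R u = c} \<le> 2"
proof (rule card_int_le_2)
  fix a b d assume "a \<in> {u \<in> {s..<s + m}. R u = c}" "b \<in> {u \<in> {s..<s + m}. R u = c}"
    "d \<in> {u \<in> {s..<s + m}. R u = c}" and lt: "a < b" "b < d"
  then have abd: "s \<le> a" "d < s + m" "R a = c" "R b = c" "R d = c" by simp_all
  obtain y where y: "s \<le> y" "y < s + m" "D y = c" using D_covers assms by blast
  obtain a' where a: "a' = a \<or> a' = a + m" "y \<le> a'" "a' < y + m"
    "a' \<le> y + q \<or> y + h \<le> a' \<and> a' \<le> y + h + q + 1"
    by (rule R_lift[of a y]) (use abd y lt in auto)
  obtain b' where b: "b' = b \<or> b' = b + m" "y \<le> b'" "b' < y + m"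
    "b' \<le> y + q \<or> y + h \<le> b' \<and> b' \<le> y + h + q + 1"
    by (rule R_lift[of b y]) (use abd y lt in auto)
  obtain d' where d: "d' = d \<or> d' = d + m" "y \<le> d'" "d' < y + m"
    "d' \<le> y + q \<or> y + h \<le> d' \<and> d' \<le> y + h + q + 1"
    by (rule R_lift[of d y]) (use abd y lt in auto)
  have far: "r \<le> b - a" "r \<le> d - b" "d - a \<le> m - r"
    using R_R[of a b] R_R[of b d] R_R[of a d] abd lt by simp_all
  have "\<not> (a' \<le> y + q \<and> b' \<le> y + q)" "\<not> (a' \<le> y + q \<and> d' \<le> y + q)" "\<not> (b' \<le> y + q \<and> d' \<le> y + q)"
    using a b d far q r by linarith+
  moreover have "\<not> (y + h \<le> a' \<and> y + h \<le> b' \<and> a' \<le> y + h + q + 1 \<and> b' \<le> y + h + q + 1)"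
     "\<not> (y + h \<le> a' \<and> y + h \<le> d' \<and> a' \<le> y + h + q + 1 \<and> d' \<le> y + h + q + 1)"
     "\<not> (y + h \<le> b' \<and> y + h \<le> d' \<and> b' \<le> y + h + q + 1 \<and> d' \<le> y + h + q + 1)"
    using a b d far q r by linarith+
  ultimately show False using a b d by linarith
qed

lemma R_deficient:
  assumes "D y = c" "s \<le> y" "y < s + m" "c \<in> C"
    and side: "(\<forall>u. y \<le> u \<and> u \<le> y + q \<longrightarrow> R u \<noteq> c) \<or> (\<forall>u. y + h \<le> u \<and> u \<le> y + h + q + 1 \<longrightarrow> R u \<noteq> c)"
  shows "card {u \<in> {s..<s + m}. R u = c} \<le> 1"
proof (rule card_int_le_1)
  fix a b assume "a \<in> {u \<in> {s..<s + m}. R u = c}" "b \<in> {u \<in> {s..<s + m}. R u = c}" and lt: "a < b"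
  then have ab: "s \<le> a" "b < s + m" "R a = c" "R b = c" by simp_all
  obtain a' where a: "a' = a \<or> a' = a + m" "y \<le> a'" "a' < y + m" "R a' = c"
    "a' \<le> y + q \<or> y + h \<le> a' \<and> a' \<le> y + h + q + 1"
    by (rule R_lift[of a y]) (use ab assms lt in auto)
  obtain b' where b: "b' = b \<or> b' = b + m" "y \<le> b'" "b' < y + m" "R b' = c"
    "b' \<le> y + q \<or> y + h \<le> b' \<and> b' \<le> y + h + q + 1"
    by (rule R_lift[of b y]) (use ab assms lt in auto)
  have far: "r \<le> b - a" "b - a \<le> m - r"
    using R_R[of a b] ab lt by simp_all
  consider "a' \<le> y + q" "b' \<le> y + q"
    | "y + h \<le> a'" "a' \<le> y + h + q + 1" "y + h \<le> b'" "b' \<le> y + h + q + 1"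
    using side a b by blast
  then show False
    using a(1) b(1) a(2) b(2) far q r by cases linarith+
qed (rule finite_subset[of _ "{s..<s + m}"], auto)

text \<open>Two is the most that a colour can hold, and \<open>m\<close> chords \<open>R\<close> in
  \<open>h + 1\<close> colours leave exactly one colour that is not full.\<close>

definition full :: "'a \<Rightarrow> bool" where
  "full c \<longleftrightarrow> card {u \<in> {s..<s + m}. R u = c} = 2"

lemma full_R:
  assumes "full c" "c \<in> C" "D y = c" "s \<le> y" "y < s + m"
  shows "\<exists>u\<ge>y. u \<le> y + q \<and> R u = c" "\<exists>u\<ge>y + h. u \<le> y + h + q + 1 \<and> R u = c"
  using R_deficient[of y c] assms unfolding full_def by force+

lemma not_full_unique:
  assumes "c \<in> C" "c' \<in> C" "\<not> full c" "\<not> full c'"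
  shows "c = c'"
proof -
  have "\<exists>c0\<in>C. card {u \<in> {s..<s + m}. R u = c0} = 1 \<and>
      (\<forall>c\<in>C. c \<noteq> c0 \<longrightarrow> card {u \<in> {s..<s + m}. R u = c} = 2)"
    using finite_C in_C(4) card_window[of s] R_fibre_le_2
    by (intro fibres_of_almost_double_cover) auto
  then show ?thesis using assms unfolding full_def by metis
qed

section \<open>Spokes\<close>

lemma l_dvd_shift: "l dvd a \<Longrightarrow> b = a + c * l + d * r \<Longrightarrow> l dvd b"
  using l_dvd_r by simp

text \<open>Adding \<open>h = r + q\<close> advances the position within a group by
  \<open>q\<close>. So one of \<open>D x\<close> and \<open>D (x + h)\<close> starts in the second
  half of a group, unless \<open>x\<close> starts a group, and \<open>spoke_far\<close> confines the
  spoke to the arc of that chord. If \<open>x\<close> starts a group, the two chords cut off all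
  points but \<open>x\<close>, \<open>x - 1\<close> and the apex \<open>x + h\<close>, of which only
  the apex is not at an end of its group.\<close>

lemma spoke_cases:
  assumes z: "s \<le> z" "z < s + m" and b: "l dvd z - b" "1 \<le> b" "b < 2 * q" and "S z \<noteq> D s"
  shows "(\<exists>y P. s < y \<and> y < s + m \<and> D y = S z \<and> l dvd y - P \<and> q < P \<and> P \<le> 2 * q \<and>
        (y \<le> z \<and> z \<le> y + h \<or> z + m \<le> y + h)) \<or> b = q \<and> s + h < z"
proof -
  obtain x where x: "s < x" "x \<le> s + h" "D x = S z" "D (x + h) = S z"
    using colour_cases[OF S_in \<open>S z \<noteq> D s\<close>] by metis
  obtain G P where G: "x = G + P" "l dvd G" "0 \<le> P" "P \<le> 2 * q" using split_l[of x] .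
  have inside: ?thesis if y: "y = G' + P'" "l dvd G'" "q < P'" "P' \<le> 2 * q" "s < y" "y < s + m" "D y = S z"
    for y G' P'
  proof -
    have "y \<le> z \<Longrightarrow> z \<le> y + h" "z < y \<Longrightarrow> z + m \<le> y + h"
      using spoke_far[of G' y z] spoke_far[of G' y "z + m"] S_periodic[of z] y z by force+
    then have "y \<le> z \<and> z \<le> y + h \<or> z + m \<le> y + h" by linarith
    moreover have "l dvd y - P'" using y by simp
    ultimately show ?thesis using y(3-7) by blast
  qed
  consider "P = 0" | "0 < P" "P \<le> q" | "q < P" using G by linarith
  then show ?thesis
  proof cases
    case 1
    have Gr: "l dvd G + r" using G l_dvd_r by simp
    have near: "S z' \<noteq> D x" if "x < z'" "z' < x + h \<or> x + h < z' \<and> z' < x + 2 * h" for z'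
      using spoke_near[of G x z'] spoke_near[of "G + r" "x + h" z'] that G Gr x 1 by auto
    have "z = x \<or> z = x - 1 \<or> z = x + h \<or> z = x + 2 * h"
      using near[of z] near[of "z + m"] S_periodic[of z] x z by (cases "x \<le> z") force+
    moreover have "z \<noteq> x" using dvd_diff_unique[of l z 0 b] G 1 b by auto
    moreover have "z \<noteq> x - 1" using dvd_diff_unique[of l z "-1" b] G 1 b by auto
    moreover have "z \<noteq> x + 2 * h"
    proof
      assume "z = x + 2 * h"
      moreover have "l dvd G + 2 * r" using G l_dvd_r by simp
      ultimately show False using dvd_diff_unique[of l z "2 * q" b] G 1 b by (simp add: algebra_simps)
    qed
    ultimately have zx: "z = x + h" by blast
    moreover have "x + h - q = G + r" using G 1 by simp
    ultimately have "l dvd z - q" using Gr by (simp only:)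
    moreover have "\<bar>q - b\<bar> < l" using b by linarith
    ultimately have "b = q" using dvd_diff_unique[of l z q b] b(1) by simp
    then show ?thesis using zx x by simp
  next
    case 2
    have "l dvd G + r" using G l_dvd_r by simp
    then show ?thesis using inside[of "x + h" "G + r" "P + q"] 2 G x by simp
  next
    case 3
    then show ?thesis using inside[of x G P] G x by simp
  qed
qed

lemma full_spoke_at:
  assumes y: "s \<le> y" "y < s + m" "D y = S z" "l dvd y - P" "q < P" "P \<le> 2 * q" "full (S z)"
    and z: "l dvd z - b" "1 \<le> b" "b < 2 * q" and z': "z' = z \<or> z' = z + m" "y \<le> z'" "z' \<le> y + h"
  shows "\<exists>i u. 0 \<le> i \<and> i \<le> q \<and> (b = P + i \<or> b + l = P + i) \<and> R u = D y \<and>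
    (z' = y + i \<and> y + i \<le> u \<and> u \<le> y + q \<or> z' = y + r + i \<and> y \<le> u \<and> u \<le> y + i)"
proof -
  obtain u where u: "y \<le> u" "u \<le> y + q" "R u = D y"
    using full_R(1)[OF y(7) S_in y(3,1,2)] y(3) by auto
  have "S z' = S z" using z' S_periodic by auto
  then have out: "z' \<le> u \<or> u + r \<le> z'" using spoke_R[of u z'] u y(3) by force
  \<comment> \<open>\<open>R u\<close> forces \<open>z'\<close> to the front of the arc, up to
    \<open>u\<close>, or to its back, from \<open>u + r\<close> on. As \<open>l\<close> divides
    \<open>r\<close>, the offset \<open>i\<close> gives the position \<open>P + i\<close> modulo
    \<open>l\<close> in both cases.\<close>
  define i where "i = (if z' \<le> u then z' - y else z' - y - r)"
  have i: "0 \<le> i" "i \<le> q"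
    "z' = y + i \<and> y + i \<le> u \<and> u \<le> y + q \<or> z' = y + r + i \<and> y \<le> u \<and> u \<le> y + i"
    using out u z' r by (auto simp: i_def)
  have near: "\<bar>b - (P + i)\<bar> < l \<or> \<bar>b - (P + i - l)\<bar> < l"
    using z(2,3) y(5,6) i(1,2) by linarith
  have "l dvd z' - b"
  proof -
    have "z + m - b = (z - b) + m" by simp
    then have "l dvd z + m - b" using z(1) l_dvd_m by (simp only: dvd_add)
    then show ?thesis using z' z by auto
  qed
  moreover have "l dvd z' - (P + i)"
  proof -
    have "l dvd (y - P) + r" using y(4) l_dvd_r by simp
    then show ?thesis using i(3) y(4) by (auto simp: algebra_simps)
  qed
  moreover have "l dvd z' - (P + i - l)"
  proof -
    have "z' - (P + i - l) = (z' - (P + i)) + l" by simp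
    then show ?thesis using calculation(2) by (simp only: dvd_add dvd_refl)
  qed
  ultimately have "b = P + i \<or> b = P + i - l"
    using dvd_diff_unique[of l z' b "P + i"] dvd_diff_unique[of l z' b "P + i - l"] near by blast
  then show ?thesis using i u by (intro exI[of _ i] exI[of _ u]) auto
qed

text \<open>The chord \<^term>\<open>R u\<close> separates its arc from the centre, which confines the spoke to the two ends of
  the arc from \<^term>\<open>y\<close> to \<^term>\<open>y + h\<close>. In particular the middle \<^term>\<open>b = q\<close> of a group is reached only when
  it is the apex of the two longest chords.\<close>

lemma full_spoke:
  assumes "s \<le> z" "z < s + m" "l dvd z - b" "1 \<le> b" "b < 2 * q" "S z \<noteq> D s" "full (S z)"
  obtains "b = q" "s + h < z"
  | y P i u where "s < y" "y < s + m" "D y = S z" "l dvd y - P" "q < P" "P \<le> 2 * q" "0 \<le> i" "i \<le> q"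
    "b = P + i \<or> b + l = P + i" "R u = D y"
    "(z = y + i \<or> z + m = y + i) \<and> y + i \<le> u \<and> u \<le> y + q \<or>
     (z = y + r + i \<or> z + m = y + r + i) \<and> y \<le> u \<and> u \<le> y + i"
proof -
  consider y P where "s < y" "y < s + m" "D y = S z" "l dvd y - P" "q < P" "P \<le> 2 * q"
      "y \<le> z \<and> z \<le> y + h \<or> z + m \<le> y + h"
    | "b = q" "s + h < z"
    using spoke_cases[OF assms(1-6)] by blast
  then show ?thesis
  proof cases
    case 1
    define z' where "z' = (if y \<le> z \<and> z \<le> y + h then z else z + m)"
    have z': "z' = z \<or> z' = z + m" "y \<le> z'" "z' \<le> y + h"
      using 1(1,2,7) assms(1) by (auto simp: z'_def)
    obtain i u where iu: "0 \<le> i" "i \<le> q" "b = P + i \<or> b + l = P + i" "R u = D y"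
      "z' = y + i \<and> y + i \<le> u \<and> u \<le> y + q \<or> z' = y + r + i \<and> y \<le> u \<and> u \<le> y + i"
      using full_spoke_at[OF _ 1(2-6) assms(7,3-5) z'] 1(1) by auto
    have "(z = y + i \<or> z + m = y + i) \<and> y + i \<le> u \<and> u \<le> y + q \<or>
      (z = y + r + i \<or> z + m = y + r + i) \<and> y \<le> u \<and> u \<le> y + i"
      using iu(5) z'(1) by auto
    then show ?thesis using that(2)[OF 1(1-6) iu(1-4)] by blast
  qed (rule that(1))
qed

text \<open>Position \<open>q\<close> would require \<open>P + i = q\<close> or
  \<open>P + i = 3 * q + 1\<close>, but \<open>q < P\<close> and \<open>P + i \<le> 3 * q\<close>;
  the apices lie beyond \<open>s + h\<close>. Thus such a spoke exhibits the one colour that is not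
  full.\<close>

lemma q_spoke_not_full:
  assumes "s \<le> z" "z \<le> s + h" "l dvd z - q" "S z \<noteq> D s"
  shows "\<not> full (S z)"
proof
  assume "full (S z)"
  show False
    by (rule full_spoke[of z q]) (use \<open>full (S z)\<close> assms q r in auto)
qed

text \<open>\<open>E x\<close> is one step shorter than a longest chord, so it may start one
  position later and still stay within \<open>(k + 1) div 2\<close> groups. Correspondingly
  \<open>spoke_F_near\<close> gains two positions.\<close>

lemma spoke_E_near:
  assumes "l dvd G" "G \<le> x" "x \<le> G + q + 1" "x < z" "z < x + h - 1"
  shows "S z \<noteq> E x"
  using spokes[of G x z "x + h - 1"] assms by (simp add: E_def eq_commute)

lemma spoke_E_far:
  assumes "l dvd G" "G + q + 2 \<le> x" "x \<le> G + 2 * q" "x + h - 1 < z" "z < x + m"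
  shows "S z \<noteq> E x"
proof -
  have "l dvd G + r + l" using assms(1) l_dvd_r by simp
  moreover have "K (x + h - 1) (x + m) = E x" by (simp only: K_flip E_def)
  ultimately show ?thesis using spokes[of "G + r + l" "x + h - 1" z "x + m"] assms by (simp add: eq_commute)
qed

lemma E_R:
  assumes "u < x \<and> x < u + r \<or> x + q - 1 < u \<and> u < x + h - 1"
  shows "E x \<noteq> R u"
proof -
  consider "u < x" "x < u + r" | "x + q - 1 < u" "u < x + h - 1" using assms by blast
  then show ?thesis
  proof cases
    case 1
    then show ?thesis using chords[of u x "u + r" "x + h - 1"] q r by (simp add: E_def R_def eq_commute)
  next
    case 2
    then show ?thesis using chords[of x u "x + h - 1" "u + r"] q r by (simp add: E_def R_def)
  qed
qed

lemma far_sides: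
  assumes "S z = D y" "l dvd y - P" "q < P" "P \<le> 2 * q" "s \<le> z" "z < s + m" "s \<le> y" "y < s + m"
  shows "y \<le> z \<and> z \<le> y + h \<or> z + m \<le> y + h"
  using spoke_far[of "y - P" y z] spoke_far[of "y - P" y "z + m"] S_periodic[of z] assms by force

text \<open>Position \<open>q + 1\<close> leaves only \<open>P = q + 1\<close> and
  \<open>i = 0\<close>. Outside the hole, \<open>E_cases\<close> turns the first outcome into
  \<open>E (z + 1) = D (z + 1)\<close> and the second into \<open>E (z - r) = D (z - r - 1)\<close>
  and \<open>E (z - r + 1) = D (z - r + 1)\<close>.\<close>

lemma full_spoke_after:
  assumes "s < z" "z < s + m" "s < z - r" "l dvd z - (q + 1)" "S z \<noteq> D s" "full (S z)"
  shows "D z = S z \<and> E (z + 1) \<noteq> D z \<or>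
    D (z - r) = S z \<and> R (z - r) = S z \<and> E (z - r) \<noteq> S z \<and> E (z - r + 1) \<noteq> S z"
proof (rule full_spoke[of z "q + 1"])
  fix y P i u
  assume y: "s < y" "y < s + m" "D y = S z" "l dvd y - P" "q < P" "P \<le> 2 * q" "0 \<le> i" "i \<le> q"
    "q + 1 = P + i \<or> q + 1 + l = P + i" "R u = D y"
    and pos: "(z = y + i \<or> z + m = y + i) \<and> y + i \<le> u \<and> u \<le> y + q \<or>
     (z = y + r + i \<or> z + m = y + r + i) \<and> y \<le> u \<and> u \<le> y + i"
  then have P: "P = q + 1" "i = 0" by auto
  consider "y = z" | "y = z - r" "u = y" using pos P(2) y(1,2) assms(1-3) q r by linarith
  then show ?thesis
  proof cases
    case 1
    then have "E (z + 1) \<noteq> S z"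
      using spoke_E_far[of "z - (q + 1)" "z + 1" "z + m"] S_periodic[of z] assms q r by fastforce
    then show ?thesis using 1 y by simp
  next
    case 2
    have "E (z - r) \<noteq> S z"
      using spoke_E_near[of "y - (q + 1)" y z] 2 y P q r by fastforce
    moreover have "E (z - r + 1) \<noteq> R u" using E_R[of u "z - r + 1"] 2 q r by simp
    ultimately show ?thesis using 2 y by simp
  qed
qed (use assms q r in auto)

text \<open>Position \<open>q - 1\<close> arises only modulo \<open>l\<close>, from
  \<open>P = 2 * q\<close> and \<open>i = q\<close>. Again each outcome fixes the choice of chords
  \<open>E\<close>, here at \<open>z - h\<close> or around \<open>z - q\<close>.\<close>

lemma full_spoke_before:
  assumes "s + q < z" "z < s + m" "l dvd z - (q - 1)" "S z \<noteq> D s" "full (S z)"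
  shows "(\<exists>y. (y = z - h \<or> y = z - h + m) \<and> s < y \<and> y < s + m \<and> D y = S z \<and> E y \<noteq> S z) \<or>
    D (z - q) = S z \<and> E (z - q) \<noteq> S z \<and> E (z - q + 1) \<noteq> S z"
proof (rule full_spoke[of z "q - 1"])
  fix y P i u
  assume y: "s < y" "y < s + m" "D y = S z" "l dvd y - P" "q < P" "P \<le> 2 * q" "0 \<le> i" "i \<le> q"
    "q - 1 = P + i \<or> q - 1 + l = P + i" "R u = D y"
    and pos: "(z = y + i \<or> z + m = y + i) \<and> y + i \<le> u \<and> u \<le> y + q \<or>
     (z = y + r + i \<or> z + m = y + r + i) \<and> y \<le> u \<and> u \<le> y + i"
  have "P + i = 3 * q" using y(5,7,9) by linarith
  then have P: "P = 2 * q" "i = q" using y(6,8) by linarith+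
  have "z + m \<noteq> y + i" using y(2,8) assms(1) q r by linarith
  then consider "y = z - h \<or> y = z - h + m" | "y = z - q" "u = z" using pos P(2) by fastforce
  then show ?thesis
  proof cases
    case 1
    have "l dvd y - 2 * q" using y(4) P by simp
    moreover have "S (if y = z - h then z else z + m) = S z" by (simp add: S_periodic)
    ultimately have "S z \<noteq> E y"
      using spoke_E_far[of "y - 2 * q" y "if y = z - h then z else z + m"] 1 q r by (auto split: if_splits)
    then show ?thesis using 1 y by auto
  next
    case 2
    have "E y \<noteq> R u" by (rule E_R) (use 2 q r in linarith)
    moreover have "l dvd y + 1" using l_dvd_shift[OF y(4), of "y + 1" 1 0] P by simp
    then have "S z \<noteq> E (y + 1)"
      by (rule spoke_E_near) (use 2 q r in linarith)+
    ultimately show ?thesis using 2 y by auto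
  qed
qed (use assms q in simp_all)

text \<open>The spoke at \<open>p\<close> uses up the colour that is not full. The spokes at
  \<open>a\<close> and \<open>b\<close> lie in other colours, and their alternatives for the chords
  \<open>E\<close> contradict each other in every combination.\<close>

lemma impossible_generic:
  assumes G: "l dvd G" "G \<le> s" "s \<le> G + 2 * q" and big: "2 * l \<le> r \<or> G + q < s"
  shows False
proof -
  \<comment> \<open>The middle of a group and two points beside the gap opposite to it.\<close>
  define p where "p = G + l + q"
  define a where "a = G + r + l + q + 1"
  define b where "b = G + r + 2 * l + q - 1"
  have dvd: "l dvd p - q" "l dvd a - (q + 1)" "l dvd b - (q - 1)"
    using l_dvd_shift[OF G(1), of "p - q" 1 0] l_dvd_shift[OF G(1), of "a - (q + 1)" 1 1]
      l_dvd_shift[OF G(1), of "b - (q - 1)" 2 1] by (simp_all add: p_def a_def b_def)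
  have near: "r \<ge> 2 * l" if "s \<le> G + q" using big that by linarith
  have range_p: "s < p" "p \<le> s + h" and range_a: "s < a" "a + 1 < s + m" "s + h + 2 < a + 1" "s < a - r"
    "a - r \<le> s + h - 1" and range_b: "s < b" "b < s + m" "s < b - h" "b - h \<le> s + h - 1" "s + h + 2 < b - q + 1"
    using G big q r by (auto simp: p_def a_def b_def)
  \<comment> \<open>Even if the colour is that of \<open>D s\<close>, this chord starts at position
    \<open>s - G > q\<close>, and no offset up to \<open>q\<close> leads from there to position
    \<open>q\<close>.\<close>
  have p: "\<not> full (S p)"
  proof (cases "S p = D s")
    case True
    then have "G + q < s"
      using spoke_near[of G s p] G near q r by (force simp: p_def)
    show ?thesis
    proof
      assume "full (S p)"
      then have "\<exists>i. 0 \<le> i \<and> i \<le> q \<and> (q = s - G + i \<or> q + l = s - G + i)"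
        using full_spoke_at[of s p "s - G" q p] True G dvd(1) q r \<open>G + q < s\<close> range_p by auto
      then show False using \<open>G + q < s\<close> G by auto
    qed
  next
    case False
    then show ?thesis using q_spoke_not_full[of p] dvd(1) range_p by simp
  qed
  have full: "full c" if "c \<in> C" "c \<noteq> S p" for c
    using not_full_unique[of c "S p"] p S_in that by blast
  \<comment> \<open>If \<open>s\<close> lies in the first half of its group, the chord
    \<open>R u\<close> of the same colour behind the end of \<open>D s\<close> cuts both points off
    from the centre; otherwise \<open>D s\<close> itself does.\<close>
  have ab: "S z \<noteq> D s" if z: "z = a \<or> z = b" for z
  proof (cases "s \<le> G + q")
    case True
    then have "D s \<noteq> S p" using spoke_near[of G s p] G near q r by (force simp: p_def)
    then obtain u where u: "s + h \<le> u" "u \<le> s + h + q + 1" "R u = D s"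
      using full_R(2)[of "D s" s] full in_C(1) q r by auto
    then show ?thesis using spoke_R[of u z] z True near G q r by (auto simp: a_def b_def)
  next
    case False
    then show ?thesis using spoke_far[of G s z] z G q r by (auto simp: a_def b_def)
  qed
  have abp: "S z \<noteq> S p" if z: "z = a \<or> z = b" for z
  proof
    assume eq: "S z = S p"
    then have "S p \<noteq> D s" using ab[OF z] by simp
    then obtain y P where y: "s < y" "y < s + m" "D y = S p" "l dvd y - P" "q < P" "P \<le> 2 * q"
      "y \<le> p \<and> p \<le> y + h \<or> p + m \<le> y + h"
      using spoke_cases[of p q] dvd(1) range_p q r by auto
    have "y \<le> z \<and> z \<le> y + h \<or> z + m \<le> y + h"
      using far_sides[of z y P] y eq z range_a range_b by auto
    then have "G + l \<le> y \<and> y \<le> G + l + q \<or> G + r + 2 * l \<le> y \<and> y \<le> G + r + 2 * l + q - 1"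
      using y(2,7) z G(2,3) q r unfolding a_def b_def p_def by (elim disjE) auto
    moreover have "P = y - (G + l)" if "G + l \<le> y" "y \<le> G + l + q"
      using dvd_diff_unique[of l y P "y - (G + l)"] y G that q by simp
    moreover have "P = y - (G + r + 2 * l)" if "G + r + 2 * l \<le> y" "y \<le> G + r + 2 * l + q - 1"
    proof -
      have "l dvd y - (y - (G + r + 2 * l))" by (rule l_dvd_shift[OF G(1), of _ 2 1]) simp
      then show ?thesis using dvd_diff_unique[of l y P "y - (G + r + 2 * l)"] y that q by simp
    qed
    ultimately show False using y by auto
  qed
  have end_up: "E (s + m) = D (s + m)" if "E y = D y" "s + h + 2 \<le> y" "y \<le> s + m" for y
    using E_up[OF that(1,2,3)] by simp
  have end_down: "E (s + 1) = D s" if "E y = D (y - 1)" "s < y" "y \<le> s + h" for y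
    using E_down[of y "s + 1"] that q r by simp
  have A: "D a = S a \<and> E (a + 1) \<noteq> D a \<or>
    D (a - r) = S a \<and> R (a - r) = S a \<and> E (a - r) \<noteq> S a \<and> E (a - r + 1) \<noteq> S a"
    using full_spoke_after[of a] dvd(2) ab abp full S_in range_a by simp
  have B: "D (b - h) = S b \<and> E (b - h) \<noteq> S b \<or>
    D (b - q) = S b \<and> E (b - q) \<noteq> S b \<and> E (b - q + 1) \<noteq> S b"
    using full_spoke_before[of b] dvd(3) ab abp full S_in range_b q r by auto
  have A1: "E (a + 1) = D (a + 1)" if "E (a + 1) \<noteq> D a"
    using E_cases[of "a + 1"] that range_a by simp
  have A2: "E (a - r) = D (a - r - 1)" if "E (a - r) \<noteq> D (a - r)"
    using E_cases[of "a - r"] that range_a q by simp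
  have B1: "E (b - h) = D (b - h - 1)" if "E (b - h) \<noteq> D (b - h)"
    using E_cases[of "b - h"] that range_b by simp
  have B2: "E (b - q + 1) = D (b - q + 1)" if "E (b - q + 1) \<noteq> D (b - q)"
    using E_cases[of "b - q + 1"] that range_b q by simp
  \<comment> \<open>Two combinations bring an upward and a downward run to \<open>D s\<close>; in
    the other two, one run reaches a chord \<open>E\<close> whose colour the other spoke
    forbids.\<close>
  show False
    using A
  proof (elim disjE conjE)
    assume a: "D a = S a" "E (a + 1) \<noteq> D a"
    have up: "E y = D y" if "a + 1 \<le> y" "y \<le> s + m" for y
      using E_up[OF A1] a that range_a by simp
    show False
      using B
    proof (elim disjE conjE)
      assume "D (b - h) = S b" "E (b - h) \<noteq> S b"
      then have "E (s + 1) = D s" using end_down[OF B1] range_b by simp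
      then show False using up[of "s + m"] E_ends range_a by simp
    next
      assume "D (b - q) = S b" "E (b - q) \<noteq> S b"
      then show False using up[of "b - q"] G q r by (simp add: a_def b_def)
    qed
  next
    assume a: "D (a - r) = S a" "E (a - r) \<noteq> S a" "E (a - r + 1) \<noteq> S a"
    show False
      using B
    proof (elim disjE conjE)
      assume "D (b - h) = S b" "E (b - h) \<noteq> S b"
      then have "E (a - r + 1) = D (a - r)"
        using E_down[OF B1, of "a - r + 1"] range_a range_b q by (simp add: a_def b_def)
      then show False using a by simp
    next
      assume "D (b - q) = S b" "E (b - q + 1) \<noteq> S b"
      then have "E (s + m) = D (s + m)" using end_up[OF B2] range_b q by simp
      moreover have "E (s + 1) = D s" using end_down[OF A2] a range_a by simp
      ultimately show False using E_ends by blast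
    qed
  qed
qed

text \<open>\<open>D s\<close> cuts off \<open>p\<close> and \<open>p'\<close>, the middles of its
  first group and of the group \<open>r\<close> further on. Both precede the apices, so both spokes
  have the one colour that is not full. An arc of length \<open>h\<close> containing both starts in
  the first half of a group, contrary to \<open>spoke_cases\<close>.\<close>

lemma impossible_between:
  assumes G: "l dvd G" "G < s" "s < G + q"
  shows False
proof -
  define p where "p = G + q"
  define p' where "p' = G + r + q"
  have dvd: "l dvd p - q" "l dvd p' - q"
    using G l_dvd_shift[OF G(1), of "p' - q" 0 1] by (simp_all add: p_def p'_def)
  have pp': "S z \<noteq> D s" "\<not> full (S z)" if z: "z = p \<or> z = p'" for z
  proof -
    show "S z \<noteq> D s" using spoke_near[of G s z] z G q r by (auto simp: p_def p'_def)
    then show "\<not> full (S z)"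
      using q_spoke_not_full[of z] dvd z G q r by (auto simp: p_def p'_def)
  qed
  have eq: "S p = S p'" using not_full_unique[OF S_in S_in] pp' by blast
  obtain y P where y: "s < y" "y < s + m" "D y = S p" "l dvd y - P" "q < P" "P \<le> 2 * q"
      "y \<le> p \<and> p \<le> y + h \<or> p + m \<le> y + h"
    using spoke_cases[of p q] pp' dvd G q r by (auto simp: p_def)
  have "y \<le> p' \<and> p' \<le> y + h \<or> p' + m \<le> y + h"
    using far_sides[of p' y P] y eq G q r by (auto simp: p'_def)
  then have "G \<le> y \<and> y \<le> G + q \<or> G + m \<le> y \<and> y \<le> G + m + q"
    using y(1,2,7) G(2,3) q r unfolding p_def p'_def by (elim disjE) auto
  moreover have "P = y - G" if "G \<le> y" "y \<le> G + q"
    using dvd_diff_unique[of l y P "y - G"] y G that q by simp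
  moreover have "P = y - (G + m)" if "G + m \<le> y" "y \<le> G + m + q"
  proof -
    have "l dvd y - (y - (G + m))" by (rule l_dvd_shift[OF G(1), of _ 1 2]) simp
    then show ?thesis using dvd_diff_unique[of l y P "y - (G + m)"] y that q by simp
  qed
  ultimately show False using y by auto
qed

section \<open>Three groups\<close>

lemma F_D:
  assumes "F z = D y" "z - 2 \<le> y" "y \<le> z + m - 3"
  shows "y = z - 2 \<or> y = z - 1 \<or> y = z \<or> z + h - 2 \<le> y \<and> y \<le> z + h + 1"
proof (rule ccontr)
  assume n: "\<not> ?thesis"
  consider "z < y" "y < z + h - 2" | "y > z + h + 1" using n assms by linarith
  then show False
  proof cases
    case 1
    then show ?thesis
      using chords[of z y "z + h - 2" "y + h"] assms q r by (simp add: D_def F_def)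
  next
    case 2
    then show ?thesis
      using chords[of y "z + m" "y + h" "z + m + h - 2"] assms q r periodic(3)[of z]
      by (simp add: D_def F_def)
  qed
qed

lemma F_E:
  assumes "F z = E x" "z - 1 \<le> x" "x \<le> z + m - 2"
  shows "x = z - 1 \<or> x = z \<or> z + h - 2 \<le> x \<and> x \<le> z + h + 2"
proof (rule ccontr)
  assume n: "\<not> ?thesis"
  consider "z < x" "x < z + h - 2" | "x > z + h + 2" using n assms by linarith
  then show False
  proof cases
    case 1
    then show ?thesis
      using chords[of z x "z + h - 2" "x + h - 1"] assms q r by (simp add: E_def F_def)
  next
    case 2
    then show ?thesis
      using chords[of x "z + m" "x + h - 1" "z + m + h - 2"] assms q r periodic(3)[of z]
      by (simp add: E_def F_def)
  qed
qed

lemma F_F: "F z \<noteq> F (z + 1)"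
  using chords[of z "z + 1" "z + h - 2" "z + h - 1"] q r by (simp add: F_def algebra_simps)

lemma F_R:
  assumes "u < x \<and> x < u + r \<or> x + q - 2 < u \<and> u < x + h - 2"
  shows "F x \<noteq> R u"
proof -
  consider "u < x" "x < u + r" | "x + q - 2 < u" "u < x + h - 2" using assms by blast
  then show ?thesis
  proof cases
    case 1
    then show ?thesis using chords[of u x "u + r" "x + h - 2"] q r by (simp add: F_def R_def eq_commute)
  next
    case 2
    then show ?thesis using chords[of x u "x + h - 2" "u + r"] q r by (simp add: F_def R_def)
  qed
qed

lemma spoke_F_near:
  assumes "l dvd G" "G \<le> x" "x \<le> G + q + 2" "x < z" "z < x + h - 2"
  shows "S z \<noteq> F x"
  using spokes[of G x z "x + h - 2"] assms by (simp add: F_def eq_commute)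

lemma spoke_F_far:
  assumes "l dvd G" "G + q + 3 \<le> x" "x \<le> G + 2 * q" "x + h - 2 < z" "z < x + m"
  shows "S z \<noteq> F x"
proof -
  have "l dvd G + r + l" using assms(1) l_dvd_r by simp
  moreover have "K (x + h - 2) (x + m) = F x" by (simp only: K_flip F_def)
  ultimately show ?thesis using spokes[of "G + r + l" "x + h - 2" z "x + m"] assms by (simp add: eq_commute)
qed

text \<open>By the pattern assumed for \<open>E\<close>, a colour containing \<open>D x\<close> and
  \<open>D (x + h)\<close> also contains \<open>E (x + 1)\<close> and \<open>E (x + h + 1)\<close>,
  which narrows the place of \<open>F z\<close> as in \<open>E_cases\<close>. For
  \<open>x = s + 1\<close> the second of these is the exception in the pattern, and
  \<open>D (x + h)\<close> has to serve instead. At \<open>z = s + h + 1\<close> these constraints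
  would still admit \<open>D z\<close>.\<close>

lemma F_cases:
  assumes E: "\<And>z. \<lbrakk>s < z; z \<le> s + m; z \<noteq> s + h + 2\<rbrakk> \<Longrightarrow> E z = D (z - 1)" and "3 \<le> q"
    and z: "s + 2 \<le> z" "z \<le> s + m + 1" "z \<noteq> s + h + 1"
  shows "F z = D (z - 1) \<or> F z = D (z - 2) \<or> F z = D s \<and> s + h \<le> z \<and> z \<le> s + h + 3"
proof (cases "F z = D s")
  case True
  have per: "D (s + m) = D s" "E (s + 1 + m) = E (s + 1)" by (rule periodic)+
  have E1: "E (s + 1) = D s" using E[of "s + 1"] q r by simp
  show ?thesis
  proof (cases "z = s + 2")
    case False
    then have "s + m = z - 2 \<or> s + m = z - 1 \<or> s + m = z \<or> z + h - 2 \<le> s + m \<and> s + m \<le> z + h + 1"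
      using F_D[of z "s + m"] True per z by simp
    moreover have "s + 1 + m = z - 1 \<or> s + 1 + m = z \<or> z + h - 2 \<le> s + 1 + m \<and> s + 1 + m \<le> z + h + 2"
      using F_E[of z "s + 1 + m"] True per E1 z False by simp
    ultimately have "z - 1 = s + m \<or> s + h \<le> z \<and> z \<le> s + h + 3"
      using z q r by linarith
    then show ?thesis using True per(1) by metis
  qed (use True in simp)
next
  case False
  have "F z \<in> C" by (rule in_C)
  then obtain x where x: "s < x" "x \<le> s + h" "D x = F z" "D (x + h) = F z"
    using colour_cases False by metis
  have near: "w = z - 1 \<or> w = z \<or> z + h - 2 \<le> w \<and> w \<le> z + h + 2 \<or> z + h - 2 \<le> w + m \<and> w + m \<le> z + h + 2"
    if "E w = F z" "s + 1 < w" "w \<le> s + m" for w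
    using F_E[of z w] F_E[of z "w + m"] periodic(2)[of w] that z by force
  have Ex: "E (x + 1) = F z" using E[of "x + 1"] x q r by simp
  have n1: "x + 1 = z - 1 \<or> x + 1 = z \<or> z + h - 2 \<le> x + 1 \<and> x + 1 \<le> z + h + 2 \<or>
      z + h - 2 \<le> x + 1 + m \<and> x + 1 + m \<le> z + h + 2"
    using near[OF Ex] x q r by simp
  show ?thesis
  proof (cases "x = s + 1")
    case True
    have "z = s + 2 \<or> z = s + 3 \<or> s + h + 1 \<le> z \<and> z \<le> s + h + 5"
      using n1 True z \<open>3 \<le> q\<close> r by linarith
    moreover have "\<not> (z = s + h + 4 \<or> z = s + h + 5)"
      using F_D[of z "x + h + m"] periodic(1)[of "x + h"] x True q r by auto
    ultimately have "x = z - 1 \<or> x = z - 2 \<or> x + h = z - 1 \<or> x + h = z - 2"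
      using z True by linarith
    then show ?thesis using x by metis
  next
    case False
    then have Exh: "E (x + h + 1) = F z" using E[of "x + h + 1"] x q r by simp
    have "x + h + 1 = z - 1 \<or> x + h + 1 = z \<or> z + h - 2 \<le> x + h + 1 \<and> x + h + 1 \<le> z + h + 2 \<or>
      z + h - 2 \<le> x + h + 1 + m \<and> x + h + 1 + m \<le> z + h + 2"
      using near[OF Exh] x q r by simp
    then have "x = z - 1 \<or> x = z - 2 \<or> x + h = z - 1 \<or> x + h = z - 2"
      using n1 \<open>3 \<le> q\<close> r by linarith
    then show ?thesis using x by metis
  qed
qed

lemma F_up:
  assumes E: "\<And>z. \<lbrakk>s < z; z \<le> s + m; z \<noteq> s + h + 2\<rbrakk> \<Longrightarrow> E z = D (z - 1)" and "3 \<le> q"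
    and z0: "F z0 = D (z0 - 1)" "s + h + 3 \<le> z0" "z0 \<le> z" "z \<le> s + m + 1"
  shows "F z = D (z - 1)"
proof -
  have "z0 + int n \<le> s + m + 1 \<Longrightarrow> F (z0 + int n) = D (z0 + int n - 1)" for n
  proof (induction n)
    case (Suc n)
    then have "F (z0 + int n) = D (z0 + int n - 1)" by simp
    then show ?case
      using F_cases[OF E \<open>3 \<le> q\<close>, of "z0 + int (Suc n)"] F_F[of "z0 + int n"] Suc.prems z0 q r
      by (auto simp: algebra_simps)
  qed (use z0 in simp)
  from this[of "nat (z - z0)"] show ?thesis using z0 by simp
qed

lemma F_down:
  assumes E: "\<And>z. \<lbrakk>s < z; z \<le> s + m; z \<noteq> s + h + 2\<rbrakk> \<Longrightarrow> E z = D (z - 1)" and "3 \<le> q"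
    and z0: "F z0 = D (z0 - 2)" "z0 \<le> s + h" "s + 2 \<le> z" "z \<le> z0"
  shows "F z = D (z - 2)"
proof -
  have "z \<le> z0 - int n \<Longrightarrow> F (z0 - int n) = D (z0 - int n - 2)" for n
  proof (induction n)
    case (Suc n)
    then have "F (z0 - int n) = D (z0 - int n - 2)" by simp
    then show ?case
      using F_cases[OF E \<open>3 \<le> q\<close>, of "z0 - int (Suc n)"] F_F[of "z0 - int (Suc n)"] Suc.prems z0 q r
      by (auto simp: algebra_simps)
  qed (use z0 in simp)
  from this[of "nat (z0 - z)"] show ?thesis using z0 by simp
qed

lemma F_ends: "\<not> (F (s + m + 1) = D (s + m) \<and> F (s + 2) = D s)"
proof
  assume f: "F (s + m + 1) = D (s + m) \<and> F (s + 2) = D s"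
  have "F (s + 1 + m) = F (s + 1)" "D (s + m) = D s" by (rule periodic)+
  then have "F (s + 1) = F (s + 1 + 1)" using f by (simp add: algebra_simps)
  then show False using F_F by blast
qed

text \<open>With \<open>s\<close> at the start of a group the alternatives for the chords
  \<open>E\<close> do not clash but leave essentially one pattern, \<open>E z = D (z - 1)\<close>.
  Under this pattern the chords \<open>F\<close> repeat the argument, with \<open>y4\<close> and
  \<open>y5\<close> in the roles of \<open>a\<close> and \<open>b\<close>. The bound on
  \<open>q\<close> keeps the positions \<open>q - 2\<close> and \<open>q + 2\<close> away from the
  ends of a group.\<close>

lemma impossible_corner:
  assumes r_eq: "r = l" and s: "l dvd s" and q3: "3 \<le> q"
  shows False
proof -
  \<comment> \<open>These five spokes were found as an unsatisfiable core with a SAT solver.\<close>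
  define p where "p = s + q"
  define y1 where "y1 = s + 2 * l + q + 1"
  define y3 where "y3 = s + l + q - 1"
  define y4 where "y4 = s + l + q + 2"
  define y5 where "y5 = s + 2 * l + q - 2"
  note ys = p_def y1_def y3_def y4_def y5_def
  have dvd: "l dvd p - q" "l dvd y1 - (q + 1)" "l dvd y3 - (q - 1)" "l dvd y4 - (q + 2)" "l dvd y5 - (q - 2)"
    using s l_dvd_shift[OF s, of "y1 - (q + 1)" 2 0] l_dvd_shift[OF s, of "y3 - (q - 1)" 1 0]
      l_dvd_shift[OF s, of "y4 - (q + 2)" 1 0] l_dvd_shift[OF s, of "y5 - (q - 2)" 2 0]
    by (simp_all add: ys)
  have sl: "l dvd s + l" "l dvd s + 2 * l"
    using l_dvd_shift[OF s, of "s + l" 1 0] l_dvd_shift[OF s, of "s + 2 * l" 2 0] by simp_all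
  have pD: "S p \<noteq> D s" using spoke_near[of s s p] s q q3 r_eq by (simp add: p_def)
  have p_full: "\<not> full (S p)" using q_spoke_not_full[of p] dvd(1) pD q3 r_eq by (simp add: p_def)
  have full: "full c" if "c \<in> C" "c \<noteq> S p" for c
    using not_full_unique[of c "S p"] p_full S_in that by blast
  \<comment> \<open>Among the chords that start in the second half of a group, only those of the
    last group have an arc that reaches round to \<open>p\<close>.\<close>
  obtain v where v: "s + 2 * l + q < v" "v < s + m" "D v = S p" "l dvd v - (v - s - 2 * l)"
  proof -
    have "\<not> (q = q \<and> s + h < p)" using q3 r_eq by (simp add: p_def)
    then obtain v P where v: "s < v" "v < s + m" "D v = S p" "l dvd v - P" "q < P" "P \<le> 2 * q"
      "v \<le> p \<and> p \<le> v + h \<or> p + m \<le> v + h"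
      using spoke_cases[of p q] dvd(1) pD q3 r_eq by (auto simp: p_def)
    have 1: "\<not> v \<le> p" using dvd_diff_unique[of l v P "v - s"] v s q3 by (auto simp: p_def)
    then have "s + 2 * l \<le> v" using v q3 r_eq by (auto simp: p_def)
    moreover have d: "l dvd v - (v - s - 2 * l)" using sl(2) by simp
    ultimately have "P = v - s - 2 * l"
      using dvd_diff_unique[of l v P "v - s - 2 * l"] v q3 r_eq by auto
    then show ?thesis using that[of v] v d by simp
  qed
  have v_sides: "v \<le> z \<and> z \<le> v + h \<or> z + m \<le> v + h" if "S z = S p" "s \<le> z" "z < s + m" for z
    using far_sides[of z v "v - s - 2 * l"] that v q3 r_eq by simp
  obtain u0 where u0: "s + h \<le> u0" "u0 \<le> s + h + q + 1" "R u0 = D s"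
    using full_R(2)[of "D s" s] full in_C(1) pD q3 r_eq by auto
  have E_far1: "E (y1 + 1) \<noteq> D y1" if "D y1 = S y1"
  proof -
    have "S (y1 + m) \<noteq> E (y1 + 1)"
      by (rule spoke_E_far[OF sl(2)]) (use q3 r_eq in \<open>simp_all add: y1_def\<close>)
    then show ?thesis using that S_periodic[of y1] by simp
  qed
  have y1: "D y1 = S y1 \<and> E (y1 + 1) \<noteq> D y1 \<or> S y1 = D s \<or>
      D (s + h + 1) = S y1 \<and> R (s + h + 1) = S y1 \<and> E (s + h + 1) \<noteq> S y1 \<and> E (s + h + 2) \<noteq> S y1"
  proof (cases "S y1 = S p")
    case True
    then have "v = y1" using v_sides[of y1] v q3 r_eq by (auto simp: y1_def)
    then show ?thesis using True v E_far1 by simp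
  next
    case False
    have eq: "y1 - r = s + h + 1" "s + h + 1 + 1 = s + h + 2" using r_eq by (simp_all add: y1_def)
    have "s < y1" "y1 < s + m" "s < y1 - r" using q3 r_eq by (simp_all add: y1_def)
    then show ?thesis
      using full_spoke_after[of y1] dvd(2) full[OF S_in False] unfolding eq by blast
  qed
  have y3: "D (s + 2 * h) = S y3 \<and> E (s + 2 * h) \<noteq> S y3 \<or>
      D (s + 2 * q) = S y3 \<and> E (s + 2 * q) \<noteq> S y3 \<and> E (s + 2 * q + 1) \<noteq> S y3"
  proof (cases "S y3 = S p")
    case True
    then have vh: "v = s + 2 * h" using v_sides[of y3] v q3 r_eq by (auto simp: y3_def)
    have "S (y3 + m) \<noteq> E v"
      by (rule spoke_E_far[OF sl(2)]) (use vh q3 r_eq in \<open>simp_all add: y3_def\<close>)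
    then show ?thesis using True v(3) vh S_periodic[of y3] by simp
  next
    case False
    have "S y3 \<noteq> D s" using spoke_near[of s s y3] s q3 r_eq by (simp add: y3_def)
    then have "(\<exists>y. (y = y3 - h \<or> y = y3 - h + m) \<and> s < y \<and> y < s + m \<and> D y = S y3 \<and> E y \<noteq> S y3) \<or>
      D (y3 - q) = S y3 \<and> E (y3 - q) \<noteq> S y3 \<and> E (y3 - q + 1) \<noteq> S y3"
      using dvd(3) full[OF S_in False] q3 r_eq by (intro full_spoke_before) (simp_all add: y3_def)
    moreover have "y3 - h + m = s + 2 * h" "y3 - h < s" "y3 - q = s + 2 * q"
      using r_eq by (simp_all add: y3_def)
    ultimately show ?thesis by auto
  qed
  \<comment> \<open>An upward run behind the hole is blocked at \<open>s + 2 * h\<close>, or, in the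
    other alternative for \<open>y3\<close>, it meets a downward run at \<open>D s\<close>.\<close>
  have no_up: False if "E y = D y" "s + h + 2 \<le> y" "y \<le> s + 2 * h" for y
    using y3
  proof (elim disjE conjE)
    assume "D (s + 2 * h) = S y3" "E (s + 2 * h) \<noteq> S y3"
    then show False using E_up[OF that(1,2), of "s + 2 * h"] that by simp
  next
    assume a: "D (s + 2 * q) = S y3" "E (s + 2 * q) \<noteq> S y3"
    then have "E (s + 2 * q) = D (s + 2 * q - 1)" using E_cases[of "s + 2 * q"] q3 r_eq by auto
    then have "E (s + 1) = D s" using E_down[of "s + 2 * q" "s + 1"] q3 r_eq by simp
    moreover have "E (s + m) = D (s + m)" using E_up[OF that(1,2), of "s + m"] that q3 r_eq by simp
    ultimately show False using E_ends by blast
  qed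
  have last: "E (s + m) = D (s + m - 1)" if "E (s + 1) = D s"
    using E_cases[of "s + m"] E_ends that q3 r_eq by auto
  have not_y1: "\<not> (D y1 = S y1 \<and> E (y1 + 1) \<noteq> D y1)"
  proof
    assume a: "D y1 = S y1 \<and> E (y1 + 1) \<noteq> D y1"
    then have "E (y1 + 1) = D (y1 + 1)" using E_cases[of "y1 + 1"] q3 r_eq by (auto simp: y1_def)
    then show False using no_up[of "y1 + 1"] q3 r_eq by (simp add: y1_def)
  qed
  \<comment> \<open>Only \<open>E (s + h + 2)\<close> stays open. Both of its variants are recorded
    with a chord \<open>R\<close>, namely \<open>R (s + h + 1)\<close> or \<open>R u0\<close>,
    because this chord is what later constrains \<open>F (s + h + 3)\<close>.\<close>
  have shifted: "(\<forall>z. s < z \<longrightarrow> z \<le> s + m \<longrightarrow> z \<noteq> s + h + 2 \<longrightarrow> E z = D (z - 1)) \<and>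
     (E (s + h + 2) = D s \<and> R (s + h + 1) = D (s + h + 1) \<or> E (s + h + 2) = D (s + h + 1) \<and> u0 \<le> s + h + 1)"
  proof (cases "S y1 = D s")
    case False
    then have b: "R (s + h + 1) = D (s + h + 1)" "E (s + h + 1) \<noteq> D (s + h + 1)" "E (s + h + 2) \<noteq> D (s + h + 1)"
      using y1 not_y1 by auto
    have 2: "E (s + h + 2) = D s"
      using E_cases[of "s + h + 2"] no_up[of "s + h + 2"] b q3 r_eq by auto
    have 1: "E (s + h + 1) = D (s + h)"
      using E_cases[of "s + h + 1"] E_E(1)[of "s + h + 1"] 2 b q r by (auto simp: add.assoc)
    have 0: "E (s + h) = D (s + h - 1)"
      using E_cases[of "s + h"] E_E(1)[of "s + h"] E_E(2)[of "s + h"] 1 2 q3 r_eq by auto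
    have low: "E z = D (z - 1)" if "s < z" "z \<le> s + h" for z
      using E_down[OF 0] that q3 r_eq by simp
    have "E (s + m) = D (s + m - 1)" using last low[of "s + 1"] q3 r_eq by simp
    then have high: "E z = D (z - 1)" if "s + h + 2 < z" "z \<le> s + m" for z
      using E_down[of "s + m" z] that q3 r_eq by simp
    have "E z = D (z - 1)" if z: "s < z" "z \<le> s + m" "z \<noteq> s + h + 2" for z
    proof -
      consider "z \<le> s + h" | "z = s + h + 1" | "s + h + 2 < z" using z by linarith
      then show ?thesis using low high z 1 by cases auto
    qed
    then show ?thesis using b 2 by blast
  next
    case True
    have "y1 \<le> u0 \<or> u0 + r \<le> y1" using spoke_R[of u0 y1] u0 True by force
    then have u0': "u0 \<le> s + h + 1" using u0 q3 r_eq by (auto simp: y1_def)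
    have hole: "E z \<noteq> D s" if "s + h \<le> z" "z \<le> s + h + 2" for z
    proof (cases "z = s + h + 2")
      case True
      then show ?thesis using E_R[of u0 z] u0 u0' q3 r_eq by simp
    next
      case False
      have "S y1 \<noteq> E z"
        by (rule spoke_E_near[OF sl(1)]) (use that False q3 r_eq in \<open>simp_all add: y1_def\<close>)
      then show ?thesis using True by simp
    qed
    have all: "E z = D (z - 1)" if z: "s < z" "z \<le> s + m" for z
    proof -
      have "E (s + m) = D (s + m - 1)"
        using y3
      proof (elim disjE conjE)
        assume "D (s + 2 * h) = S y3" "E (s + 2 * h) \<noteq> S y3"
        then have "E (s + 2 * h) = D (s + 2 * h - 1)" using E_cases[of "s + 2 * h"] q3 r_eq by auto
        then have "E (s + 1) = D s" using E_down[of "s + 2 * h" "s + 1"] hole q3 r_eq by simp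
        then show ?thesis by (rule last)
      next
        assume "D (s + 2 * q) = S y3" "E (s + 2 * q) \<noteq> S y3"
        then have "E (s + 2 * q) = D (s + 2 * q - 1)" using E_cases[of "s + 2 * q"] q3 r_eq by auto
        then have "E (s + 1) = D s" using E_down[of "s + 2 * q" "s + 1"] hole q3 r_eq by simp
        then show ?thesis by (rule last)
      qed
      then show ?thesis using E_down[of "s + m" z] hole z by simp
    qed
    then show ?thesis using all[of "s + h + 2"] u0' q3 r_eq by auto
  qed
  then have E: "\<And>z. \<lbrakk>s < z; z \<le> s + m; z \<noteq> s + h + 2\<rbrakk> \<Longrightarrow> E z = D (z - 1)" by blast
  have E': "E z = D y" if "y = z - 1" "s < z" "z \<le> s + m" "z \<noteq> s + h + 2" for y z
    using E that by simp
  have F_3: "F (s + h + 3) = D (s + h + 2)" if "F (s + h + 3) \<noteq> D (s + h + 1)" "F (s + h + 3) \<noteq> D s"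
  proof -
    have "s + h + 3 - 1 = s + h + 2" "s + h + 3 - 2 = s + h + 1" by simp_all
    moreover have "s + 2 \<le> s + h + 3" "s + h + 3 \<le> s + m + 1" "s + h + 3 \<noteq> s + h + 1"
      using q r by simp_all
    ultimately show ?thesis using F_cases[OF E q3, of "s + h + 3"] that by metis
  qed
  have F_out: "S y4 \<noteq> F (s + h + 3)"
  proof -
    have "S (y4 + m) \<noteq> F (s + h + 3)"
      by (rule spoke_F_far[OF sl(1)]) (use q3 r_eq in \<open>simp_all add: y4_def\<close>)
    then show ?thesis unfolding S_periodic .
  qed
  \<comment> \<open>Position \<open>q + 2\<close> forces \<open>i\<close> to be 0 or 1. Either an
    upward run of chords \<open>F\<close> starts behind the hole, or the colour
    \<open>D (s + q + 1)\<close> is denied to both chords \<open>F\<close> that could take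
    it.\<close>
  have y4: "F (s + h + 3) = D (s + h + 2) \<or>
      F (s + q + 2) \<noteq> D (s + q + 1) \<and> F (s + q + 3) \<noteq> D (s + q + 1)"
  proof (cases "S y4 = D s")
    case True
    have "\<not> u0 \<le> s + h + 1"
      using spoke_R[of u0 y4] u0 True q3 r_eq by (force simp: y4_def)
    then have "E (s + h + 2) = D s" "R (s + h + 1) = D (s + h + 1)" using shifted by auto
    moreover have "F (s + h + 3) \<noteq> R (s + h + 1)" by (rule F_R) (use q3 r_eq in simp)
    ultimately show ?thesis using F_3 F_out True by metis
  next
    case False
    have "S y4 \<noteq> S p" using v_sides[of y4] v q3 r_eq by (auto simp: y4_def)
    then have "full (S y4)" using full S_in by blast
    show ?thesis
    proof (rule full_spoke[of y4 "q + 2"])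
      fix y P i u
      assume y: "s < y" "y < s + m" "D y = S y4" "l dvd y - P" "q < P" "P \<le> 2 * q" "0 \<le> i" "i \<le> q"
        "q + 2 = P + i \<or> q + 2 + l = P + i" "R u = D y"
        and pos: "(y4 = y + i \<or> y4 + m = y + i) \<and> y + i \<le> u \<and> u \<le> y + q \<or>
         (y4 = y + r + i \<or> y4 + m = y + r + i) \<and> y \<le> u \<and> u \<le> y + i"
      have i: "i = 0 \<or> i = 1" using y by auto
      have "y4 + m \<noteq> y + i" "y4 + m \<noteq> y + r + i" using y(2) i q3 r_eq by (auto simp: y4_def)
      then have sides: "y4 = y + i \<and> y + i \<le> u \<and> u \<le> y + q \<or> y4 = y + r + i \<and> y \<le> u \<and> u \<le> y + i"
        using pos by blast
      have "i = 0 \<and> y = s + h + 2 \<or> i = 1 \<and> y = s + h + 1 \<and> s + h + 2 \<le> u \<and> u \<le> s + h + q + 1 \<or>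
        i = 0 \<and> y = s + q + 2 \<and> u = s + q + 2 \<or>
        i = 1 \<and> y = s + q + 1 \<and> (u = s + q + 1 \<or> u = s + q + 2)"
        using sides
      proof (elim disjE conjE)
        assume "y4 = y + i" "y + i \<le> u" "u \<le> y + q"
        then show ?thesis using i r_eq unfolding y4_def by (elim disjE) auto
      next
        assume "y4 = y + r + i" "y \<le> u" "u \<le> y + i"
        then show ?thesis using i r_eq unfolding y4_def by (elim disjE) auto
      qed
      then consider "i = 0" "y = s + h + 2" | "i = 1" "y = s + h + 1" "s + h + 2 \<le> u" "u \<le> s + h + q + 1"
        | "i = 0" "y = s + q + 2" "u = s + q + 2"
        | "i = 1" "y = s + q + 1" "u = s + q + 1 \<or> u = s + q + 2"
        by blast
      then show ?thesis
      proof cases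
        case 1
        have "E (s + h + 3) = D (s + h + 2)" by (rule E') (use q r in simp_all)
        moreover have "S (y4 + m) \<noteq> E (s + h + 3)"
          by (rule spoke_E_far[OF sl(1)]) (use q3 r_eq in \<open>simp_all add: y4_def\<close>)
        ultimately show ?thesis using y(3) 1 unfolding S_periodic by simp
      next
        case 2
        have "\<not> R (s + h + 1) = D (s + h + 1)"
          using spoke_R[of "s + h + 1" y4] y(3) 2 q3 r_eq by (force simp: y4_def)
        then have u0': "u0 \<le> s + h + 1" using shifted by blast
        have "F (s + h + 3) \<noteq> R u0" by (rule F_R) (use u0 u0' q3 r_eq in simp)
        then show ?thesis using F_3 F_out y(3) u0(3) 2 by simp
      next
        case 3
        have "E (s + q + 3) = D (s + q + 2)" by (rule E') (use q3 r_eq in simp_all)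
        moreover have "E (s + q + 3) \<noteq> R u" by (rule E_R) (use 3 q3 r_eq in simp)
        ultimately show ?thesis using y(10) 3 by simp
      next
        case 4
        have "E (s + q + 2) = D (s + q + 1)" by (rule E') (use q3 r_eq in simp_all)
        moreover have "E (s + q + 2) \<noteq> R (s + q + 1)" by (rule E_R) (use q3 r_eq in simp)
        ultimately have u: "R (s + q + 2) = D (s + q + 1)" using 4 y(10) by auto
        have "S y4 \<noteq> F (s + q + 2)"
          by (rule spoke_F_near[OF s]) (use q3 r_eq in \<open>simp_all add: y4_def\<close>)
        moreover have "F (s + q + 3) \<noteq> R (s + q + 2)" by (rule F_R) (use q3 r_eq in simp)
        ultimately show ?thesis using u 4 y(3) by metis
      qed
    qed (use False \<open>full (S y4)\<close> dvd(4) q3 r_eq in \<open>simp_all add: y4_def\<close>)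
  qed
  \<comment> \<open>Position \<open>q - 2\<close> forces \<open>i\<close> to be \<open>q - 1\<close>
    or \<open>q\<close>. Either a downward run starts at \<open>F (s + 2 * q)\<close>, or the colour
    \<open>D (s + 4 * q)\<close> is denied to both chords \<open>F\<close> that could take
    it.\<close>
  have y5: "F (s + 2 * q) \<noteq> D (s + 2 * q - 1) \<or>
      F (s + 4 * q + 1) \<noteq> D (s + 4 * q) \<and> F (s + 4 * q + 2) \<noteq> D (s + 4 * q)"
  proof -
    have "S y5 \<noteq> D s" using spoke_R[of u0 y5] u0 q3 r_eq by (force simp: y5_def)
    have "S y5 \<noteq> S p" using v_sides[of y5] v q3 r_eq by (auto simp: y5_def)
    then have "full (S y5)" using full S_in by blast
    show ?thesis
    proof (rule full_spoke[of y5 "q - 2"])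
      fix y P i u
      assume y: "s < y" "y < s + m" "D y = S y5" "l dvd y - P" "q < P" "P \<le> 2 * q" "0 \<le> i" "i \<le> q"
        "q - 2 = P + i \<or> q - 2 + l = P + i" "R u = D y"
        and pos: "(y5 = y + i \<or> y5 + m = y + i) \<and> y + i \<le> u \<and> u \<le> y + q \<or>
         (y5 = y + r + i \<or> y5 + m = y + r + i) \<and> y \<le> u \<and> u \<le> y + i"
      have i: "i = q - 1 \<or> i = q" using y by auto
      have "y5 + m \<noteq> y + i" "y5 + m \<noteq> y + r + i" using y(2) i q3 r_eq by (auto simp: y5_def)
      then have sides: "y5 = y + i \<and> y + i \<le> u \<and> u \<le> y + q \<or> y5 = y + r + i \<and> y \<le> u \<and> u \<le> y + i"
        using pos by blast
      have "y = s + 4 * q + 1 \<or> y = s + 2 * q \<or> y = s + 4 * q \<and> u = s + 5 * q \<or> y = s + 2 * q - 1"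
        using sides
      proof (elim disjE conjE)
        assume "y5 = y + i" "y + i \<le> u" "u \<le> y + q"
        then show ?thesis using i r_eq unfolding y5_def by (elim disjE) simp_all
      next
        assume "y5 = y + r + i" "y \<le> u" "u \<le> y + i"
        then show ?thesis using i r_eq unfolding y5_def by (elim disjE) simp_all
      qed
      then consider "y = s + 4 * q + 1" | "y = s + 2 * q"
        | "y = s + 4 * q" "u = s + 5 * q" | "y = s + 2 * q - 1"
        by blast
      then show ?thesis
      proof cases
        case 1
        have "E (y + 1) = D y" by (rule E') (use 1 q3 r_eq in simp_all)
        moreover have "S y5 \<noteq> E (y + 1)"
          by (rule spoke_E_near[OF sl(2)]) (use 1 q3 r_eq in \<open>simp_all add: y5_def\<close>)
        ultimately show ?thesis using y(3) by simp
      next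
        case 2
        have "E (y + 1) = D y" by (rule E') (use 2 q3 r_eq in simp_all)
        moreover have "S y5 \<noteq> E (y + 1)"
          by (rule spoke_E_near[OF sl(1)]) (use 2 q3 r_eq in \<open>simp_all add: y5_def\<close>)
        ultimately show ?thesis using y(3) by simp
      next
        case 3
        have "F (s + 4 * q + 1) \<noteq> R u" by (rule F_R) (use 3 q3 r_eq in simp)
        moreover have "S y5 \<noteq> F (s + 4 * q + 2)"
          by (rule spoke_F_near[OF sl(2)]) (use q3 r_eq in \<open>simp_all add: y5_def\<close>)
        ultimately show ?thesis using 3 y(3,10) by simp
      next
        case 4
        have "S y5 \<noteq> F (s + 2 * q)"
          by (rule spoke_F_far[OF s]) (use q3 r_eq in \<open>simp_all add: y5_def\<close>)
        then show ?thesis using 4 y(3) by simp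
      qed
    qed (use \<open>S y5 \<noteq> D s\<close> \<open>full (S y5)\<close> dvd(5) q3 r_eq in \<open>simp_all add: y5_def\<close>)
  qed
  have F_low: "F z = D w" if "w = z - 2" "F z \<noteq> D y" "y = z - 1" "s + 2 \<le> z" "z \<le> s + 2 * q" for w y z
    using F_cases[OF E q3, of z] that q3 r_eq by auto
  have F_high: "F z = D w" if "w = z - 1" "F z \<noteq> D y" "y = z - 2" "s + h + 3 < z" "z \<le> s + m" for w y z
    using F_cases[OF E q3, of z] that q3 r_eq by auto
  have down: "F z = D w" if "w = z - 2" "F x = D v" "v = x - 2" "x \<le> s + 2 * q" "s + 2 \<le> z" "z \<le> x" for v w x z
    using F_down[OF E q3, of x z] that q3 r_eq by simp
  have up: "F z = D w" if "w = z - 1" "F x = D v" "v = x - 1" "s + h + 3 \<le> x" "x \<le> z" "z \<le> s + m + 1" for v w x z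
    using F_up[OF E q3, of x z] that by simp
  \<comment> \<open>As for \<open>E\<close>: two runs reach \<open>D s\<close> from both sides, or
    one run gives a chord \<open>F\<close> the colour that it was denied.\<close>
  show False
    using y4 y5
  proof (elim disjE conjE)
    assume a: "F (s + h + 3) = D (s + h + 2)" and b: "F (s + 2 * q) \<noteq> D (s + 2 * q - 1)"
    have "F (s + 2 * q) = D (s + 2 * q - 2)" by (rule F_low[OF _ b]) (use q3 in simp_all)
    then have "F (s + 2) = D s" by (rule down[rotated]) (use q3 in simp_all)
    moreover have "F (s + m + 1) = D (s + m)" by (rule up[OF _ a]) (use q r in simp_all)
    ultimately show False using F_ends by blast
  next
    assume a: "F (s + h + 3) = D (s + h + 2)" and b: "F (s + 4 * q + 1) \<noteq> D (s + 4 * q)"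
    have "F (s + 4 * q + 1) = D (s + 4 * q)" by (rule up[OF _ a]) (use q3 r_eq in simp_all)
    then show False using b by blast
  next
    assume a: "F (s + q + 3) \<noteq> D (s + q + 1)" and b: "F (s + 2 * q) \<noteq> D (s + 2 * q - 1)"
    have "F (s + 2 * q) = D (s + 2 * q - 2)" by (rule F_low[OF _ b]) (use q3 in simp_all)
    then have "F (s + q + 3) = D (s + q + 1)" by (rule down[rotated]) (use q3 in simp_all)
    then show False using a by blast
  next
    assume a: "F (s + q + 2) \<noteq> D (s + q + 1)" and b: "F (s + 4 * q + 2) \<noteq> D (s + 4 * q)"
    have "F (s + q + 2) = D (s + q)" by (rule F_low[OF _ a]) (use q3 in simp_all)
    then have "F (s + 2) = D s" by (rule down[rotated]) (use q3 in simp_all)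
    moreover have "F (s + 4 * q + 2) = D (s + 4 * q + 1)" by (rule F_high[OF _ b]) (use q3 r_eq in simp_all)
    then have "F (s + m + 1) = D (s + m)" by (rule up[rotated]) (use q3 r_eq in simp_all)
    ultimately show False using F_ends by blast
  qed
qed

end

context wheel_colouring
begin

text \<open>The reversal is \<open>-1 - x\<close> rather than \<open>- x\<close> because it must
  carry groups to groups, which occupy the positions from a multiple of \<open>l\<close> up to just
  before the next.\<close>

lemma reflected: "wheel_colouring q r C (\<lambda>x y. K (-1 - y) (-1 - x)) (\<lambda>x. S (-1 - x))"
proof
  fix x y z u G :: int
  have "K (-1 - (x + m)) (-1 - y) = K (-1 - y - m) (-1 - x - m)"
    using K_flip[of "-1 - (x + m)" "-1 - y - m"] by (simp add: algebra_simps)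
  also have "\<dots> = K (-1 - y) (-1 - x)"
    by (rule K_periodic'[symmetric]) simp_all
  finally show "K (-1 - (x + m)) (-1 - y) = K (-1 - y) (-1 - x)" .
  show "S (-1 - (x + m)) = S (-1 - x)"
    using S_periodic[of "-1 - (x + m)"] by (simp add: algebra_simps)
  show "K (-1 - y) (-1 - x) \<in> C" if "x < y" "y < x + m"
    using that by (intro K_in) auto
  show "K (-1 - y) (-1 - x) \<noteq> K (-1 - u) (-1 - z)" if "x < z" "z < y" "y < u" "u < x + m"
    using chords[of "-1 - u" "-1 - y" "-1 - z" "-1 - x"] that by auto
  show "K (-1 - y) (-1 - x) \<noteq> S (-1 - z)" if "l dvd G" "G \<le> x" "x < z" "z < y" "y < G + r + l"
  proof -
    have "- G - r - l = - (G + r + l)" by simp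
    moreover have "l dvd - (G + r + l)" using that(1) l_dvd_r by (simp only: dvd_minus_iff dvd_add dvd_refl)
    ultimately have "l dvd - G - r - l" by (simp only:)
    then show ?thesis using spokes[of "- G - r - l" "-1 - y" "-1 - z" "-1 - x"] that by simp
  qed
qed (use q r l_dvd_r finite_C card_C S_in in auto)

lemma reflected_at:
  assumes "wheel_colouring_at q r C K S s"
  shows "wheel_colouring_at q r C (\<lambda>x y. K (-1 - y) (-1 - x)) (\<lambda>x. S (-1 - x)) (-1 - s - h)"
proof -
  interpret A: wheel_colouring_at q r C K S s by fact
  interpret B: wheel_colouring q r C "\<lambda>x y. K (-1 - y) (-1 - x)" "\<lambda>x. S (-1 - x)"
    by (rule reflected)
  have D: "B.D x = D (-1 - x - h)" for x
    unfolding B.D_def D_def by (rule arg_cong2[of _ _ _ _ K]) simp_all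
  have D': "B.D x = D (-1 - x - h + m)" for x
    unfolding D periodic(1) ..
  have Ds: "B.D (-1 - s - h) = D s" unfolding D by simp
  show ?thesis
  proof
    show "B.D x \<noteq> B.D (-1 - s - h)" if "-1 - s - h < x" "x < -1 - s - h + m" for x
      unfolding Ds unfolding D' by (rule A.single) (use that in auto)
    show "\<exists>x\<ge>-1 - s - h. x < -1 - s - h + m \<and> B.D x = c" if c: "c \<in> C" for c
    proof -
      obtain y where y: "s \<le> y" "y < s + m" "D y = c" using A.D_covers[OF c] by blast
      show ?thesis
      proof (cases "y = s")
        case True
        then show ?thesis using y Ds q r by (intro exI[of _ "-1 - s - h"]) simp
      next
        case False
        have "-1 - (-1 - y - h + m) - h + m = y" by simp
        then have "B.D (-1 - y - h + m) = c" unfolding D' using y by (simp only:)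
        then show ?thesis using y False by (intro exI[of _ "-1 - y - h + m"]) simp
      qed
    qed
    show "\<exists>y>-1 - s - h. y < -1 - s - h + m \<and> y \<noteq> x \<and> B.D y = B.D x"
      if x: "-1 - s - h < x" "x < -1 - s - h + m" for x
    proof -
      obtain y where y: "s < y" "y < s + m" "y \<noteq> -1 - x - h + m" "D y = D (-1 - x - h + m)"
        using A.D_partner[of "-1 - x - h + m"] x by auto
      have "-1 - (-1 - y - h + m) - h + m = y" by simp
      then have "B.D (-1 - y - h + m) = B.D x" unfolding D' using y by (simp only:)
      then show ?thesis using y by (intro exI[of _ "-1 - y - h + m"]) auto
    qed
  qed
qed

theorem impossible:
  assumes "2 * l \<le> r \<or> r = l \<and> 3 \<le> q"
  shows False
proof -
  obtain s where "wheel_colouring_at q r C K S s"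
  proof (rule single_exists)
    fix s
    assume "\<And>x. \<lbrakk>s < x; x < s + m\<rbrakk> \<Longrightarrow> D x \<noteq> D s"
      "\<And>c. c \<in> C \<Longrightarrow> \<exists>x\<ge>s. x < s + m \<and> D x = c"
      "\<And>x. \<lbrakk>s < x; x < s + m\<rbrakk> \<Longrightarrow> \<exists>y>s. y < s + m \<and> y \<noteq> x \<and> D y = D x"
    then have "wheel_colouring_at q r C K S s" by unfold_locales
    then show ?thesis by (rule that)
  qed
  then interpret A: wheel_colouring_at q r C K S s .
  obtain G P where G: "s = G + P" "l dvd G" "0 \<le> P" "P \<le> 2 * q" using split_l[of s] .
  consider "2 * l \<le> r \<or> G + q < s" | "r = l" "3 \<le> q" "P = 0" | "0 < P" "P < q"
    | "r = l" "3 \<le> q" "P = q"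
    using assms G by linarith
  then show False
  proof cases
    case 1
    then show False using A.impossible_generic[of G] G by simp
  next
    case 2
    then show False using A.impossible_corner G by simp
  next
    case 3
    then show False using A.impossible_between[of G] G by simp
  next
    case 4
    \<comment> \<open>For \<open>P = q\<close> the chord \<open>D s\<close> runs from the middle of
      a group to the last point of the next, so its reflection starts at the start of a
      group.\<close>
    interpret B: wheel_colouring_at q r C "\<lambda>x y. K (-1 - y) (-1 - x)" "\<lambda>x. S (-1 - x)" "-1 - s - h"
      by (rule reflected_at) (rule A.wheel_colouring_at_axioms)
    have "-1 - s - h = - G - 2 * l" using 4 G by simp
    moreover have "l dvd - G - 2 * l" using G by (intro dvd_diff dvd_triv_right) simp
    ultimately have "l dvd -1 - s - h" by (simp only:)
    then show False using B.impossible_corner 4 by blast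
  qed
qed

end

section \<open>From a plane partition to a colouring of cyclically indexed chords and spokes\<close>

lemma plane_partition_colouring:
  assumes "plane_partitionable G n"
  obtains C :: "geom_graph set" and col where "finite C" "card C = n" "\<And>e. e \<in> edges G \<Longrightarrow> col e \<in> C"
    "\<And>e f. \<lbrakk>e \<in> edges G; f \<in> edges G; e \<noteq> f; crossing e f\<rbrakk> \<Longrightarrow> col e \<noteq> col f"
proof -
  obtain \<H> where H: "finite \<H>" "card \<H> = n" "graph_partition \<H> G" "\<And>H. H \<in> \<H> \<Longrightarrow> plane H"
    using assms unfolding plane_partitionable_def by blast
  then have ex: "\<exists>H. H \<in> \<H> \<and> e \<in> edges H" if "e \<in> edges G" for e
    using that unfolding graph_partition_def by blast
  define col where "col e = (SOME H. H \<in> \<H> \<and> e \<in> edges H)" for e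
  have col: "col e \<in> \<H>" "e \<in> edges (col e)" if "e \<in> edges G" for e
    using someI_ex[OF ex[OF that]] by (simp_all add: col_def)
  show ?thesis
  proof (rule that[of \<H> col])
    fix e f assume "e \<in> edges G" "f \<in> edges G" "e \<noteq> f" "crossing e f"
    then show "col e \<noteq> col f" using H(4)[of "col e"] col unfolding plane_def by metis
  qed (use H col in auto)
qed

lemma mod_window:
  fixes x y m :: int
  assumes "0 < m" "x \<le> y" "y < x + m"
  shows "y mod m = (if y - x + x mod m < m then y - x + x mod m else y - x + x mod m - m)"
proof -
  define w where "w = y - x + x mod m"
  have "0 \<le> x mod m" "x mod m < m" using assms by auto
  then have w: "0 \<le> w" "w < 2 * m" using assms unfolding w_def by linarith+
  have "w mod m = (if w < m then w else w - m)"
  proof (cases "w < m")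
    case False
    have "w mod m = (w - m) mod m" by simp
    also have "\<dots> = w - m" using w False by (intro mod_pos_pos_trivial) auto
    finally show ?thesis using False by simp
  qed (use w in simp)
  moreover have "w mod m = y mod m"
    unfolding w_def mod_add_right_eq by simp
  ultimately have "y mod m = (if w < m then w else w - m)" by simp
  then show ?thesis unfolding w_def .
qed

lemma int_div_le:
  fixes y l c :: int
  assumes "0 < l" "y < (c + 1) * l"
  shows "y div l \<le> c"
proof (rule ccontr)
  assume "\<not> y div l \<le> c"
  then have "(c + 1) * l \<le> (y div l) * l" using assms(1) by (intro mult_right_mono) auto
  also have "\<dots> \<le> y" using assms(1) by (simp add: minus_mod_eq_div_mult[symmetric])
  finally show False using assms(2) by simp
qed

lemma int_le_div:
  fixes x l g :: int
  assumes "0 < l" "g * l \<le> x"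
  shows "g \<le> x div l"
  using zdiv_mono1[OF assms(2,1)] assms(1) by simp

context
  fixes k l :: nat and v :: complex and V :: "complex set" and p :: "nat \<Rightarrow> complex"
  assumes wi: "wheel_indexing k l v V p" and odd_k: "odd k" and l_pos: "0 < l"
begin

definition pt :: "int \<Rightarrow> complex" where
  "pt x = p (nat (x mod int (k * l)))"

lemma kl_pos: "0 < int (k * l)"
  using odd_pos[OF odd_k] l_pos by simp

lemma pt_periodic: "pt (x + int (k * l)) = pt x"
  by (simp add: pt_def)

lemma pt_bound: "nat (x mod int (k * l)) < k * l"
  using kl_pos by (metis nat_int nat_mono_iff pos_mod_bound)

lemma pt_in: "pt x \<in> V" "pt x \<noteq> v"
  using indexed_points(3,4)[OF wi odd_k pt_bound] by (simp_all add: pt_def)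

lemma pt_neq:
  assumes "x < y" "y < x + int (k * l)"
  shows "pt x \<noteq> pt y"
proof
  assume "pt x = pt y"
  then have "nat (x mod int (k * l)) = nat (y mod int (k * l))"
    using indexed_points(6)[OF wi odd_k pt_bound pt_bound] by (simp add: pt_def)
  moreover have "0 \<le> x mod int (k * l)" "0 \<le> y mod int (k * l)" using kl_pos by auto
  ultimately have "x mod int (k * l) = y mod int (k * l)" by simp
  then show False using mod_window[of "int (k * l)" x y] assms kl_pos by (auto split: if_splits)
qed

lemma crossing_ordered:
  fixes a b c d :: int
  assumes "0 \<le> a" "a < b" "b < c" "c < d" "d < int (k * l)"
  shows "crossing {p (nat a), p (nat c)} {p (nat b), p (nat d)}"
proof -
  have "nat a < nat c" "nat c < k * l" "nat b < nat d" "nat d < k * l" "{nat a, nat c} \<noteq> {nat b, nat d}"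
    "nat a < nat b" "nat b < nat c" "nat c < nat d"
    using assms by (auto simp: doubleton_eq_iff nat_less_iff simp del: of_nat_mult)
  then show ?thesis
    using chord_crossing_iff[OF wi odd_k, of "nat a" "nat c" "nat b" "nat d"] by simp
qed

lemma pt_chords_cross:
  assumes "x < z" "z < y" "y < u" "u < x + int (k * l)"
  shows "crossing {pt x, pt y} {pt z, pt u}"
proof -
  define m where "m = int (k * l)"
  have m: "0 < m" "0 \<le> x mod m" "x mod m < m" using kl_pos by (auto simp: m_def)
  note w = mod_window[of m x]
  have pt: "pt w = p (nat (w mod m))" for w by (simp add: pt_def m_def)
  let ?a = "x mod m" and ?b = "y mod m" and ?c = "z mod m" and ?d = "u mod m"
  \<comment> \<open>Reduction modulo \<open>m\<close> preserves the cyclic order \<open>x\<close>,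
    \<open>z\<close>, \<open>y\<close>, \<open>u\<close>, so the residues appear in one of its four
    rotations.\<close>
  consider "?a < ?c" "?c < ?b" "?b < ?d" | "?d < ?a" "?a < ?c" "?c < ?b"
    | "?b < ?d" "?d < ?a" "?a < ?c" | "?c < ?b" "?b < ?d" "?d < ?a"
  proof -
    have m': "y < x + m" "z < x + m" "u < x + m" using assms by (simp_all add: m_def)
    define a where "a = x mod m"
    have "?b = (if y - x + a < m then y - x + a else y - x + a - m)"
      "?c = (if z - x + a < m then z - x + a else z - x + a - m)"
      "?d = (if u - x + a < m then u - x + a else u - x + a - m)" "?a = a" "0 \<le> a" "a < m"
      using w[of y] w[of z] w[of u] m m' assms by (simp_all add: a_def)
    then have "(?a < ?c \<and> ?c < ?b \<and> ?b < ?d) \<or> (?d < ?a \<and> ?a < ?c \<and> ?c < ?b)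
      \<or> (?b < ?d \<and> ?d < ?a \<and> ?a < ?c) \<or> (?c < ?b \<and> ?b < ?d \<and> ?d < ?a)"
      using assms m' by (smt (verit))
    then show ?thesis using that by blast
  qed
  moreover have bd: "0 \<le> ?a" "0 \<le> ?b" "0 \<le> ?c" "0 \<le> ?d" "?a < m" "?b < m" "?c < m" "?d < m"
    using m by auto
  ultimately show ?thesis
    unfolding pt
  proof cases
    case 1
    then show "crossing {p (nat ?a), p (nat ?b)} {p (nat ?c), p (nat ?d)}"
      using bd by (intro crossing_ordered) (simp_all only: m_def[symmetric])
  next
    case 2
    then have "crossing {p (nat ?d), p (nat ?c)} {p (nat ?a), p (nat ?b)}"
      using bd by (intro crossing_ordered) (simp_all only: m_def[symmetric])
    then show "crossing {p (nat ?a), p (nat ?b)} {p (nat ?c), p (nat ?d)}"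
      by (metis insert_commute crossing_commute)
  next
    case 3
    then have "crossing {p (nat ?b), p (nat ?a)} {p (nat ?d), p (nat ?c)}"
      using bd by (intro crossing_ordered) (simp_all only: m_def[symmetric])
    then show "crossing {p (nat ?a), p (nat ?b)} {p (nat ?c), p (nat ?d)}"
      by (metis insert_commute)
  next
    case 4
    then have "crossing {p (nat ?c), p (nat ?d)} {p (nat ?b), p (nat ?a)}"
      using bd by (intro crossing_ordered) (simp_all only: m_def[symmetric])
    then show "crossing {p (nat ?a), p (nat ?b)} {p (nat ?c), p (nat ?d)}"
      by (metis insert_commute crossing_commute)
  qed
qed

text \<open>Shift by a multiple of \<open>m\<close> so that \<open>x\<close> becomes its residue. If
  \<open>y\<close> stays below \<open>m\<close>, the chord spans less than a half turn in index
  order and \<open>z\<close> lies inside. If \<open>y\<close> wraps around, the ends swap, the index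
  interval spans more than a half turn, and \<open>z\<close> lies outside.\<close>

lemma pt_spoke_crosses:
  assumes "int l dvd G" "G \<le> x" "x < z" "z < y" "y < G + int (k div 2 * l) + int l"
  shows "crossing {pt x, pt y} {v, pt z}"
proof -
  define m where "m = int (k * l)"
  define t where "t = x - x mod m"
  have m: "0 < m" "0 \<le> x mod m" "x mod m < m" using kl_pos by (auto simp: m_def)
  have k: "int k = 2 * int (k div 2) + 1" using odd_k by presburger
  obtain g where g: "G = int l * g" using assms(1) by (elim dvdE)
  have "t = m * (x div m)" unfolding t_def by (simp add: minus_mod_eq_mult_div)
  then have t: "t = int l * (int k * (x div m))" by (simp add: m_def)
  define g' where "g' = g - int k * (x div m)"
  have G': "g' * int l \<le> x mod m" "y - t < (g' + int (k div 2) + 1) * int l"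
    using assms g t by (simp_all add: g'_def t_def algebra_simps)
  have len: "y < x + m"
  proof -
    have "int (k div 2 * l) + int l \<le> m"
      unfolding m_def of_nat_mult k by (simp add: algebra_simps)
    then show ?thesis using assms by simp
  qed
  have pt: "pt w = p (nat (w mod m))" for w by (simp add: pt_def m_def)
  have bd: "nat (w mod m) < k * l" "0 \<le> w mod m" for w using pt_bound m by (simp_all add: m_def)
  have wy: "y mod m = (if y - t < m then y - t else y - t - m)"
    and wz: "z mod m = (if z - t < m then z - t else z - t - m)"
    using mod_window[of m x y] mod_window[of m x z] m len assms by (simp_all add: t_def)
  have dx: "g' \<le> (x mod m) div int l"
    using G'(1) l_pos by (intro int_le_div) simp_all
  have nd: "int (nat (w mod m) div l) = (w mod m) div int l" for w
    using bd(2)[of w] by (simp add: zdiv_int)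
  show ?thesis
  proof (cases "y - t < m")
    case True
    have "(y mod m) div int l \<le> g' + int (k div 2)"
      using True G'(2) l_pos by (intro int_div_le) (simp_all add: wy)
    then have "int (nat (y mod m) div l) \<le> int (nat (x mod m) div l) + int (k div 2)"
      using dx by (simp add: nd)
    then have near: "2 * (nat (y mod m) div l - nat (x mod m) div l) < k" using k by linarith
    have "nat (x mod m) < nat (z mod m)" "nat (z mod m) < nat (y mod m)"
      using True wy wz assms m by (auto simp: t_def)
    then show ?thesis
      unfolding pt using chord_crossing_spoke_iff[OF wi odd_k _ bd(1) bd(1), of "nat (x mod m)" y z] near
      by simp
  next
    case False
    have "y - t - m < (g' + int (k div 2) + 1 - int k) * int l"
      using G'(2) by (simp add: m_def algebra_simps)
    then have "(y mod m) div int l \<le> g' + int (k div 2) - int k"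
      using False l_pos by (intro int_div_le) (simp_all add: wy algebra_simps)
    then have "int (nat (y mod m) div l) + int k \<le> int (nat (x mod m) div l) + int (k div 2)"
      using dx by (simp add: nd)
    then have far: "\<not> 2 * (nat (x mod m) div l - nat (y mod m) div l) < k" using k by linarith
    have "nat (y mod m) < nat (x mod m)" "nat (x mod m) < nat (z mod m) \<or> nat (z mod m) < nat (y mod m)"
      using False wy wz assms m len by (auto simp: t_def split: if_splits)
    then show ?thesis
      unfolding pt using chord_crossing_spoke_iff[OF wi odd_k _ bd(1) bd(1), of "nat (y mod m)" x z] far
      by (auto simp: insert_commute)
  qed
qed

end

lemma not_plane_partitionable:
  assumes wi: "wheel_indexing k l v (verts G) p" and G: "edges G = all_edges (verts G)"
    and "odd k" "odd l" "3 \<le> k" "5 \<le> l" "l > 5 \<or> k > 3" "n = (k * l + 1) div 2"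
  shows "\<not> plane_partitionable G n"
proof
  assume "plane_partitionable G n"
  then obtain C :: "geom_graph set" and col where C: "finite C" "card C = n"
    and col: "\<And>e. e \<in> edges G \<Longrightarrow> col e \<in> C"
    "\<And>e f. \<lbrakk>e \<in> edges G; f \<in> edges G; e \<noteq> f; crossing e f\<rbrakk> \<Longrightarrow> col e \<noteq> col f"
    by (rule plane_partition_colouring) blast
  have l0: "0 < l" using assms by simp
  define q r where "q = int (l div 2)" and "r = int (k div 2 * l)"
  have l: "int l = 2 * q + 1" using \<open>odd l\<close> unfolding q_def by presburger
  have k: "int k = 2 * int (k div 2) + 1" using \<open>odd k\<close> by presburger
  have m: "int (k * l) = 2 * r + 2 * q + 1"
    unfolding of_nat_mult k r_def using l by (simp add: algebra_simps)
  let ?pt = "pt k l p"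
  note pt = pt_in[OF wi \<open>odd k\<close> l0] pt_neq[OF wi \<open>odd k\<close> l0] pt_periodic[OF wi \<open>odd k\<close> l0]
  have v: "v \<in> verts G" using indexed_points(1)[OF wi \<open>odd k\<close>] .
  have spoke: "{v, ?pt x} \<in> edges G" for x
    using pt(1,2)[of x] v unfolding G all_edges_def by blast
  have chord: "{?pt x, ?pt y} \<in> edges G" if "x < y" "y < x + int (k * l)" for x y
    using pt(1)[of x] pt(1)[of y] pt(3)[OF that] unfolding G all_edges_def by blast
  have "wheel_colouring q r C (\<lambda>x y. col {?pt x, ?pt y}) (\<lambda>x. col {v, ?pt x})"
    unfolding wheel_colouring_def m[symmetric] l[symmetric]
  proof (intro conjI allI impI)
    show "2 \<le> q" using l assms by simp
    show "int l \<le> r" using assms by (simp add: r_def)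
    show "int l dvd r" by (simp add: r_def)
    have "2 * n = k * l + 1" using assms by simp
    then have "2 * int n = int (k * l) + 1" by linarith
    then show "int (card C) = r + q + 1" using C m by simp
    show "col {?pt y, ?pt (x + int (k * l))} = col {?pt x, ?pt y}" for x y
      using pt(4) by (simp add: insert_commute)
    show "col {v, ?pt (x + int (k * l))} = col {v, ?pt x}" for x
      using pt(4) by simp
    show "col {?pt x, ?pt y} \<in> C" if "x < y" "y < x + int (k * l)" for x y
      using col(1) chord that by blast
    show "col {v, ?pt x} \<in> C" for x using col(1) spoke by blast
    show "col {?pt x, ?pt y} \<noteq> col {?pt z, ?pt u}"
      if "x < z" "z < y" "y < u" "u < x + int (k * l)" for x y z u
    proof (rule col(2))
      show "crossing {?pt x, ?pt y} {?pt z, ?pt u}"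
        by (rule pt_chords_cross[OF wi \<open>odd k\<close> l0 that])
      have "?pt x \<noteq> ?pt z" "?pt z \<noteq> ?pt y" using pt(3) that by force+
      then show "{?pt x, ?pt y} \<noteq> {?pt z, ?pt u}" by (auto simp: doubleton_eq_iff)
    qed (use chord that in auto)
    show "col {?pt x, ?pt y} \<noteq> col {v, ?pt z}"
      if "int l dvd G'" "G' \<le> x" "x < z" "z < y" "y < G' + r + int l" for G' x y z
    proof (rule col(2))
      show "crossing {?pt x, ?pt y} {v, ?pt z}"
        by (rule pt_spoke_crosses[OF wi \<open>odd k\<close> l0 that[unfolded r_def]])
      show "{?pt x, ?pt y} \<noteq> {v, ?pt z}" using pt(2) by (auto simp: doubleton_eq_iff)
      have "0 \<le> r" by (simp add: r_def)
      then have "y < x + int (k * l)" using that m l by linarith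
      then show "{?pt x, ?pt y} \<in> edges G" using chord that by simp
      show "{v, ?pt z} \<in> edges G" by (rule spoke)
    qed
  qed (rule C)
  then interpret wheel_colouring q r C "\<lambda>x y. col {?pt x, ?pt y}" "\<lambda>x. col {v, ?pt x}" .
  show False
  proof (rule impossible)
    show "2 * (2 * q + 1) \<le> r \<or> r = 2 * q + 1 \<and> 3 \<le> q"
    proof (cases "k = 3")
      case True
      then show ?thesis using assms l by (auto simp: r_def q_def)
    next
      case False
      then have "2 \<le> k div 2" using assms by presburger
      then have "2 * l \<le> k div 2 * l" by simp
      then have "int (2 * l) \<le> r" unfolding r_def by (simp only: of_nat_le_iff)
      then show ?thesis using l by simp
    qed
  qed
qed

section \<open>Plane partitions\<close>

text \<open>Each colour has to occur on a chord so that the \<open>n\<close> colour classes are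
  different subgraphs, since a partition is a set whose cardinality counts.\<close>

definition plane_colouring ::
  "nat \<Rightarrow> nat \<Rightarrow> nat \<Rightarrow> (nat \<Rightarrow> nat \<Rightarrow> nat) \<Rightarrow> (nat \<Rightarrow> nat) \<Rightarrow> bool" where
  "plane_colouring k l n c d \<longleftrightarrow>
     (\<forall>b<k * l. \<forall>a<b. c a b < n) \<and> (\<forall>x<k * l. d x < n) \<and>
     (\<forall>i<n. \<exists>b<k * l. \<exists>a<b. c a b = i) \<and>
     (\<forall>b<k * l. \<forall>j<b. \<forall>a<j. \<forall>i<a. c i j \<noteq> c a b) \<and>
     (\<forall>j<k * l. \<forall>i<j. \<forall>x<k * l.
        (if 2 * (j div l - i div l) < k then i < x \<and> x < j else x < i \<or> j < x) \<longrightarrow> c i j \<noteq> d x)"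

lemma plane_partitionable_if_colouring:
  assumes wi: "wheel_indexing k l v (verts G) p" and odd_k: "odd k"
    and G: "edges G = all_edges (verts G)" and col: "plane_colouring k l n c d" and "0 < n"
  shows "plane_partitionable G n"
proof -
  define ch where "ch i = {{p a, p b} | a b. a < b \<and> b < k * l \<and> c a b = i}" for i
  define sp where "sp i = {{v, p x} | x. x < k * l \<and> d x = i}" for i
  define H where "H i = \<lparr>verts = verts G, edges = ch i \<union> sp i\<rparr>" for i
  note pts = indexed_points[OF wi odd_k]
  have c_less: "c a b < n" if "a < b" "b < k * l" for a b
    using col that by (simp add: plane_colouring_def)
  have d_less: "d x < n" if "x < k * l" for x
    using col that by (simp add: plane_colouring_def)
  have c_surj: "\<exists>b<k * l. \<exists>a<b. c a b = i" if "i < n" for i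
    using col that by (simp add: plane_colouring_def)
  have c_c: "c i j \<noteq> c a b" if "i < a" "a < j" "j < b" "b < k * l" for i j a b
    using col that by (simp add: plane_colouring_def)
  have c_d: "c i j \<noteq> d x" if "i < j" "j < k * l" "x < k * l"
    "if 2 * (j div l - i div l) < k then i < x \<and> x < j else x < i \<or> j < x" for i j x
    using col that unfolding plane_colouring_def by (elim conjE) metis
  have chord_eq: "a = a' \<and> b = b'"
    if "{p a, p b} = {p a', p b'}" "a < b" "b < k * l" "a' < b'" "b' < k * l" for a b a' b'
    using that pts(6)[of a a'] pts(6)[of a b'] pts(6)[of b a'] pts(6)[of b b']
    by (simp add: doubleton_eq_iff) linarith
  have spoke_eq: "x = x'" if "{v, p x} = {v, p x'}" "x < k * l" "x' < k * l" for x x'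
    using that pts(4)[of x'] pts(6)[of x x'] by (simp add: doubleton_eq_iff)
  have mixed: "{p a, p b} \<noteq> {v, p x}" if "a < b" "b < k * l" for a b x
    using that pts(4)[of a] pts(4)[of b] by (simp add: doubleton_eq_iff)
  have "i = j" if "e \<in> ch i" "e \<in> ch j" for e i j
  proof -
    obtain a b where "e = {p a, p b}" "a < b" "b < k * l" "c a b = i" using \<open>e \<in> ch i\<close> unfolding ch_def by blast
    moreover obtain a' b' where "e = {p a', p b'}" "a' < b'" "b' < k * l" "c a' b' = j"
      using \<open>e \<in> ch j\<close> unfolding ch_def by blast
    ultimately show ?thesis using chord_eq[of a b a' b'] by simp
  qed
  moreover have "i = j" if "e \<in> sp i" "e \<in> sp j" for e i j
  proof -
    obtain x where "e = {v, p x}" "x < k * l" "d x = i" using \<open>e \<in> sp i\<close> unfolding sp_def by blast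
    moreover obtain x' where "e = {v, p x'}" "x' < k * l" "d x' = j"
      using \<open>e \<in> sp j\<close> unfolding sp_def by blast
    ultimately show ?thesis using spoke_eq[of x x'] by simp
  qed
  moreover have "\<not> (e \<in> ch i \<and> e \<in> sp j)" for e i j
    using mixed unfolding ch_def sp_def by blast
  ultimately have disj: "(ch i \<union> sp i) \<inter> (ch j \<union> sp j) = {}" if "i \<noteq> j" for i j
    using that by blast
  have nonempty: "ch i \<noteq> {}" if "i < n" for i
    using c_surj[OF that] unfolding ch_def by blast
  have inj: "inj_on H {..<n}"
  proof (rule inj_onI, rule ccontr)
    fix i j assume "i \<in> {..<n}" "j \<in> {..<n}" "H i = H j" "i \<noteq> j"
    then show False using disj[of i j] nonempty[of i] by (auto simp: H_def)
  qed
  have V: "verts G = insert v (p ` {..<k * l})"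
    using wi unfolding wheel_indexing_def bij_betw_def by blast
  have "e \<in> (\<Union>i<n. ch i \<union> sp i)" if e: "e \<in> edges G" for e
  proof -
    obtain x y where xy: "e = {x, y}" "x \<in> verts G" "y \<in> verts G" "x \<noteq> y"
      using e unfolding G all_edges_def by blast
    have spoke: "{v, z} \<in> (\<Union>i<n. ch i \<union> sp i)" if z: "z \<in> verts G" "z \<noteq> v" for z
    proof -
      obtain a where "a < k * l" "z = p a" using z V by auto
      then have "{v, z} \<in> sp (d a)" "d a < n"
        using d_less[of a] unfolding sp_def by blast+
      then show ?thesis by blast
    qed
    have chord: "{p a, p b} \<in> (\<Union>i<n. ch i \<union> sp i)" if "a < b" "b < k * l" for a b
    proof -
      have "{p a, p b} \<in> ch (c a b)" "c a b < n"
        using c_less[OF that] that unfolding ch_def by blast+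
      then show ?thesis by blast
    qed
    show ?thesis
    proof (cases "x = v \<or> y = v")
      case True
      then show ?thesis using xy spoke[of x] spoke[of y] by (auto simp: insert_commute)
    next
      case False
      then obtain a b where ab: "a < k * l" "x = p a" "b < k * l" "y = p b" using xy V by auto
      then have "a < b \<or> b < a" using xy by (metis linorder_neqE_nat)
      then show ?thesis using ab xy chord[of a b] chord[of b a] by (metis insert_commute)
    qed
  qed
  moreover have sub: "ch i \<union> sp i \<subseteq> edges G" for i
  proof -
    have "{p a, p b} \<in> edges G" if "a < b" "b < k * l" for a b
    proof -
      have "p a \<in> verts G" "p b \<in> verts G" "p a \<noteq> p b"
        using that pts(3)[of a] pts(3)[of b] pts(6)[of a b] by simp_all
      then show ?thesis unfolding G all_edges_def by blast
    qed
    moreover have "{v, p x} \<in> edges G" if "x < k * l" for x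
      using pts(1) pts(3)[OF that] pts(7)[OF that] unfolding G all_edges_def by blast
    ultimately show ?thesis unfolding ch_def sp_def by blast
  qed
  ultimately have E: "(\<Union>i<n. ch i \<union> sp i) = edges G" by blast
  have part: "graph_partition (H ` {..<n}) G"
    unfolding graph_partition_def
  proof (intro conjI)
    show "\<forall>K\<in>H ` {..<n}. subgraph K G"
      using sub by (auto simp: subgraph_def H_def G)
    show "pairwise (\<lambda>H K. edges H \<inter> edges K = {}) (H ` {..<n})"
    proof (rule pairwiseI)
      fix A B assume "A \<in> H ` {..<n}" "B \<in> H ` {..<n}" "A \<noteq> B"
      then obtain i j where "A = H i" "B = H j" "i \<noteq> j" by blast
      then show "edges A \<inter> edges B = {}" using disj[of i j] by (simp add: H_def)
    qed
    show "(\<Union>K\<in>H ` {..<n}. verts K) = verts G"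
      using \<open>0 < n\<close> by (auto simp: H_def)
    show "(\<Union>K\<in>H ` {..<n}. edges K) = edges G"
      using E by (simp add: H_def)
  qed
  have ncc: "\<not> crossing {p i, p j} {p a, p b}"
    if "i < j" "j < k * l" "a < b" "b < k * l" "c i j = c a b" "{p i, p j} \<noteq> {p a, p b}" for i j a b
  proof
    assume "crossing {p i, p j} {p a, p b}"
    moreover have "{i, j} \<noteq> {a, b}" using that by (auto simp: doubleton_eq_iff)
    ultimately have "i < a \<and> a < j \<and> j < b \<or> a < i \<and> i < b \<and> b < j"
      using chord_crossing_iff[OF wi odd_k] that by blast
    then show False using c_c that by metis
  qed
  have ncs: "\<not> crossing {p i, p j} {v, p x}" if "i < j" "j < k * l" "x < k * l" "c i j = d x" for i j x
    using chord_crossing_spoke_iff[OF wi odd_k that(1-3)] c_d[OF that(1-3)] that(4) by metis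
  have nss: "\<not> crossing {v, p x} {v, p y}" if "x < k * l" "y < k * l" "{v, p x} \<noteq> {v, p y}" for x y
    using spokes_not_crossing[OF wi odd_k, of x y] that by auto
  have plane: "plane (H i)" for i
    unfolding plane_def H_def
  proof (simp, intro ballI impI)
    fix e f assume ef: "e \<in> ch i \<union> sp i" "f \<in> ch i \<union> sp i" "e \<noteq> f"
    consider a b a' b' where "e = {p a, p b}" "f = {p a', p b'}" "a < b" "b < k * l" "c a b = i"
        "a' < b'" "b' < k * l" "c a' b' = i"
      | a b x where "e = {p a, p b}" "f = {v, p x}" "a < b" "b < k * l" "c a b = i" "x < k * l" "d x = i"
      | a b x where "f = {p a, p b}" "e = {v, p x}" "a < b" "b < k * l" "c a b = i" "x < k * l" "d x = i"
      | x y where "e = {v, p x}" "f = {v, p y}" "x < k * l" "y < k * l"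
      using ef unfolding ch_def sp_def by blast
    then show "\<not> crossing e f"
    proof cases
      case 1 then show ?thesis using ncc ef by simp
    next
      case 2 then show ?thesis using ncs by simp
    next
      case 3 then show ?thesis using ncs by (subst crossing_commute) simp
    next
      case 4 then show ?thesis using nss ef by simp
    qed
  qed
  show ?thesis
    unfolding plane_partitionable_def using part plane inj
    by (intro exI[of _ "H ` {..<n}"]) (auto simp: card_image)
qed

text \<open>For \<^term>\<open>i < h\<close> the colour \<^term>\<open>i\<close> is a double star: the edges from \<^term>\<open>i\<close> to the next
  \<^term>\<open>h\<close> points, those from \<^term>\<open>i + h + 1\<close> to the next \<^term>\<open>h - 1\<close> points, the longest chord
  that starts at \<^term>\<open>i + h\<close>, and the spoke to \<^term>\<open>i + h\<close>. The colour \<^term>\<open>h\<close> gets what remains: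
  half of the spokes, a star at \<^term>\<open>h\<close> and one longest chord.\<close>

definition star_chord_colour :: "nat \<Rightarrow> nat \<Rightarrow> nat \<Rightarrow> nat" where
  "star_chord_colour h a b =
    (if b \<le> a + h then if a < h then a else if a = h then if b = 2 * h then 0 else h else a - h - 1
     else if b = a + h + 1 then if b = 2 * h then h else a + 1 else b - h - 1)"

definition star_spoke_colour :: "nat \<Rightarrow> nat \<Rightarrow> nat" where
  "star_spoke_colour h x = (if h \<le> x \<and> x < 2 * h then x - h else h)"

text \<open>With \<open>c\<close> for the colour, \<open>b = c + h + 1\<close> and
  \<open>a < c\<close> describe the part of the second star that wraps past index 0. The chord from
  \<open>a = c - 1\<close> to \<open>b = c + h\<close> is the longest chord starting at
  \<open>c + h\<close>; for \<open>c = 0\<close> it does not wrap and ends at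
  \<open>2 * h\<close>.\<close>

lemma star_chord_class:
  assumes "a < b" "b \<le> 2 * h"
  shows "star_chord_colour h a b < h \<and>
      (a = star_chord_colour h a b \<and> b \<le> a + h \<or> a = star_chord_colour h a b + h + 1 \<or>
       b = star_chord_colour h a b + h + 1 \<and> a < star_chord_colour h a b \<or>
       star_chord_colour h a b = a + 1 \<and> b = a + h + 1 \<or>
       star_chord_colour h a b = 0 \<and> a = h \<and> b = 2 * h) \<or>
    star_chord_colour h a b = h \<and> (a = h \<and> b < 2 * h \<or> a + 1 = h \<and> b = 2 * h)"
proof -
  consider "b \<le> a + h" "a < h" | "a = h" "b = 2 * h" | "a = h" "b < 2 * h" | "b \<le> a + h" "h < a"
    | "b = a + h + 1" "b = 2 * h" | "b = a + h + 1" "b < 2 * h" | "a + h + 1 < b"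
    using assms by linarith
  then show ?thesis
    using assms by cases (simp_all add: star_chord_colour_def less_diff_conv less_diff_conv2)
qed

lemma star_spoke_class:
  "star_spoke_colour h x < h \<and> x = star_spoke_colour h x + h \<or>
   star_spoke_colour h x = h \<and> (x < h \<or> 2 * h \<le> x)"
  by (auto simp: star_spoke_colour_def)

lemma star_chords_compatible:
  assumes "i < a" "a < j" "j < b" "b \<le> 2 * h"
  shows "star_chord_colour h i j \<noteq> star_chord_colour h a b"
proof
  define c where "c = star_chord_colour h a b"
  assume "star_chord_colour h i j = star_chord_colour h a b"
  then have "c < h \<and> (i = c \<and> j \<le> i + h \<or> i = c + h + 1 \<or> j = c + h + 1 \<and> i < c \<or>
       c = i + 1 \<and> j = i + h + 1 \<or> c = 0 \<and> i = h \<and> j = 2 * h) \<or>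
    c = h \<and> (i = h \<and> j < 2 * h \<or> i + 1 = h \<and> j = 2 * h)"
    using star_chord_class[of i j h] assms by (simp add: c_def)
  moreover have "c < h \<and> (a = c \<and> b \<le> a + h \<or> a = c + h + 1 \<or> b = c + h + 1 \<and> a < c \<or>
       c = a + 1 \<and> b = a + h + 1 \<or> c = 0 \<and> a = h \<and> b = 2 * h) \<or>
    c = h \<and> (a = h \<and> b < 2 * h \<or> a + 1 = h \<and> b = 2 * h)"
    unfolding c_def by (rule star_chord_class) (use assms in simp_all)
  ultimately show False
    using assms by (elim disjE conjE) linarith+
qed

text \<open>The last premise keeps only what the length of a chord says about the side of the
  centre. Lengths \<open>h\<close> and \<open>h + 1\<close> leave the side open, so such chords must
  avoid the spokes on both sides; only for the longest chord of colour \<open>h\<close> is the side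
  prescribed.\<close>

lemma star_spokes_compatible:
  assumes "i < j" "j \<le> 2 * h" "x \<le> 2 * h"
    and "i < x \<and> x < j \<and> j \<le> i + h + 1 \<or> (x < i \<or> j < x) \<and> i + h \<le> j \<and> \<not> (j = 2 * h \<and> i + 1 = h)"
  shows "star_chord_colour h i j \<noteq> star_spoke_colour h x"
proof
  define c where "c = star_chord_colour h i j"
  assume "star_chord_colour h i j = star_spoke_colour h x"
  then have "c < h \<and> x = c + h \<or> c = h \<and> (x < h \<or> 2 * h \<le> x)"
    using star_spoke_class[of h x] by (simp add: c_def)
  moreover have "c < h \<and> (i = c \<and> j \<le> i + h \<or> i = c + h + 1 \<or> j = c + h + 1 \<and> i < c \<or>
       c = i + 1 \<and> j = i + h + 1 \<or> c = 0 \<and> i = h \<and> j = 2 * h) \<or>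
    c = h \<and> (i = h \<and> j < 2 * h \<or> i + 1 = h \<and> j = 2 * h)"
    unfolding c_def by (rule star_chord_class) (use assms in simp_all)
  ultimately show False
    using assms by (elim disjE conjE) linarith+
qed

lemma star_colouring:
  assumes "odd k"
  defines "h \<equiv> (3 * k) div 2"
  shows "plane_colouring k 3 (h + 1) (star_chord_colour h) (star_spoke_colour h)"
proof -
  obtain k' where k': "k = 2 * k' + 1" using assms(1) by (elim oddE)
  have h: "h = 3 * k' + 1" by (simp add: h_def k')
  have kl: "k * 3 = 2 * h + 1" by (simp add: h k')
  show ?thesis
    unfolding plane_colouring_def kl
  proof (intro conjI allI impI)
    fix a b assume "b < 2 * h + 1" "a < b"
    then show "star_chord_colour h a b < h + 1" by (auto simp: star_chord_colour_def)
  next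
    fix x show "star_spoke_colour h x < h + 1" by (auto simp: star_spoke_colour_def)
  next
    fix i assume i: "i < h + 1"
    then show "\<exists>b<2 * h + 1. \<exists>a<b. star_chord_colour h a b = i"
    proof (cases "i < h")
      case True
      then show ?thesis
        by (intro exI[of _ "i + 1"] conjI exI[of _ i]) (auto simp: star_chord_colour_def)
    next
      case False
      then show ?thesis using i h
        by (intro exI[of _ "2 * h"] conjI exI[of _ "h - 1"]) (auto simp: star_chord_colour_def)
    qed
  next
    fix i a j b assume "b < 2 * h + 1" "j < b" "a < j" "i < a"
    then show "star_chord_colour h i j \<noteq> star_chord_colour h a b"
      by (intro star_chords_compatible) simp_all
  next
    fix i j x assume ij: "j < 2 * h + 1" "i < j" "x < 2 * h + 1"
      and x: "if 2 * (j div 3 - i div 3) < k then i < x \<and> x < j else x < i \<or> j < x"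
    \<comment> \<open>For groups of three, lengths up to \<open>h - 1\<close> are always short of a
      half turn and lengths from \<open>h + 2\<close> on never are. In between only the chord from
      \<open>h - 1\<close> to \<open>2 * h\<close> is decided by its groups.\<close>
    have near: "2 * (j div 3 - i div 3) < k" if "j \<le> i + 3 * k'"
      using div_le_mono[OF that, of 3] k' by simp
    have near': "2 * (j div 3 - i div 3) < k" if "j = 2 * h" "i + 1 = h"
    proof -
      have "j div 3 = 2 * k'" "i div 3 = k'" using that h by presburger+
      then show ?thesis using k' by simp
    qed
    have far: "\<not> 2 * (j div 3 - i div 3) < k" if "i + 3 * (k' + 1) \<le> j"
    proof -
      have "(i + 3 * (k' + 1)) div 3 = i div 3 + (k' + 1)" by (rule trans[OF div_mult_self2]) simp_all
      then show ?thesis using div_le_mono[OF that, of 3] k' by linarith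
    qed
    show "star_chord_colour h i j \<noteq> star_spoke_colour h x"
    proof (rule star_spokes_compatible)
      show "i < x \<and> x < j \<and> j \<le> i + h + 1 \<or>
          (x < i \<or> j < x) \<and> i + h \<le> j \<and> \<not> (j = 2 * h \<and> i + 1 = h)"
      proof (cases "2 * (j div 3 - i div 3) < k")
        case True
        then have "\<not> i + 3 * (k' + 1) \<le> j" using far by blast
        then show ?thesis using x True h by simp
      next
        case False
        then have "\<not> j \<le> i + 3 * k'" "\<not> (j = 2 * h \<and> i + 1 = h)" using near near' by blast+
        then show ?thesis using x False h by simp
      qed
    qed (use ij in simp_all)
  qed
qed

text \<open>A partition for \<^term>\<open>k = 3\<close> and \<^term>\<open>l = 5\<close>, found with a SAT solver: row \<^term>\<open>a\<close> lists the colours of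
  the chords from \<^term>\<open>a\<close> to \<^term>\<open>a + 1\<close> up to \<^term>\<open>14\<close>.\<close>

definition chord_rows :: "nat list list" where
  "chord_rows =
   [[0, 2, 3, 1, 1, 1, 0, 7, 7, 7, 6, 5, 0, 0],
    [0, 3, 1, 0, 0, 0, 7, 6, 6, 6, 5, 4, 4],
    [0, 1, 0, 7, 7, 7, 6, 5, 5, 5, 4, 2],
    [0, 0, 7, 6, 6, 6, 5, 4, 4, 4, 3],
    [0, 7, 6, 5, 5, 5, 4, 3, 3, 3],
    [6, 6, 5, 4, 4, 4, 3, 2, 2],
    [0, 5, 4, 3, 3, 3, 2, 1],
    [0, 4, 3, 2, 2, 2, 1],
    [6, 3, 2, 0, 0, 1],
    [6, 2, 0, 1, 1],
    [6, 0, 1, 7],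
    [6, 1, 6],
    [6, 5],
    [6]]"

definition spoke_row :: "nat list" where
  "spoke_row = [0, 6, 2, 2, 4, 3, 1, 0, 0, 6, 5, 4, 3, 0, 1]"

text \<open>Chords cross if \<open>i < a < j < b\<close>. Once row \<open>i\<close> is cut to begin
  at the column of \<open>a + 1\<close>, both rows list the same right endpoints, so the entries to
  compare are those at an earlier place in row \<open>i\<close> and a later place in row
  \<open>a\<close>. The recursion lets the simplifier check this.\<close>

fun later_disjoint :: "nat list \<Rightarrow> nat list \<Rightarrow> bool" where
  "later_disjoint (x # xs) (y # ys) \<longleftrightarrow> x \<notin> set ys \<and> later_disjoint xs ys"
| "later_disjoint _ _ \<longleftrightarrow> True"

fun row_compatible :: "nat list \<Rightarrow> nat list list \<Rightarrow> bool" where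
  "row_compatible (x # xs) (r # rs) \<longleftrightarrow> later_disjoint xs r \<and> row_compatible xs rs"
| "row_compatible _ _ \<longleftrightarrow> True"

fun rows_compatible :: "nat list list \<Rightarrow> bool" where
  "rows_compatible (r # rs) \<longleftrightarrow> row_compatible r rs \<and> rows_compatible rs"
| "rows_compatible [] \<longleftrightarrow> True"

lemma later_disjoint_nth:
  "later_disjoint xs ys \<Longrightarrow> i < j \<Longrightarrow> i < length xs \<Longrightarrow> j < length ys \<Longrightarrow> xs ! i \<noteq> ys ! j"
proof (induction xs ys arbitrary: i j rule: later_disjoint.induct)
  case (1 x xs y ys)
  obtain j' where j: "j = Suc j'" using 1(3) by (cases j) auto
  show ?case
  proof (cases i)
    case 0
    then show ?thesis using 1 j nth_mem[of j' ys] by auto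
  next
    case (Suc i')
    then show ?thesis using 1 j by auto
  qed
qed auto

lemma row_compatible_nth:
  "row_compatible xs rs \<Longrightarrow> t < length rs \<Longrightarrow> later_disjoint (drop (Suc t) xs) (rs ! t)"
proof (induction xs rs arbitrary: t rule: row_compatible.induct)
  case (1 x xs r rs)
  then show ?case by (cases t) auto
qed auto

lemma rows_compatible_nth:
  "rows_compatible rs \<Longrightarrow> i < length rs \<Longrightarrow> row_compatible (rs ! i) (drop (Suc i) rs)"
proof (induction rs arbitrary: i rule: rows_compatible.induct)
  case (1 r rs)
  then show ?case by (cases i) auto
qed simp

lemma chord_rows_check:
  "rows_compatible chord_rows" "length chord_rows = 14" "\<forall>i<14. length (chord_rows ! i) = 14 - i"
  "\<forall>r\<in>set chord_rows. \<forall>c\<in>set r. c < 8"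
  by (simp_all add: chord_rows_def All_less_Suc numeral_eq_Suc)

lemma spoke_row_check:
  "length spoke_row = 15" "\<forall>d\<in>set spoke_row. d < 8"
  "\<forall>i<14. \<forall>t<14 - i. chord_rows ! i ! t \<notin> set (if i < 5 \<and> 9 \<le> i + t
     then take i spoke_row @ drop (i + t + 2) spoke_row else take t (drop (i + 1) spoke_row))"
  by (simp_all add: spoke_row_def chord_rows_def All_less_Suc numeral_eq_Suc)

lemma table_colouring:
  "plane_colouring 3 5 8 (\<lambda>a b. chord_rows ! a ! (b - a - 1)) (\<lambda>x. spoke_row ! x)"
  unfolding plane_colouring_def
proof (intro conjI allI impI)
  fix a b :: nat assume ab: "b < 3 * 5" "a < b"
  then have "chord_rows ! a \<in> set chord_rows" "b - a - 1 < length (chord_rows ! a)"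
    using chord_rows_check by auto
  then show "chord_rows ! a ! (b - a - 1) < 8" using chord_rows_check(4) nth_mem by blast
next
  fix x :: nat assume "x < 3 * 5"
  then show "spoke_row ! x < 8" using spoke_row_check nth_mem[of x spoke_row] by simp
next
  fix i :: nat assume "i < 8"
  \<comment> \<open>Entry \<open>i\<close> of the list is a chord of colour
    \<open>i\<close>.\<close>
  define w where "w = [(0::nat, 1), (0, 4), (0, 2), (0, 3), (1, 13), (0, 12), (0, 11), (0, 8::nat)] ! i"
  have "snd w < 15 \<and> fst w < snd w \<and> chord_rows ! fst w ! (snd w - fst w - 1) = i"
    using \<open>i < 8\<close> by (auto simp: w_def chord_rows_def less_Suc_eq numeral_eq_Suc)
  then show "\<exists>b<3 * 5. \<exists>a<b. chord_rows ! a ! (b - a - 1) = i" by auto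
next
  fix i a j b :: nat assume o: "b < 3 * 5" "j < b" "a < j" "i < a"
  have "row_compatible (chord_rows ! i) (drop (Suc i) chord_rows)"
    using rows_compatible_nth chord_rows_check o by simp
  then have "later_disjoint (drop (Suc (a - Suc i)) (chord_rows ! i)) (drop (Suc i) chord_rows ! (a - Suc i))"
    by (rule row_compatible_nth) (use chord_rows_check o in simp)
  then have "later_disjoint (drop (a - i) (chord_rows ! i)) (chord_rows ! a)"
    using o chord_rows_check(2) by (simp add: Suc_diff_Suc)
  then have "drop (a - i) (chord_rows ! i) ! (j - a - 1) \<noteq> chord_rows ! a ! (b - a - 1)"
    by (rule later_disjoint_nth) (use o chord_rows_check in auto)
  moreover have "drop (a - i) (chord_rows ! i) ! (j - a - 1) = chord_rows ! i ! (j - i - 1)"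
    using o chord_rows_check by simp
  ultimately show "chord_rows ! i ! (j - i - 1) \<noteq> chord_rows ! a ! (b - a - 1)" by simp
next
  fix i j x :: nat assume ij: "j < 3 * 5" "i < j" "x < 3 * 5"
    and x: "if 2 * (j div 5 - i div 5) < 3 then i < x \<and> x < j else x < i \<or> j < x"
  let ?t = "j - i - 1"
  \<comment> \<open>With three groups only the chords from the first group, indices below 5, to the
    last, indices from 10 on, span more than a half turn; \<open>i + ?t\<close> is
    \<open>j - 1\<close>.\<close>
  have far: "2 * (j div 5 - i div 5) < 3 \<longleftrightarrow> \<not> (i < 5 \<and> 9 \<le> i + ?t)"
  proof -
    have "j div 5 \<le> 2" "10 \<le> j \<longleftrightarrow> 2 \<le> j div 5" "i < 5 \<longleftrightarrow> i div 5 = 0" using ij by auto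
    moreover have "9 \<le> i + ?t \<longleftrightarrow> 10 \<le> j" using ij by auto
    ultimately show ?thesis by linarith
  qed
  have "chord_rows ! i ! ?t \<notin> set (if i < 5 \<and> 9 \<le> i + ?t
     then take i spoke_row @ drop (i + ?t + 2) spoke_row else take ?t (drop (i + 1) spoke_row))"
    by (rule spoke_row_check(3)[rule_format]) (use ij in simp_all)
  moreover have "spoke_row ! x \<in> set (if i < 5 \<and> 9 \<le> i + ?t
     then take i spoke_row @ drop (i + ?t + 2) spoke_row else take ?t (drop (i + 1) spoke_row))"
  proof (cases "i < 5 \<and> 9 \<le> i + ?t")
    case True
    then have "x < i \<or> j < x" using x far by simp
    then show ?thesis
    proof
      assume "x < i"
      then have "spoke_row ! x = take i spoke_row ! x" "x < length (take i spoke_row)"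
        using ij spoke_row_check(1) by simp_all
      then have "spoke_row ! x \<in> set (take i spoke_row)" using nth_mem by metis
      then show ?thesis using True by (simp only: if_True set_append Un_iff simp_thms)
    next
      assume "j < x"
      then have "spoke_row ! x = drop (i + ?t + 2) spoke_row ! (x - (i + ?t + 2))"
        "x - (i + ?t + 2) < length (drop (i + ?t + 2) spoke_row)"
        using ij spoke_row_check(1) by simp_all
      then have "spoke_row ! x \<in> set (drop (i + ?t + 2) spoke_row)" using nth_mem by metis
      then show ?thesis using True by (simp only: if_True set_append Un_iff simp_thms)
    qed
  next
    case False
    then have "i < x" "x < j" using x far by simp_all
    then have "spoke_row ! x = take ?t (drop (i + 1) spoke_row) ! (x - (i + 1))"
      "x - (i + 1) < length (take ?t (drop (i + 1) spoke_row))"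
      using ij spoke_row_check(1) by simp_all
    then have "spoke_row ! x \<in> set (take ?t (drop (i + 1) spoke_row))" using nth_mem by metis
    then show ?thesis by (simp only: False if_False)
  qed
  ultimately show "chord_rows ! i ! ?t \<noteq> spoke_row ! x" by metis
qed

theorem theorem2:
  fixes k l n :: nat and v0 w :: complex
  assumes "odd k" and "odd l" and "k \<ge> 3" and "l \<ge> 3"
    and "n = (k * l + 1) div 2"
    and "w \<noteq> 0"
  shows "\<forall>\<^sub>F \<epsilon> in at_right (0::real). \<forall>G. bumpy_wheel k l v0 w \<epsilon> G \<longrightarrow>
           (\<not> plane_partitionable G n \<longleftrightarrow> l > 5 \<or> (l = 5 \<and> k > 3))"
  using eventually_small_bumps[OF \<open>w \<noteq> 0\<close> \<open>odd k\<close>, of v0]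
proof eventually_elim
  case (elim \<epsilon>)
  show ?case
  proof (intro allI impI)
    fix G assume bw: "bumpy_wheel k l v0 w \<epsilon> G"
    have "0 < l" using assms by simp
    then obtain p where wi: "wheel_indexing k l v0 (verts G) p"
      using bumpy_wheel_indexing[OF bw elim] \<open>odd k\<close> by blast
    have G: "edges G = all_edges (verts G)"
      using bw by (simp add: bumpy_wheel_def complete_geometric_graph_def)
    consider "l = 3" | "l = 5" "k = 3" | "5 \<le> l" "l > 5 \<or> k > 3"
    proof -
      have "l = 3 \<or> 5 \<le> l" using \<open>odd l\<close> \<open>l \<ge> 3\<close> by presburger
      then show ?thesis using that \<open>k \<ge> 3\<close> by linarith
    qed
    then show "\<not> plane_partitionable G n \<longleftrightarrow> l > 5 \<or> (l = 5 \<and> k > 3)"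
    proof cases
      case 1
      have "n = (3 * k) div 2 + 1" using assms(1,5) 1 by presburger
      then have "plane_partitionable G n"
        using plane_partitionable_if_colouring[OF wi \<open>odd k\<close> G] star_colouring[OF \<open>odd k\<close>] 1 by auto
      then show ?thesis using 1 by simp
    next
      case 2
      have "plane_partitionable G n"
        using plane_partitionable_if_colouring[OF wi \<open>odd k\<close> G] table_colouring 2 assms(5) by auto
      then show ?thesis using 2 by simp
    next
      case 3
      then have "\<not> plane_partitionable G n"
        using not_plane_partitionable[OF wi G] assms by blast
      then show ?thesis using 3 by auto
    qed
  qed
qed

end
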